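(* Let $p\in(0,1)$ and $b>0$. Let $\Omega\subset\mathbb{R}^N$ be a bounded uniformly convex domain, i.e. there exist $R>0$ and $Y\subset\mathbb{R}^N$ with $\Omega=\bigcap_{y\in Y}B_R(y)$. Let $f\in C(\Omega)\cap L^\infty(\Omega)$ with $\inf_\Omega f>0$. Then there exists a unique convex viscosity solution $u\in C(\overline\Omega)$ of $$\left(\det(D^2u)\right)^{\frac1N}=f(x)+b|Du|^p\ \text{ in }\Omega,\qquad u=0\ \text{ on }\partial\Omega.$$
   Context: $B_R(y)$ is the open ball of radius $R$ and center $y$. The Monge–Ampère operator $X\mapsto(\det X)^{1/N}$ is considered only on nonnegative symmetric matrices $X\ge0$, and (sub/super)solutions are sought in the class of convex functions. A convex function $u$ in $\Omega$ is a viscosity subsolution of the equation if, whenever $x_0\in\Omega$, $\psi\in C^2(\Omega)$ and $u-\psi$ has a local maximum at $x_0$ (so that $D^2\psi(x_0)\ge0$), one has $(\det D^2\psi(x_0))^{1/N}\ge f(x_0)+b|D\psi(x_0)|^p$. It is a viscosity supersolution if, whenever $x_0\in\Omega$, $\psi\in C^2(\Omega)$, $u-\psi$ has a local minimum at $x_0$ and $D^2\psi(x_0)\ge0$, one has $(\det D^2\psi(x_0))^{1/N}\le f(x_0)+b|D\psi(x_0)|^p$. A solution of the Dirichlet problem is a convex $u\in C(\overline\Omega)$ that is both a subsolution and a supersolution and vanishes on $\partial\Omega$. *)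

theory Defs
  imports "HOL-Analysis.Analysis"
begin

definition grad :: "(real ^ 'n \<Rightarrow> real) \<Rightarrow> real ^ 'n \<Rightarrow> real ^ 'n" where
  "grad \<psi> x = (\<chi> i. frechet_derivative \<psi> (at x) (axis i 1))"

definition hessian :: "(real ^ 'n \<Rightarrow> real) \<Rightarrow> real ^ 'n \<Rightarrow> real ^ 'n ^ 'n" where
  "hessian \<psi> x = jacobian (grad \<psi>) (at x)"

lemma grad_eqI:
  assumes "GDERIV \<psi> x :> D"
  shows "grad \<psi> x = D"
proof -
  have "frechet_derivative \<psi> (at x) = (\<lambda>h. inner h D)"
    using assms unfolding gderiv_def by (metis frechet_derivative_at)
  then show ?thesis
    by (simp add: grad_def vec_eq_iff inner_axis inner_commute)
qed

text \<open>Intended for open \<open>\<Omega>\<close>. Differentiability is Frechet differentiability, which \<open>C\<^sup>2\<close> regularity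
  implies; together with a continuous Hessian it gives continuous second partial derivatives.\<close>

definition C2_on :: "(real ^ 'n) set \<Rightarrow> (real ^ 'n \<Rightarrow> real) \<Rightarrow> bool" where
  "C2_on \<Omega> \<psi> \<longleftrightarrow>
     (\<forall>x\<in>\<Omega>. \<psi> differentiable (at x)) \<and>
     (\<forall>x\<in>\<Omega>. grad \<psi> differentiable (at x)) \<and>
     continuous_on \<Omega> (hessian \<psi>)"

definition nonneg_sym :: "real ^ 'n ^ 'n \<Rightarrow> bool" where
  "nonneg_sym X \<longleftrightarrow> transpose X = X \<and> (\<forall>v. 0 \<le> inner v (X *v v))"

definition local_max_at :: "('a::topological_space \<Rightarrow> real) \<Rightarrow> 'a \<Rightarrow> bool" where
  "local_max_at w x0 \<longleftrightarrow> eventually (\<lambda>x. w x \<le> w x0) (nhds x0)"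

definition local_min_at :: "('a::topological_space \<Rightarrow> real) \<Rightarrow> 'a \<Rightarrow> bool" where
  "local_min_at w x0 \<longleftrightarrow> eventually (\<lambda>x. w x0 \<le> w x) (nhds x0)"

text \<open>The operator \<open>X \<mapsto> (det X)\<^sup>1\<^sup>/\<^sup>N\<close>; meaningful only for \<open>X\<close> with \<open>nonneg_sym X\<close>
  (\<open>powr\<close> gives the value 0 when \<open>det X = 0\<close>).\<close>

definition monge_ampere :: "real ^ 'n ^ 'n \<Rightarrow> real" where
  "monge_ampere X = det X powr (1 / real CARD('n))"

text \<open>In the subsolution condition \<open>nonneg_sym (hessian \<psi> x0)\<close> need not be required: it follows
  from the convexity of \<open>u\<close> at any point where \<open>u - \<psi>\<close> has a local maximum.\<close>

definition viscosity_subsolution ::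
  "real \<Rightarrow> real \<Rightarrow> (real ^ 'n \<Rightarrow> real) \<Rightarrow> (real ^ 'n) set \<Rightarrow> (real ^ 'n \<Rightarrow> real) \<Rightarrow> bool" where
  "viscosity_subsolution p b f \<Omega> u \<longleftrightarrow> convex_on \<Omega> u \<and>
     (\<forall>x0\<in>\<Omega>. \<forall>\<psi>. C2_on \<Omega> \<psi> \<and> local_max_at (\<lambda>x. u x - \<psi> x) x0
        \<longrightarrow> monge_ampere (hessian \<psi> x0) \<ge> f x0 + b * norm (grad \<psi> x0) powr p)"

definition viscosity_supersolution ::
  "real \<Rightarrow> real \<Rightarrow> (real ^ 'n \<Rightarrow> real) \<Rightarrow> (real ^ 'n) set \<Rightarrow> (real ^ 'n \<Rightarrow> real) \<Rightarrow> bool" where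
  "viscosity_supersolution p b f \<Omega> u \<longleftrightarrow> convex_on \<Omega> u \<and>
     (\<forall>x0\<in>\<Omega>. \<forall>\<psi>. C2_on \<Omega> \<psi> \<and> local_min_at (\<lambda>x. u x - \<psi> x) x0 \<and> nonneg_sym (hessian \<psi> x0)
        \<longrightarrow> monge_ampere (hessian \<psi> x0) \<le> f x0 + b * norm (grad \<psi> x0) powr p)"

definition dirichlet_solution ::
  "real \<Rightarrow> real \<Rightarrow> (real ^ 'n \<Rightarrow> real) \<Rightarrow> (real ^ 'n) set \<Rightarrow> (real ^ 'n \<Rightarrow> real) \<Rightarrow> bool" where
  "dirichlet_solution p b f \<Omega> u \<longleftrightarrow>
     continuous_on (closure \<Omega>) u \<and>
     viscosity_subsolution p b f \<Omega> u \<and> viscosity_supersolution p b f \<Omega> u \<and>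
     (\<forall>x\<in>frontier \<Omega>. u x = 0)"

definition uniformly_convex_set :: "('a::metric_space) set \<Rightarrow> bool" where
  "uniformly_convex_set \<Omega> \<longleftrightarrow> (\<exists>R>0. \<exists>Y. \<Omega> = (\<Inter>y\<in>Y. ball y R))"

definition essentially_bounded_on :: "(real ^ 'n) set \<Rightarrow> (real ^ 'n \<Rightarrow> real) \<Rightarrow> bool" where
  "essentially_bounded_on \<Omega> f \<longleftrightarrow>
     f \<in> borel_measurable (lebesgue_on \<Omega>) \<and> (\<exists>C. AE x in lebesgue_on \<Omega>. \<bar>f x\<bar> \<le> C)"

end

theory Submission
  imports Defs
begin

text \<open>
  Existence is Perron's method: the supremum of all subsolutions that are \<open>\<le> 0\<close> is a solution, and
  the paraboloids \<open>K (|x - y|\<^sup>2 - R\<^sup>2)\<close>, \<open>y \<in> Y\<close>, are subsolutions for large \<open>K\<close> because \<open>p < 1\<close>;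
  they force the boundary values.

  For uniqueness, \<open>t u\<close> with \<open>t > 1\<close> is a strict subsolution, again because \<open>p < 1\<close>. Doubling the
  variables, \<open>t u(x) - v(y) - a |x - y|\<^sup>2 / 2\<close> has an interior maximum, at which the convex function
  \<open>t u\<close> is touched from above by a paraboloid; hence its subgradients near that point are almost
  constant and \<open>t u\<close> satisfies \<open>(det D\<^sup>2w)\<^sup>1\<^sup>/\<^sup>N \<ge> c\<close> there with a constant \<open>c\<close>. This is equivalent to the
  linear inequalities \<open>tr (P D\<^sup>2w P\<^sup>T) \<ge> N c\<close> for \<open>|det P| = 1\<close>, which pass from the viscosity
  subsolution to its mollification. The mollified function, translated by \<open>x - y\<close>, is then a test
  function for \<open>v\<close>. No theorem on sums of semijets is needed.
\<close>

text \<open>A viscosity inequality \<open>L w \<ge> q\<close>, with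
  \<open>L v = tr (P D^2 v P^T)\<close>, speaks only of points where a \<open>C^2\<close> function
  touches \<open>w\<close>, so it cannot be averaged directly against a mollifier. It is therefore
  turned into a statement that holds at every point and is linear in \<open>w\<close>:
  \<open>w \<le> R w - q / l + o(1 / l)\<close>, where \<open>R\<close> approximates the resolvent
  \<open>l (l - L)^(-1)\<close>. As \<open>R\<close> averages translates, the inequality survives
  convolution, and for the mollification \<open>W\<close> the expansion
  \<open>R W = W + L W / l + o(1 / l)\<close> gives back \<open>L W \<ge> q\<close>. Discretising
  \<open>L\<close> by second differences along the rows of \<open>P\<close> and iterating finitely
  often makes \<open>R\<close> an explicit finite sum, so that no linear equation has to be solved.
  The price is a chain of parameters, chosen in the order \<open>l\<close>, \<open>h\<close>,
  \<open>n\<close>. Only an inequality with constant right-hand side and no gradient term is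
  invariant under translations. This is why \<open>f + b |Du|^p\<close> has to be frozen near the
  doubled maximum, and why control of the subgradients of a convex function is decisive
  there.\<close>

abbreviation quad :: "real^'n^'n \<Rightarrow> real^'n \<Rightarrow> real" where
  "quad A v \<equiv> v \<bullet> (A *v v)"

text \<open>This is \<open>tr (P A P^T)\<close>, written row by row because each row of
  \<open>P\<close> later serves as the direction of a second difference.\<close>

abbreviation quad_sum :: "real^'n^'n \<Rightarrow> real^'n^'n \<Rightarrow> real" where
  "quad_sum P A \<equiv> \<Sum>i\<in>UNIV. quad A (P $ i)"

text \<open>A plain integral over a cube: it becomes a mean only when the integrand carries a
  density of mass one supported in the ball of radius \<open>r\<close>.\<close>

abbreviation avg :: "real \<Rightarrow> (real^'n \<Rightarrow> real) \<Rightarrow> real" where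
  "avg r \<equiv> integral (cbox (- vec r) (vec r))"

subsection \<open>Symmetric matrices and the determinant\<close>

text \<open>A maximiser \<open>e\<close> of the Rayleigh quotient on the unit sphere of
  \<open>S\<close> is an eigenvector, and its orthogonal complement in \<open>S\<close> is again
  invariant because \<open>X\<close> is symmetric; induction on the dimension does the rest.\<close>

lemma invariant_subspace_eigenbasis:
  fixes X :: "real^'n^'n"
  assumes sym: "transpose X = X" and "subspace S" and "\<And>x. x \<in> S \<Longrightarrow> X *v x \<in> S"
  shows "\<exists>B. B \<subseteq> S \<and> S \<subseteq> span B \<and> pairwise orthogonal B \<and> (\<forall>e\<in>B. norm e = 1 \<and> (\<exists>l. X *v e = l *\<^sub>R e))"
  using assms(2,3)
proof (induction "dim S" arbitrary: S rule: less_induct)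
  case less
  have self: "x \<bullet> (X *v y) = (X *v x) \<bullet> y" for x y
    by (metis dot_lmul_matrix transpose_matrix_vector sym)
  show ?case
  proof (cases "S \<subseteq> {0}")
    case True
    then show ?thesis by (intro exI[of _ "{}"]) auto
  next
    case False
    then obtain x0 where x0: "x0 \<in> S" "x0 \<noteq> 0" by auto
    let ?U = "S \<inter> sphere 0 1"
    have "compact ?U"
      using closed_subspace[OF less.prems(1)] by (simp add: closed_Int_compact)
    moreover have "x0 /\<^sub>R norm x0 \<in> ?U"
      using x0 less.prems(1) by (auto simp: subspace_scale)
    moreover have "continuous_on ?U (\<lambda>x. x \<bullet> (X *v x))"
      by (intro continuous_intros matrix_vector_mult_linear_continuous_on)
    ultimately obtain e where e: "e \<in> ?U" and emax: "\<And>y. y \<in> ?U \<Longrightarrow> y \<bullet> (X *v y) \<le> e \<bullet> (X *v e)"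
      using continuous_attains_sup[of ?U "\<lambda>x. x \<bullet> (X *v x)"] by blast
    define l where "l = e \<bullet> (X *v e)"
    have e1: "e \<bullet> e = 1" "norm e = 1" and eS: "e \<in> S" using e by (auto simp: dot_square_norm)
    have le: "y \<bullet> (X *v y) \<le> l * (y \<bullet> y)" if "y \<in> S" for y
    proof (cases "y = 0")
      case False
      then have "y /\<^sub>R norm y \<in> ?U" using that less.prems(1) by (auto simp: subspace_scale)
      from emax[OF this] have "(y \<bullet> (X *v y)) / (norm y)\<^sup>2 \<le> l"
        by (simp add: l_def matrix_vector_mult_scaleR power2_eq_square divide_simps)
      then show ?thesis using False by (simp add: divide_simps power2_norm_eq_inner split: if_splits)
    qed auto
    \<comment> \<open>The residual \<open>v\<close> is orthogonal to \<open>e\<close>. Perturbing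
      \<open>e\<close> in direction \<open>v\<close> gives a quadratic in \<open>t\<close> that is
      never positive, so its linear coefficient \<open>a\<close> vanishes; and \<open>a\<close>
      turns out to be \<open>v \<bullet> v\<close>.\<close>
    define v where "v = X *v e - l *\<^sub>R e"
    have vS: "v \<in> S" unfolding v_def using less.prems eS by (simp add: subspace_diff subspace_scale)
    have ve: "v \<bullet> e = 0" by (simp add: v_def inner_diff_left e1 l_def inner_commute[of "X *v e"])
    define a where "a = v \<bullet> (X *v e)"
    define be where "be = quad X v - l * (v \<bullet> v)"
    have quad: "2 * t * a + t\<^sup>2 * be \<le> 0" for t
    proof -
      have "e + t *\<^sub>R v \<in> S" using eS vS less.prems(1) by (simp add: subspace_add subspace_scale)
      from le[OF this] show ?thesis
        using ve e1 self[of e v]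
        by (simp add: a_def be_def l_def matrix_vector_right_distrib matrix_vector_mult_scaleR inner_add_left
            inner_add_right inner_commute algebra_simps power2_eq_square)
    qed
    have "a = 0"
    proof (rule ccontr)
      assume a: "a \<noteq> 0"
      \<comment> \<open>The maximiser of \<open>2 t a - t^2 (|be| + 1)\<close>, whose value there is
        positive.\<close>
      define t where "t = a / (\<bar>be\<bar> + 1)"
      have "t\<^sup>2 * (- (\<bar>be\<bar> + 1)) \<le> t\<^sup>2 * be" by (intro mult_left_mono) auto
      moreover have "2 * t * a - t\<^sup>2 * (\<bar>be\<bar> + 1) = a\<^sup>2 / (\<bar>be\<bar> + 1)"
        by (simp add: t_def power2_eq_square divide_simps add_nonneg_eq_0_iff)
      moreover have "a\<^sup>2 / (\<bar>be\<bar> + 1) > 0" using a by (simp add: add_nonneg_pos)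
      ultimately show False using quad[of t] by (simp add: algebra_simps)
    qed
    have "v \<bullet> v = a - l * (v \<bullet> e)"
      by (subst (2) v_def) (simp add: inner_diff_right a_def)
    then have "v = 0" using \<open>a = 0\<close> ve by simp
    then have eig: "X *v e = l *\<^sub>R e" by (simp add: v_def)
    define S' where "S' = {x \<in> S. e \<bullet> x = 0}"
    have sub': "subspace S'"
      using less.prems(1) by (auto simp: S'_def subspace_def inner_add_right)
    have inv': "X *v x \<in> S'" if "x \<in> S'" for x
      using that less.prems(2) by (auto simp: S'_def self eig)
    have "e \<notin> S'" using e1 by (simp add: S'_def)
    moreover have "S' \<subseteq> S" by (simp add: S'_def)
    ultimately have "S' \<subset> S" using eS by blast
    then have "dim S' < dim S"
      using sub' less.prems(1) by (metis dim_psubset span_eq_iff)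
    from less.hyps[OF this sub' inv'] obtain B where B: "B \<subseteq> S'" "S' \<subseteq> span B" "pairwise orthogonal B"
      "\<forall>e\<in>B. norm e = 1 \<and> (\<exists>l. X *v e = l *\<^sub>R e)" by blast
    show ?thesis
    proof (intro exI[of _ "insert e B"] conjI)
      show "insert e B \<subseteq> S" using B(1) eS by (auto simp: S'_def)
      show "S \<subseteq> span (insert e B)"
      proof
        fix x assume x: "x \<in> S"
        have "x - (e \<bullet> x) *\<^sub>R e \<in> S'"
          using x eS less.prems(1) by (simp add: S'_def subspace_diff subspace_scale inner_diff_right e1)
        then have "x - (e \<bullet> x) *\<^sub>R e \<in> span B" using B(2) by auto
        then show "x \<in> span (insert e B)"
          using span_breakdown_eq by blast
      qed
      show "pairwise orthogonal (insert e B)"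
        using B(1,3) by (auto simp: pairwise_insert orthogonal_def S'_def inner_commute)
      show "\<forall>e\<in>insert e B. norm e = 1 \<and> (\<exists>l. X *v e = l *\<^sub>R e)" using B(4) eig e1 by auto
    qed
  qed
qed

lemma symmetric_matrix_diagonalizable:
  fixes X :: "real^'n^'n"
  assumes "transpose X = X"
  obtains Q d where "orthogonal_matrix Q" "\<And>i. X *v (Q $ i) = d i *\<^sub>R (Q $ i)"
proof -
  obtain B where B: "(UNIV :: (real^'n) set) \<subseteq> span B" "pairwise orthogonal B"
      "\<forall>e\<in>B. norm e = 1 \<and> (\<exists>l. X *v e = l *\<^sub>R e)"
    using invariant_subspace_eigenbasis[OF assms, of UNIV] by auto
  then have ind: "independent B"
    by (intro pairwise_orthogonal_independent) auto
  then have "card B = CARD('n)" "finite B"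
    using B(1) by (metis dim_eq_card dim_UNIV dim_span top.extremum_unique DIM_cart DIM_real mult.right_neutral)
      (use ind independent_imp_finite in blast)
  then obtain g :: "'n \<Rightarrow> real^'n" where g: "bij_betw g UNIV B"
    by (metis finite_same_card_bij finite)
  define Q :: "real^'n^'n" where "Q = (\<chi> i. g i)"
  have gB: "g i \<in> B" for i using g by (auto simp: bij_betw_def)
  have "orthogonal_matrix Q"
    unfolding orthogonal_matrix_orthonormal_rows
  proof (intro conjI allI impI)
    show "norm (row i Q) = 1" for i using B(3) gB by (simp add: row_def Q_def vec_lambda_eta)
    show "orthogonal (row i Q) (row j Q)" if "i \<noteq> j" for i j
      using pairwiseD[OF B(2) gB gB, of i j] g that
      by (auto simp: row_def Q_def vec_lambda_eta bij_betw_def inj_on_def)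
  qed
  moreover have "\<exists>l. X *v (Q $ i) = l *\<^sub>R (Q $ i)" for i
    using B(3) gB[of i] by (simp add: Q_def)
  then obtain d where "X *v (Q $ i) = d i *\<^sub>R (Q $ i)" for i by metis
  ultimately show ?thesis using that by blast
qed

lemma matrix_congruence_nth:
  fixes X P :: "real^'n^'n"
  shows "(P ** X ** transpose P) $ i $ j = P $ i \<bullet> (X *v (P $ j))"
  by (simp add: matrix_matrix_mult_def transpose_def matrix_vector_mult_def inner_vec_def sum_distrib_left
      sum_distrib_right mult_ac) (rule sum.swap)

lemma trace_congruence:
  fixes X P :: "real^'n^'n"
  shows "trace (P ** X ** transpose P) = quad_sum P X"
  by (simp add: trace_def matrix_congruence_nth)

lemma det_congruence:
  fixes X P :: "real^'n^'n"
  shows "det (P ** X ** transpose P) = (det P)\<^sup>2 * det X"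
  by (simp add: det_mul det_transpose power2_eq_square)

context
  fixes X Q :: "real^'n^'n" and d :: "'n \<Rightarrow> real"
  assumes orth: "orthogonal_matrix Q" and eig: "\<And>i. X *v (Q $ i) = d i *\<^sub>R (Q $ i)"
begin

lemma eigenrows_inner: "Q $ i \<bullet> Q $ j = (if i = j then 1 else 0)"
proof -
  have "(Q ** transpose Q) $ i $ j = Q $ i \<bullet> Q $ j"
    by (simp add: matrix_matrix_mult_def transpose_def inner_vec_def)
  then show ?thesis using orth by (simp add: orthogonal_matrix_def mat_def)
qed

lemma eigenrows_congruence: "(Q ** X ** transpose Q) $ i $ j = (if i = j then d i else 0)"
  by (simp add: matrix_congruence_nth eig eigenrows_inner)

lemma det_eq_prod_eigenvalues: "det X = prod d UNIV"
proof -
  have "(det Q)\<^sup>2 = 1" using det_orthogonal_matrix[OF orth] by auto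
  then have "det X = det (Q ** X ** transpose Q)" by (simp add: det_congruence)
  also have "\<dots> = prod d UNIV"
    by (subst det_diagonal) (auto simp: eigenrows_congruence)
  finally show ?thesis .
qed

lemma trace_eq_sum_eigenvalues: "trace X = sum d UNIV"
proof -
  have "trace X = trace (transpose Q ** (Q ** X))"
    using orth by (simp add: orthogonal_matrix_def matrix_mul_assoc)
  also have "\<dots> = trace (Q ** X ** transpose Q)" by (rule trace_mul_sym)
  also have "\<dots> = sum d UNIV" by (simp add: trace_def eigenrows_congruence)
  finally show ?thesis .
qed

lemma eigenrows_expand: "v = (\<Sum>i\<in>UNIV. (Q $ i \<bullet> v) *\<^sub>R Q $ i)"
proof -
  have "v = transpose Q *v (Q *v v)" using orth by (simp add: orthogonal_matrix_def matrix_vector_mul_assoc)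
  also have "\<dots> = (\<Sum>i\<in>UNIV. (Q $ i \<bullet> v) *\<^sub>R Q $ i)"
    by (simp add: vec_eq_iff matrix_vector_mult_def transpose_def inner_vec_def mult_ac)
  finally show ?thesis .
qed

lemma quadratic_form_eigenrows: "quad X v = (\<Sum>i\<in>UNIV. d i * (Q $ i \<bullet> v)\<^sup>2)"
proof -
  have "X *v v = (\<Sum>i\<in>UNIV. (Q $ i \<bullet> v) *\<^sub>R (d i *\<^sub>R Q $ i))"
    by (subst eigenrows_expand[of v])
      (simp add: linear_sum[OF matrix_vector_mul_linear] matrix_vector_mult_scaleR eig o_def)
  then show ?thesis
    by (simp add: inner_sum_right power2_eq_square inner_commute mult_ac)
qed

lemma norm_eigenrows: "v \<bullet> v = (\<Sum>i\<in>UNIV. (Q $ i \<bullet> v)\<^sup>2)"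
  by (subst (2) eigenrows_expand[of v]) (simp add: inner_sum_right power2_eq_square inner_commute)

lemma eigenvalue_eq: "d i = Q $ i \<bullet> (X *v (Q $ i))"
  by (simp add: eig eigenrows_inner)

end

lemma symmetric_matrix_inner:
  fixes X :: "real^'n^'n"
  assumes "transpose X = X"
  shows "x \<bullet> (X *v y) = (X *v x) \<bullet> y"
  using assms by (metis dot_lmul_matrix transpose_matrix_vector)

lemma nonneg_sym_congruence:
  fixes X P :: "real^'n^'n"
  assumes "nonneg_sym X"
  shows "nonneg_sym (P ** X ** transpose P)"
proof -
  have "quad (P ** X ** transpose P) v = (transpose P *v v) \<bullet> (X *v (transpose P *v v))" for v
    by (metis dot_lmul_matrix matrix_vector_mul_assoc transpose_matrix_vector transpose_transpose)
  then show ?thesis using assms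
    by (simp add: nonneg_sym_def matrix_transpose_mul transpose_transpose matrix_mul_assoc)
qed

text \<open>The inequality of the arithmetic and geometric means for the eigenvalues.\<close>

lemma monge_ampere_le_trace:
  fixes X :: "real^'n^'n"
  assumes X: "nonneg_sym X"
  shows "real CARD('n) * monge_ampere X \<le> trace X"
proof -
  obtain Q d where Q: "orthogonal_matrix Q" "\<And>i. X *v (Q $ i) = d i *\<^sub>R (Q $ i)"
    using symmetric_matrix_diagonalizable X unfolding nonneg_sym_def by blast
  have d: "d i \<ge> 0" for i using X eigenvalue_eq[OF Q, of i] by (simp add: nonneg_sym_def)
  have "monge_ampere X = prod d UNIV powr (1 / real CARD('n))"
    by (simp add: monge_ampere_def det_eq_prod_eigenvalues[OF Q])
  also have "\<dots> \<le> (\<Sum>i\<in>UNIV. d i / real CARD('n))"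
    using arith_geom_mean[of "UNIV :: 'n set" d] d by simp
  finally show ?thesis by (simp add: trace_eq_sum_eigenvalues[OF Q] sum_divide_distrib[symmetric] field_simps)
qed

lemma prod_sqrt: "(\<Prod>i\<in>S. sqrt (w i)) = sqrt (prod w S)"
  by (induction S rule: infinite_finite_induct) (auto simp: real_sqrt_mult)

text \<open>Congruence by \<open>P\<close> with \<open>|det P| = 1\<close> keeps the determinant, so
  the trace of \<open>P X P^T\<close> bounds the same number. This is the easy half of the
  variational formula for the operator.\<close>

lemma monge_ampere_le_congruence:
  fixes X P :: "real^'n^'n"
  assumes "nonneg_sym X" "\<bar>det P\<bar> = 1"
  shows "real CARD('n) * monge_ampere X \<le> quad_sum P X"
proof -
  have "(det P)\<^sup>2 = 1" using assms(2) by (metis power2_abs power_one)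
  then have "monge_ampere (P ** X ** transpose P) = monge_ampere X"
    by (simp add: monge_ampere_def det_congruence)
  then show ?thesis
    using monge_ampere_le_trace[OF nonneg_sym_congruence[OF assms(1), of P]] by (simp add: trace_congruence)
qed

text \<open>The converse half of the formula
  \<open>N (det X)\<^sup>1\<^sup>/\<^sup>N = inf {tr (P X P\<^sup>T) | det P = 1}\<close>; it turns the
  Monge-Ampere inequality into a family of linear ones.\<close>

lemma monge_ampere_geI:
  fixes X :: "real^'n^'n"
  assumes sym: "transpose X = X" and c: "c > 0"
    and lin: "\<And>P. \<bar>det P\<bar> = 1 \<Longrightarrow> real CARD('n) * c \<le> quad_sum P X"
  shows "nonneg_sym X" and "c \<le> monge_ampere X"
proof -
  obtain Q d where Q: "orthogonal_matrix Q" "\<And>i. X *v (Q $ i) = d i *\<^sub>R (Q $ i)"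
    using symmetric_matrix_diagonalizable sym by blast
  \<comment> \<open>Rows of \<open>Q\<close> stretched by \<open>sqrt (w i)\<close> form an
    admissible \<open>P\<close>, so the hypothesis specialises to weighted sums of eigenvalues with
    weights of product one.\<close>
  have scaled: "real CARD('n) * c \<le> (\<Sum>i\<in>UNIV. w i * d i)"
    if w: "\<And>i. w i > 0" "prod w UNIV = 1" for w :: "'n \<Rightarrow> real"
  proof -
    define P :: "real^'n^'n" where "P = (\<chi> i. sqrt (w i) *s (Q $ i))"
    have "det P = (\<Prod>i\<in>UNIV. sqrt (w i)) * det (\<chi> i. Q $ i)"
      unfolding P_def by (rule det_rows_mul)
    moreover have "(\<Prod>i\<in>UNIV. sqrt (w i)) = 1"
    proof -
      have "(\<Prod>i\<in>UNIV. sqrt (w i)) = sqrt (prod w UNIV)"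
        by (rule prod_sqrt)
      then show ?thesis using w(2) by simp
    qed
    moreover have "\<bar>det Q\<bar> = 1" using det_orthogonal_matrix[OF Q(1)] by auto
    ultimately have "\<bar>det P\<bar> = 1" by (simp add: vec_lambda_eta)
    from lin[OF this] show ?thesis
      using w(1) by (simp add: P_def scalar_mult_eq_scaleR matrix_vector_mult_scaleR Q(2)
        eigenrows_inner[OF Q] mult.assoc[of "sqrt _" "d _"] mult.left_commute[of "sqrt _" "d _"]
        mult.commute[of "w _"] less_imp_le)
  qed
  have pos: "d j > 0" for j
  proof (rule ccontr)
    assume j: "\<not> d j > 0"
    have bound: "real CARD('n) * c \<le> (\<Sum>i\<in>UNIV - {j}. \<bar>d i\<bar>) / t" if t: "t > 0" for t
    proof -
      \<comment> \<open>Weights of product one that charge a nonpositive \<open>d j\<close> heavily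
        and all others by \<open>1 / t\<close>; as \<open>t\<close> tends to infinity they would
        give \<open>N c \<le> 0\<close>.\<close>
      define w where "w i = (if i = j then t ^ (CARD('n) - 1) else 1 / t)" for i
      have "prod w UNIV = w j * prod w (UNIV - {j})" by (rule prod.remove) auto
      also have "prod w (UNIV - {j}) = (1 / t) ^ (CARD('n) - 1)"
        by (simp add: w_def)
      finally have "prod w UNIV = 1" using t by (simp add: w_def power_divide)
      then have "real CARD('n) * c \<le> (\<Sum>i\<in>UNIV. w i * d i)"
        using t by (intro scaled) (auto simp: w_def)
      also have "\<dots> = w j * d j + (\<Sum>i\<in>UNIV - {j}. w i * d i)" by (rule sum.remove) auto
      also have "\<dots> \<le> 0 + (\<Sum>i\<in>UNIV - {j}. \<bar>d i\<bar> / t)"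
        using j t by (intro add_mono sum_mono) (auto simp: w_def mult_nonneg_nonpos divide_right_mono)
      finally show ?thesis by (simp add: sum_divide_distrib)
    qed
    have "((\<lambda>t. (\<Sum>i\<in>UNIV - {j}. \<bar>d i\<bar>) / t) \<longlongrightarrow> 0) at_top"
      by (intro tendsto_divide_0[OF tendsto_const] filterlim_ident filterlim_at_top_imp_at_infinity)
    then have "real CARD('n) * c \<le> 0"
      by (rule tendsto_lowerbound) (auto intro!: eventually_mono[OF eventually_gt_at_top[of 0]] bound)
    then show False using c by (simp add: mult_le_0_iff)
  qed
  show "nonneg_sym X"
    unfolding nonneg_sym_def
    using sym pos by (auto simp: quadratic_form_eigenrows[OF Q] less_imp_le intro!: sum_nonneg mult_nonneg_nonneg)
  \<comment> \<open>\<open>D\<close> is the geometric mean of the eigenvalues; the weights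
    \<open>D / d i\<close> make all summands equal to \<open>D\<close>, the equality case of the
    mean inequality.\<close>
  define D where "D = prod d UNIV powr (1 / real CARD('n))"
  have pd: "prod d UNIV > 0" using pos by (simp add: prod_pos)
  then have D0: "D > 0" by (simp only: D_def powr_gt_zero)
  have "D ^ CARD('n) = prod d UNIV powr (1 / real CARD('n) * real CARD('n))"
    unfolding powr_powr[symmetric] D_def[symmetric] using D0 by (rule powr_realpow[symmetric])
  then have D: "D ^ CARD('n) = prod d UNIV" using pd by simp
  have "(\<Prod>i\<in>UNIV. D / d i) = 1"
    unfolding prod_dividef prod_constant D using pd by (intro divide_self) linarith
  then have "real CARD('n) * c \<le> (\<Sum>i\<in>UNIV. D / d i * d i)"
    using D0 pos by (intro scaled) simp_all
  also have "\<dots> = (\<Sum>i\<in>(UNIV :: 'n set). D)"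
  proof (rule sum.cong)
    show "D / d i * d i = D" for i using pos[of i] by simp
  qed simp
  also have "\<dots> = real CARD('n) * D" by simp
  finally show "c \<le> monge_ampere X"
    by (simp add: monge_ampere_def det_eq_prod_eigenvalues[OF Q] D_def)
qed

lemma monge_ampere_nonneg: "0 \<le> monge_ampere X"
  by (simp add: monge_ampere_def)

text \<open>Each functional \<open>quad_sum P\<close> is monotone in the matrix, hence so is their
  infimum. The value \<open>0\<close> is split off because \<open>monge_ampere_geI\<close> asks for
  a positive bound.\<close>

lemma monge_ampere_mono:
  fixes X Y :: "real^'n^'n"
  assumes X: "nonneg_sym X" and Y: "transpose Y = Y" and le: "\<And>v. quad X v \<le> quad Y v"
  shows "monge_ampere X \<le> monge_ampere Y"
proof (cases "monge_ampere X = 0")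
  case True
  then show ?thesis by (simp add: monge_ampere_nonneg)
next
  case False
  then have "monge_ampere X > 0" using monge_ampere_nonneg[of X] by simp
  moreover have "real CARD('n) * monge_ampere X \<le> quad_sum P Y"
    if "\<bar>det P\<bar> = 1" for P :: "real^'n^'n"
    using monge_ampere_le_congruence[OF X that] sum_mono[of UNIV, OF le[of "P $ _"]] by (rule order_trans)
  ultimately show ?thesis by (rule monge_ampere_geI(2)[OF Y])
qed

lemma monge_ampere_scale:
  fixes X :: "real^'n^'n"
  assumes "nonneg_sym X" "s \<ge> 0"
  shows "monge_ampere (s *\<^sub>R X) = s * monge_ampere X"
proof (cases "s = 0")
  case False
  have "det (s *\<^sub>R X) = s ^ CARD('n) * det X"
  proof -
    have "s *\<^sub>R X = (\<chi> i. s *s (X $ i))" by (simp add: vec_eq_iff)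
    then show ?thesis by (simp only: det_rows_mul vec_lambda_eta) simp
  qed
  moreover have "det X \<ge> 0"
  proof -
    obtain Q d where Q: "orthogonal_matrix Q" "\<And>i. X *v (Q $ i) = d i *\<^sub>R (Q $ i)"
      using symmetric_matrix_diagonalizable assms(1) unfolding nonneg_sym_def by blast
    have "d i \<ge> 0" for i using assms(1) eigenvalue_eq[OF Q, of i] by (simp add: nonneg_sym_def)
    then show ?thesis by (simp add: det_eq_prod_eigenvalues[OF Q] prod_nonneg)
  qed
  ultimately show ?thesis using False assms(2)
    by (simp add: monge_ampere_def powr_mult powr_realpow[symmetric] powr_powr)
next
  case True
  have "det (0 :: real^'n^'n) = 0" using det_zero_row(1)[of undefined "0 :: real^'n^'n"] by (simp add: row_def vec_eq_iff)
  then show ?thesis using True by (simp add: monge_ampere_def)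
qed

text \<open>An eigenvalue is the determinant divided by the other eigenvalues, each at most
  \<open>M\<close>. The resulting uniform positivity leaves room to subtract a small multiple of the
  identity.\<close>

lemma quadratic_form_lower_bound:
  fixes X :: "real^'n^'n"
  assumes X: "nonneg_sym X" and up: "\<And>v. quad X v \<le> M * (v \<bullet> v)"
    and c: "0 < c" "c \<le> monge_ampere X"
  shows "c ^ CARD('n) / M ^ (CARD('n) - 1) * (v \<bullet> v) \<le> quad X v"
proof -
  obtain Q d where Q: "orthogonal_matrix Q" "\<And>i. X *v (Q $ i) = d i *\<^sub>R (Q $ i)"
    using symmetric_matrix_diagonalizable X unfolding nonneg_sym_def by blast
  have d0: "d i \<ge> 0" for i using X eigenvalue_eq[OF Q, of i] by (simp add: nonneg_sym_def)
  have dM: "d i \<le> M" for i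
    using up[of "Q $ i"] eigenvalue_eq[OF Q, of i] eigenrows_inner[OF Q, of i i] by simp
  have "det X \<noteq> 0" using c by (auto simp: monge_ampere_def)
  then have det0: "det X > 0"
    using prod_nonneg[of UNIV d] d0 by (auto simp: det_eq_prod_eigenvalues[OF Q] less_le)
  have "c ^ CARD('n) \<le> monge_ampere X ^ CARD('n)" using c by (intro power_mono) auto
  also have "\<dots> = det X" using det0 by (simp add: monge_ampere_def powr_realpow[symmetric] powr_powr)
  finally have cd: "c ^ CARD('n) \<le> prod d UNIV" by (simp add: det_eq_prod_eigenvalues[OF Q])
  have lower: "c ^ CARD('n) / M ^ (CARD('n) - 1) \<le> d j" for j
  proof -
    have "prod d UNIV = d j * prod d (UNIV - {j})" by (rule prod.remove) auto
    also have "\<dots> \<le> d j * (\<Prod>i\<in>UNIV - {j}. M)"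
      using d0 dM by (intro mult_left_mono prod_mono) auto
    finally have "c ^ CARD('n) \<le> d j * M ^ (CARD('n) - 1)" using cd by simp
    moreover have "M > 0"
    proof -
      have "d j \<noteq> 0"
      proof
        assume "d j = 0"
        then have "prod d UNIV = 0" by (intro prod_zero) auto
        then show False using det0 det_eq_prod_eigenvalues[OF Q] by linarith
      qed
      then show ?thesis using d0[of j] dM[of j] by linarith
    qed
    ultimately show ?thesis by (simp add: field_simps)
  qed
  show ?thesis
    unfolding quadratic_form_eigenrows[OF Q] norm_eigenrows[OF Q, of v] sum_distrib_left
    using lower by (intro sum_mono mult_right_mono) auto
qed

subsection \<open>Functions of class \<open>C\<^sup>2\<close>\<close>

text \<open>A \<open>C^2\<close> function bundled with its gradient \<open>G\<close> and Hessian
  \<open>H\<close>. Naming the derivatives lets sums, translates and convolutions be differentiated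
  by rules; \<open>grad\<close> and \<open>hessian\<close> appear only at the interface to the
  viscosity definitions.\<close>

definition C2_data ::
  "(real^'n) set \<Rightarrow> (real^'n \<Rightarrow> real) \<Rightarrow> (real^'n \<Rightarrow> real^'n) \<Rightarrow> (real^'n \<Rightarrow> real^'n^'n) \<Rightarrow> bool" where
  "C2_data S \<psi> G H \<longleftrightarrow>
     (\<forall>x\<in>S. (\<psi> has_derivative (\<lambda>h. h \<bullet> G x)) (at x)) \<and>
     (\<forall>x\<in>S. (G has_derivative (\<lambda>h. H x *v h)) (at x)) \<and> continuous_on S H"

lemma C2_dataD:
  assumes "C2_data S \<psi> G H"
  shows "x \<in> S \<Longrightarrow> (\<psi> has_derivative (\<lambda>h. h \<bullet> G x)) (at x)"
    and "x \<in> S \<Longrightarrow> (G has_derivative (\<lambda>h. H x *v h)) (at x)"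
    and "continuous_on S H"
  using assms by (auto simp: C2_data_def)

lemma C2_data_subset: "C2_data S \<psi> G H \<Longrightarrow> T \<subseteq> S \<Longrightarrow> C2_data T \<psi> G H"
  by (auto simp: C2_data_def intro: continuous_on_subset)

lemma C2_data_grad: "C2_data S \<psi> G H \<Longrightarrow> x \<in> S \<Longrightarrow> grad \<psi> x = G x"
  by (rule grad_eqI) (simp add: C2_data_def gderiv_def)

lemma C2_data_hessian:
  assumes "C2_data S \<psi> G H" "open S" "x \<in> S"
  shows "(grad \<psi> has_derivative (\<lambda>h. H x *v h)) (at x)" and "hessian \<psi> x = H x"
proof -
  show d: "(grad \<psi> has_derivative (\<lambda>h. H x *v h)) (at x)"
    by (rule has_derivative_transform_within_open[OF C2_dataD(2)[OF assms(1,3)] assms(2,3)])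
      (simp add: C2_data_grad[OF assms(1)])
  show "hessian \<psi> x = H x"
    unfolding hessian_def jacobian_def
    by (metis d frechet_derivative_at matrix_of_matrix_vector_mul)
qed

lemma C2_data_imp_C2_on:
  assumes "C2_data S \<psi> G H" "open S"
  shows "C2_on S \<psi>"
proof -
  have "continuous_on S (hessian \<psi>)"
    using C2_dataD(3)[OF assms(1)] by (rule continuous_on_eq) (simp add: C2_data_hessian[OF assms])
  then show ?thesis
    unfolding C2_on_def
    using C2_dataD(1)[OF assms(1)] C2_data_hessian(1)[OF assms] by (blast intro: differentiableI)
qed

lemma C2_on_imp_C2_data:
  assumes "C2_on S \<psi>"
  shows "C2_data S \<psi> (grad \<psi>) (hessian \<psi>)"
  unfolding C2_data_def
proof (intro conjI ballI)
  fix x assume x: "x \<in> S"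
  have d: "(\<psi> has_derivative frechet_derivative \<psi> (at x)) (at x)"
    using assms x by (auto simp: C2_on_def frechet_derivative_works)
  then have l: "linear (frechet_derivative \<psi> (at x))" by (rule has_derivative_linear)
  have "frechet_derivative \<psi> (at x) h = h \<bullet> grad \<psi> x" for h
  proof -
    have "frechet_derivative \<psi> (at x) h = frechet_derivative \<psi> (at x) (\<Sum>i\<in>UNIV. h $ i *\<^sub>R axis i 1)"
      by (metis basis_expansion scalar_mult_eq_scaleR)
    also have "\<dots> = h \<bullet> grad \<psi> x"
      by (simp add: linear_sum[OF l] linear_scale[OF l] grad_def inner_vec_def)
    finally show ?thesis .
  qed
  then show "(\<psi> has_derivative (\<lambda>h. h \<bullet> grad \<psi> x)) (at x)" using d by presburger
  show "(grad \<psi> has_derivative (\<lambda>h. hessian \<psi> x *v h)) (at x)"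
    using assms x unfolding hessian_def by (simp add: C2_on_def jacobian_works)
next
  show "continuous_on S (hessian \<psi>)" using assms by (simp add: C2_on_def)
qed

lemma C2_data_cong:
  assumes "C2_data S \<psi> G H" and "\<And>x. \<psi>' x = \<psi> x" "\<And>x. G' x = G x" "\<And>x. H' x = H x"
  shows "C2_data S \<psi>' G' H'"
proof -
  have "\<psi>' = \<psi>" "G' = G" "H' = H" using assms by auto
  then show ?thesis using assms(1) by simp
qed

lemma C2_data_add:
  assumes "C2_data S \<psi> G H" "C2_data S \<psi>' G' H'"
  shows "C2_data S (\<lambda>x. \<psi> x + \<psi>' x) (\<lambda>x. G x + G' x) (\<lambda>x. H x + H' x)"
proof -
  have "(*v) (H x + H' x) = (\<lambda>h. H x *v h + H' x *v h)" for x
    by (auto simp: matrix_vector_mult_add_rdistrib)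
  then show ?thesis using assms unfolding C2_data_def
    by (auto simp: inner_add_right intro!: has_derivative_add continuous_intros)
qed

lemma C2_data_scale:
  assumes "C2_data S \<psi> G H"
  shows "C2_data S (\<lambda>x. c * \<psi> x) (\<lambda>x. c *\<^sub>R G x) (\<lambda>x. c *\<^sub>R H x)"
proof -
  have "(*v) (c *\<^sub>R H x) = (\<lambda>h. c *\<^sub>R (H x *v h))" for x
    by (auto simp: scaleR_matrix_vector_assoc[symmetric])
  then show ?thesis using assms unfolding C2_data_def
    by (auto intro!: has_derivative_mult_right has_derivative_scaleR_right continuous_intros)
qed

lemma C2_data_const: "C2_data S (\<lambda>x. c) (\<lambda>x. 0) (\<lambda>x. 0)"
  by (auto simp: C2_data_def matrix_vector_mult_def zero_vec_def[symmetric])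

lemma C2_data_translate:
  assumes "C2_data UNIV \<psi> G H"
  shows "C2_data S (\<lambda>x. \<psi> (x + a)) (\<lambda>x. G (x + a)) (\<lambda>x. H (x + a))"
proof -
  have sh: "((\<lambda>x. x + a) has_derivative (\<lambda>h. h)) (at x)" for x :: "real^'a"
    by (auto intro!: derivative_eq_intros)
  have "continuous_on S (\<lambda>x. H (x + a))"
    by (rule continuous_on_compose2[OF C2_dataD(3)[OF assms]]) (auto intro!: continuous_intros)
  then show ?thesis
    unfolding C2_data_def
    using has_derivative_compose[OF sh C2_dataD(1)[OF assms UNIV_I]]
      has_derivative_compose[OF sh C2_dataD(2)[OF assms UNIV_I]] by auto
qed

lemma C2_data_quadratic:
  fixes X :: "real^'n^'n"
  assumes "transpose X = X"
  shows "C2_data S (\<lambda>x. a + g \<bullet> (x - z) + quad X (x - z) / 2) (\<lambda>x. g + X *v (x - z)) (\<lambda>x. X)"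
  unfolding C2_data_def
proof (intro conjI ballI)
  have lin: "((\<lambda>x. X *v (x - z)) has_derivative (\<lambda>h. X *v h)) (at x)" for x
    by (rule has_derivative_compose[of "\<lambda>x. x - z" "\<lambda>h. h", OF _ bounded_linear_imp_has_derivative])
      (auto intro!: derivative_eq_intros)
  fix x
  have "(\<lambda>h. h \<bullet> (g + X *v (x - z))) = (\<lambda>h. g \<bullet> h + ((x - z) \<bullet> (X *v h) + h \<bullet> (X *v (x - z))) / 2)"
    by (simp add: fun_eq_iff symmetric_matrix_inner[OF assms, of "x - z"] inner_add_right inner_commute[of _ g]
        inner_commute[of _ "X *v (x - z)"])
  then show "((\<lambda>x. a + g \<bullet> (x - z) + quad X (x - z) / 2) has_derivative (\<lambda>h. h \<bullet> (g + X *v (x - z)))) (at x)"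
    by (auto intro!: derivative_eq_intros lin)
  show "((\<lambda>x. g + X *v (x - z)) has_derivative (\<lambda>h. X *v h)) (at x)"
    by (auto intro!: derivative_eq_intros lin)
qed simp

lemma C2_data_square:
  assumes "C2_data S \<psi> G H"
  shows "C2_data S (\<lambda>x. (\<psi> x)\<^sup>2) (\<lambda>x. (2 * \<psi> x) *\<^sub>R G x)
     (\<lambda>x. (2 * \<psi> x) *\<^sub>R H x + 2 *\<^sub>R (\<chi> i j. G x $ i * G x $ j))"
  unfolding C2_data_def
proof (intro conjI ballI)
  fix x assume x: "x \<in> S"
  note d = C2_dataD(1)[OF assms x] C2_dataD(2)[OF assms x]
  show "((\<lambda>x. (\<psi> x)\<^sup>2) has_derivative (\<lambda>h. h \<bullet> ((2 * \<psi> x) *\<^sub>R G x))) (at x)"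
    by (auto intro!: derivative_eq_intros d)
  have "(\<chi> i j. G x $ i * G x $ j) *v h = (h \<bullet> G x) *\<^sub>R G x" for h
    by (simp add: vec_eq_iff matrix_vector_mult_def inner_vec_def sum_distrib_left mult_ac)
  then have e: "((2 * \<psi> x) *\<^sub>R H x + 2 *\<^sub>R (\<chi> i j. G x $ i * G x $ j)) *v h =
      (2 * \<psi> x) *\<^sub>R (H x *v h) + (2 * (h \<bullet> G x)) *\<^sub>R G x" for h
    by (simp add: matrix_vector_mult_add_rdistrib scaleR_matrix_vector_assoc[symmetric])
  show "((\<lambda>x. (2 * \<psi> x) *\<^sub>R G x) has_derivative
      (\<lambda>h. ((2 * \<psi> x) *\<^sub>R H x + 2 *\<^sub>R (\<chi> i j. G x $ i * G x $ j)) *v h)) (at x)"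
    unfolding e by (rule derivative_eq_intros d refl | simp)+
next
  have c: "continuous_on S \<psi>" "continuous_on S G"
    using C2_dataD(1,2)[OF assms] by (meson differentiable_at_imp_differentiable_on differentiable_imp_continuous_on differentiableI)+
  show "continuous_on S (\<lambda>x. (2 * \<psi> x) *\<^sub>R H x + 2 *\<^sub>R (\<chi> i j. G x $ i * G x $ j))"
    by (intro continuous_intros c C2_dataD(3)[OF assms] continuous_on_vec_lambda)
qed

lemma C2_data_line_taylor:
  assumes C: "C2_data S \<psi> G H" and seg: "\<And>t. 0 \<le> t \<Longrightarrow> t \<le> 1 \<Longrightarrow> x + t *\<^sub>R v \<in> S"
  shows "\<exists>t. 0 < t \<and> t < 1 \<and> \<psi> (x + v) = \<psi> x + v \<bullet> G x + quad (H (x + t *\<^sub>R v)) v / 2"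
proof -
  define D where "D m t = (if m = 0 then \<psi> (x + t *\<^sub>R v) else if m = 1 then v \<bullet> G (x + t *\<^sub>R v)
      else v \<bullet> (H (x + t *\<^sub>R v) *v v))" for m :: nat and t :: real
  have line: "((\<lambda>t. x + t *\<^sub>R v) has_derivative (\<lambda>s. s *\<^sub>R v)) (at t)" for t :: real
    by (auto intro!: derivative_eq_intros)
  have "(D m has_real_derivative D (Suc m) t) (at t)" if "m < 2" "0 \<le> t" "t \<le> 1" for m t
  proof -
    note xs = seg[OF that(2,3)]
    have "((\<lambda>t. \<psi> (x + t *\<^sub>R v)) has_real_derivative v \<bullet> G (x + t *\<^sub>R v)) (at t)"
      using has_derivative_compose[OF line C2_dataD(1)[OF C xs]]
      by (simp add: has_field_derivative_def mult_commute_abs)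
    moreover have "((\<lambda>t. v \<bullet> G (x + t *\<^sub>R v)) has_real_derivative v \<bullet> (H (x + t *\<^sub>R v) *v v)) (at t)"
      using has_derivative_inner_right[OF has_derivative_compose[OF line C2_dataD(2)[OF C xs]], of v]
      by (simp add: has_field_derivative_def mult_commute_abs matrix_vector_mult_scaleR)
    moreover have "m = 0 \<or> m = 1" using that by auto
    ultimately show ?thesis by (auto simp: D_def[abs_def])
  qed
  then have "\<exists>t. 0 < t \<and> t < 1 \<and> D 0 1 = (\<Sum>m<2. D m 0 / fact m * 1 ^ m) + D 2 t / fact 2 * 1 ^ 2"
    by (intro Maclaurin) auto
  then show ?thesis by (simp add: D_def numeral_2_eq_2)
qed

lemma segment_in_ball:
  fixes v :: "'a :: real_normed_vector"
  assumes "v \<in> ball 0 r" "0 \<le> t" "t \<le> 1"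
  shows "x + t *\<^sub>R v \<in> ball x r"
  using assms mult_left_le_one_le[of "norm v" t] by (auto simp: dist_norm intro: le_less_trans)

lemma matrix_quadratic_diff_bound:
  fixes A B :: "real^'n^'n"
  shows "\<bar>quad A v - quad B v\<bar> \<le> real CARD('n) * norm (A - B) * (v \<bullet> v)"
proof -
  have "\<bar>quad A v - quad B v\<bar> = \<bar>quad (A - B) v\<bar>"
    by (simp add: matrix_vector_mult_diff_rdistrib inner_diff_right)
  also have "\<dots> \<le> norm v * norm ((A - B) *v v)" by (rule Cauchy_Schwarz_ineq2)
  also have "norm ((A - B) *v v) \<le> onorm ((*v) (A - B)) * norm v" by (rule onorm) simp
  also have "onorm ((*v) (A - B)) \<le> real CARD('n) * norm (A - B)"
  proof (rule onorm_bound)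
    fix w
    have "norm ((A - B) *v w) \<le> (\<Sum>i\<in>UNIV. \<bar>((A - B) *v w) $ i\<bar>)" by (rule norm_le_l1_cart)
    also have "\<dots> \<le> (\<Sum>i\<in>(UNIV::'n set). norm (A - B) * norm w)"
    proof (rule sum_mono)
      fix i
      have "\<bar>((A - B) *v w) $ i\<bar> \<le> norm ((A - B) $ i) * norm w"
        by (simp add: matrix_vector_mul_component Cauchy_Schwarz_ineq2)
      also have "norm ((A - B) $ i) \<le> norm (A - B)" by (rule Finite_Cartesian_Product.norm_nth_le)
      finally show "\<bar>((A - B) *v w) $ i\<bar> \<le> norm (A - B) * norm w" by (simp add: mult_right_mono)
    qed
    finally show "norm ((A - B) *v w) \<le> real CARD('n) * norm (A - B) * norm w" by simp
  qed simp
  finally show ?thesis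
    by (simp add: mult_left_mono mult_right_mono power2_norm_eq_inner[symmetric] power2_eq_square mult_ac)
qed

lemma C2_data_taylor:
  fixes x :: "real^'n"
  assumes C: "C2_data S \<psi> G H" and "open S" and x: "x \<in> S" and e: "e > 0"
  obtains d where "d > 0" "ball x d \<subseteq> S"
    "\<And>w. norm w < d \<Longrightarrow> \<bar>\<psi> (x + w) - \<psi> x - w \<bullet> G x - quad (H x) w / 2\<bar> \<le> e * (w \<bullet> w)"
proof -
  have "isCont H x"
    using C2_dataD(3)[OF C] assms(2) x continuous_on_eq_continuous_at by blast
  moreover have "e / real CARD('n) > 0" using e by simp
  ultimately obtain d1 where d1: "d1 > 0" "\<And>y. dist y x < d1 \<Longrightarrow> dist (H y) (H x) < e / real CARD('n)"
    unfolding continuous_at_eps_delta by metis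
  obtain d2 where d2: "d2 > 0" "ball x d2 \<subseteq> S" using assms(2) x openE by blast
  define d where "d = min d1 d2"
  have near: "\<bar>quad (H y) w - quad (H x) w\<bar> \<le> e * (w \<bullet> w)" if "y \<in> ball x d" for y w
  proof -
    have "norm (H y - H x) \<le> e / real CARD('n)"
      using d1(2)[of y] that by (simp add: d_def dist_norm norm_minus_commute less_imp_le)
    then have "real CARD('n) * norm (H y - H x) * (w \<bullet> w) \<le> e * (w \<bullet> w)"
      by (intro mult_right_mono) (simp_all add: field_simps)
    then show ?thesis using matrix_quadratic_diff_bound[of w "H y" "H x"] by linarith
  qed
  show ?thesis
  proof (rule that[of d])
    show "d > 0" "ball x d \<subseteq> S" using d1 d2 by (auto simp: d_def)
    fix w :: "real^'n" assume w: "norm w < d"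
    have "\<exists>t. 0 < t \<and> t < 1 \<and> \<psi> (x + w) = \<psi> x + w \<bullet> G x + quad (H (x + t *\<^sub>R w)) w / 2"
    proof (rule C2_data_line_taylor[OF C])
      fix t :: real assume "0 \<le> t" "t \<le> 1"
      then have "x + t *\<^sub>R w \<in> ball x d" using w by (intro segment_in_ball) auto
      then show "x + t *\<^sub>R w \<in> S" using d2 by (auto simp: d_def)
    qed
    then obtain t where t: "0 < t" "t < 1" "\<psi> (x + w) = \<psi> x + w \<bullet> G x + quad (H (x + t *\<^sub>R w)) w / 2" by blast
    have "x + t *\<^sub>R w \<in> ball x d" using w t by (intro segment_in_ball) auto
    from near[OF this, of w] show "\<bar>\<psi> (x + w) - \<psi> x - w \<bullet> G x - quad (H x) w / 2\<bar> \<le> e * (w \<bullet> w)"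
      unfolding t(3) using e inner_ge_zero[of w] mult_nonneg_nonneg[of e "w \<bullet> w"] by linarith
  qed
qed

lemma C2_data_second_difference:
  fixes x :: "real^'n"
  assumes C: "C2_data S \<psi> G H" and "open S" and x: "x \<in> S"
  shows "((\<lambda>s. (\<psi> (x + s *\<^sub>R v) + \<psi> (x - s *\<^sub>R v) - 2 * \<psi> x) / s\<^sup>2) \<longlongrightarrow> quad (H x) v) (at_right 0)"
proof (rule tendstoI)
  fix e :: real assume e: "e > 0"
  \<comment> \<open>The \<open>+ 1\<close> guards against \<open>v = 0\<close>; two Taylor errors
    together then cost at most \<open>e / 2\<close>.\<close>
  define e' where "e' = e / (4 * (v \<bullet> v + 1))"
  have vv: "v \<bullet> v + 1 > 0" by (simp add: add_nonneg_pos)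
  have e': "e' > 0" "2 * e' * (v \<bullet> v) \<le> e / 2"
    using e vv by (simp_all add: e'_def divide_simps)
  obtain d where d: "d > 0"
    and tay: "\<And>w. norm w < d \<Longrightarrow> \<bar>\<psi> (x + w) - \<psi> x - w \<bullet> G x - quad (H x) w / 2\<bar> \<le> e' * (w \<bullet> w)"
    using C2_data_taylor[OF assms e'(1)] by metis
  have "\<bar>(\<psi> (x + s *\<^sub>R v) + \<psi> (x - s *\<^sub>R v) - 2 * \<psi> x) / s\<^sup>2 - quad (H x) v\<bar> < e"
    if s: "0 < s" "s < d / (norm v + 1)" for s
  proof -
    have "norm (s *\<^sub>R v) < d"
    proof -
      have "s * norm v \<le> s * (norm v + 1)" using s by (intro mult_left_mono) auto
      also have "\<dots> < d" using s by (simp add: pos_less_divide_eq add_nonneg_pos)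
      finally show ?thesis using s by simp
    qed
    then have "\<bar>\<psi> (x + s *\<^sub>R v) - \<psi> x - (s *\<^sub>R v) \<bullet> G x - s\<^sup>2 * quad (H x) v / 2\<bar> \<le> s\<^sup>2 * (e' * (v \<bullet> v))"
      "\<bar>\<psi> (x - s *\<^sub>R v) - \<psi> x + (s *\<^sub>R v) \<bullet> G x - s\<^sup>2 * quad (H x) v / 2\<bar> \<le> s\<^sup>2 * (e' * (v \<bullet> v))"
      using tay[of "s *\<^sub>R v"] tay[of "- (s *\<^sub>R v)"]
      by (simp_all add: matrix_vector_mult_scaleR linear_neg[OF matrix_vector_mul_linear] power2_eq_square mult_ac)
    then have "\<bar>\<psi> (x + s *\<^sub>R v) + \<psi> (x - s *\<^sub>R v) - 2 * \<psi> x - s\<^sup>2 * quad (H x) v\<bar> \<le> s\<^sup>2 * (2 * e' * (v \<bullet> v))"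
      by (simp only: abs_le_iff) (simp add: algebra_simps)
    also have "\<dots> \<le> s\<^sup>2 * (e / 2)"
      using e'(2) by (intro mult_left_mono) auto
    finally have *: "\<bar>\<psi> (x + s *\<^sub>R v) + \<psi> (x - s *\<^sub>R v) - 2 * \<psi> x - s\<^sup>2 * quad (H x) v\<bar> \<le> s\<^sup>2 * (e / 2)" .
    have "(\<psi> (x + s *\<^sub>R v) + \<psi> (x - s *\<^sub>R v) - 2 * \<psi> x) / s\<^sup>2 - quad (H x) v
      = (\<psi> (x + s *\<^sub>R v) + \<psi> (x - s *\<^sub>R v) - 2 * \<psi> x - s\<^sup>2 * quad (H x) v) / s\<^sup>2"
      using s by (simp add: diff_divide_distrib)
    then have "\<bar>(\<psi> (x + s *\<^sub>R v) + \<psi> (x - s *\<^sub>R v) - 2 * \<psi> x) / s\<^sup>2 - quad (H x) v\<bar>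
      = \<bar>\<psi> (x + s *\<^sub>R v) + \<psi> (x - s *\<^sub>R v) - 2 * \<psi> x - s\<^sup>2 * quad (H x) v\<bar> / s\<^sup>2"
      by (simp only: abs_divide) simp
    also have "\<dots> \<le> e / 2" using * s by (simp add: pos_divide_le_eq mult_ac)
    finally show ?thesis using e by simp
  qed
  then show "\<forall>\<^sub>F s in at_right 0. dist ((\<psi> (x + s *\<^sub>R v) + \<psi> (x - s *\<^sub>R v) - 2 * \<psi> x) / s\<^sup>2) (quad (H x) v) < e"
    unfolding eventually_at_right_field dist_real_def using d
    by (intro exI[of _ "d / (norm v + 1)"]) (auto simp: add_nonneg_pos)
qed

section \<open>Contact of functions with \<open>C^2\<close> functions\<close>

lemma eventually_along_line:
  fixes x v :: "'a :: real_normed_vector"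
  assumes "eventually P (nhds x)"
  shows "\<forall>\<^sub>F s in at_right 0. P (x + s *\<^sub>R v) \<and> P (x - s *\<^sub>R v)"
proof -
  have "((\<lambda>s. x + s *\<^sub>R v) \<longlongrightarrow> x + 0 *\<^sub>R v) (at_right 0)" "((\<lambda>s. x - s *\<^sub>R v) \<longlongrightarrow> x - 0 *\<^sub>R v) (at_right 0)"
    by (intro tendsto_intros)+
  then show ?thesis
    using assms by (auto intro!: eventually_conj elim: eventually_compose_filterlim)
qed

lemma C2_data_local_max:
  assumes C: "C2_data S \<psi> G H" "open S" "x \<in> S" and "local_max_at \<psi> x"
  shows "G x = 0" and "quad (H x) v \<le> 0"
proof -
  obtain e where e: "e > 0" "\<And>y. dist y x < e \<Longrightarrow> \<psi> y \<le> \<psi> x"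
    using assms(4) unfolding local_max_at_def eventually_nhds_metric by blast
  have "(\<lambda>h. h \<bullet> G x) = (\<lambda>v. 0)"
    by (rule differential_zero_maxmin[OF _ open_ball C2_dataD(1)[OF C(1,3)], of x e])
      (use e in \<open>auto simp: dist_commute\<close>)
  then have "G x \<bullet> G x = 0" by meson
  then show "G x = 0" by simp
  have "\<forall>\<^sub>F s in at_right 0. (\<psi> (x + s *\<^sub>R v) + \<psi> (x - s *\<^sub>R v) - 2 * \<psi> x) / s\<^sup>2 \<le> 0"
    using eventually_along_line[OF assms(4)[unfolded local_max_at_def], of v]
    by eventually_elim (auto simp: divide_le_0_iff)
  then show "quad (H x) v \<le> 0"
    by (intro tendsto_upperbound[OF C2_data_second_difference[OF C]]) auto
qed

text \<open>Midpoint convexity makes the second differences of \<open>u\<close> nonnegative, and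
  contact from above passes the sign to \<open>\<psi>\<close>. For the subgradient inequality, the
  segment from \<open>y\<close> to \<open>x\<close> is prolonged beyond \<open>x\<close>, where
  \<open>\<psi>\<close> controls \<open>u\<close>; so a local contact gives a supporting plane on
  all of \<open>S\<close>.\<close>

lemma convex_touched_above:
  fixes u :: "real^'n \<Rightarrow> real"
  assumes conv: "convex_on S u" and C: "C2_data S \<psi> G H" "open S" "x \<in> S"
    and max: "local_max_at (\<lambda>y. u y - \<psi> y) x"
  shows "0 \<le> quad (H x) v" and "y \<in> S \<Longrightarrow> u x + (y - x) \<bullet> G x \<le> u y"
proof -
  note ev = max[unfolded local_max_at_def]
  have "\<forall>\<^sub>F s in at_right 0. x + s *\<^sub>R v \<in> S \<and> x - s *\<^sub>R v \<in> S"
    using C by (intro eventually_along_line) (auto simp: eventually_nhds)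
  with eventually_along_line[OF ev, of v]
  have "\<forall>\<^sub>F s in at_right 0. 0 \<le> (\<psi> (x + s *\<^sub>R v) + \<psi> (x - s *\<^sub>R v) - 2 * \<psi> x) / s\<^sup>2"
  proof eventually_elim
    case (elim s)
    have "u ((1 - 1/2) *\<^sub>R (x + s *\<^sub>R v) + (1/2) *\<^sub>R (x - s *\<^sub>R v))
        \<le> (1 - 1/2) * u (x + s *\<^sub>R v) + 1/2 * u (x - s *\<^sub>R v)"
      using elim by (intro convex_onD[OF conv]) auto
    also have "(1 - 1/2) *\<^sub>R (x + s *\<^sub>R v) + (1/2) *\<^sub>R (x - s *\<^sub>R v) = x"
      by (simp add: vec_eq_iff field_simps)
    finally show ?case using elim by (auto intro!: divide_nonneg_nonneg)
  qed
  then show "0 \<le> quad (H x) v"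
    by (intro tendsto_lowerbound[OF C2_data_second_difference[OF C]]) auto
  assume y: "y \<in> S"
  have line: "((\<lambda>s. x + s *\<^sub>R (x - y)) has_derivative (\<lambda>s. s *\<^sub>R (x - y))) (at 0)"
    by (auto intro!: derivative_eq_intros)
  have "((\<lambda>s. \<psi> (x + s *\<^sub>R (x - y))) has_real_derivative (x - y) \<bullet> G x) (at 0)"
    using has_derivative_compose[OF line, of \<psi> "\<lambda>h. h \<bullet> G x"] C2_dataD(1)[OF C(1,3)]
    by (simp add: has_field_derivative_def mult_commute_abs)
  then have lim: "((\<lambda>s. (\<psi> (x + s *\<^sub>R (x - y)) - \<psi> x) / s) \<longlongrightarrow> (x - y) \<bullet> G x) (at_right 0)"
    unfolding has_field_derivative_iff by (auto intro: tendsto_mono[OF at_le])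
  have "\<forall>\<^sub>F s in at_right 0. (0::real) < s"
    by (rule eventually_at_right_less)
  moreover have "\<forall>\<^sub>F s in at_right 0. x + s *\<^sub>R (x - y) \<in> S \<and> x - s *\<^sub>R (x - y) \<in> S"
    using C by (intro eventually_along_line) (auto simp: eventually_nhds)
  ultimately have "\<forall>\<^sub>F s in at_right 0. u x - u y \<le> (\<psi> (x + s *\<^sub>R (x - y)) - \<psi> x) / s"
    using eventually_along_line[OF ev, of "x - y"]
  proof eventually_elim
    case (elim s)
    \<comment> \<open>The weight with which \<open>x\<close> is the convex combination of
      \<open>y\<close> and of the point \<open>x + s (x - y)\<close> beyond
      \<open>x\<close>.\<close>
    define t where "t = s / (1 + s)"
    have t: "0 \<le> t" "t \<le> 1" "(1 + s) * t = s" "(1 + s) * (1 - t) = 1"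
      using elim by (auto simp: t_def divide_simps)
    have "(1 - t) *\<^sub>R (x + s *\<^sub>R (x - y)) + t *\<^sub>R y = ((1 + s) * (1 - t)) *\<^sub>R x + (t - (1 - t) * s) *\<^sub>R y"
      by (simp add: vec_eq_iff algebra_simps)
    also have "t - (1 - t) * s = 0" using t(3) by (simp add: algebra_simps)
    finally have "(1 - t) *\<^sub>R (x + s *\<^sub>R (x - y)) + t *\<^sub>R y = x" using t by simp
    with convex_onD[OF conv t(1,2), of "x + s *\<^sub>R (x - y)" y] elim y
    have "u x \<le> (1 - t) * u (x + s *\<^sub>R (x - y)) + t * u y" by simp
    then have "(1 + s) * u x \<le> (1 + s) * ((1 - t) * u (x + s *\<^sub>R (x - y)) + t * u y)"
      using elim by (intro mult_left_mono) auto
    also have "\<dots> = ((1 + s) * (1 - t)) * u (x + s *\<^sub>R (x - y)) + ((1 + s) * t) * u y"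
      by (simp add: algebra_simps)
    finally have "(1 + s) * u x \<le> u (x + s *\<^sub>R (x - y)) + s * u y" unfolding t(3,4) by simp
    then have "s * (u x - u y) \<le> u (x + s *\<^sub>R (x - y)) - u x" by (simp add: algebra_simps)
    also have "\<dots> \<le> \<psi> (x + s *\<^sub>R (x - y)) - \<psi> x" using elim by simp
    finally show ?case using elim by (simp add: pos_le_divide_eq mult.commute)
  qed
  then have "u x - u y \<le> (x - y) \<bullet> G x"
    by (intro tendsto_lowerbound[OF lim]) auto
  then show "u x + (y - x) \<bullet> G x \<le> u y" by (simp add: inner_diff_left)
qed

lemma C2_data_mixed_difference:
  assumes C: "C2_data S \<psi> G H" and near: "\<And>s t. \<lbrakk>0 \<le> s; s \<le> 1; 0 \<le> t; t \<le> 1\<rbrakk> \<Longrightarrow> x + s *\<^sub>R v + t *\<^sub>R w \<in> S"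
  obtains s t where "0 < s" "s < 1" "0 < t" "t < 1"
    "\<psi> (x + v + w) - \<psi> (x + v) - \<psi> (x + w) + \<psi> x = v \<bullet> (H (x + s *\<^sub>R v + t *\<^sub>R w) *v w)"
proof -
  have line: "((\<lambda>t. z + t *\<^sub>R v) has_derivative (\<lambda>s. s *\<^sub>R v)) (at t)" for t :: real and z v :: "real^'a"
    by (auto intro!: derivative_eq_intros)
  define \<phi> where "\<phi> s = \<psi> (x + w + s *\<^sub>R v) - \<psi> (x + s *\<^sub>R v)" for s
  have "(\<phi> has_real_derivative (v \<bullet> G (x + w + s *\<^sub>R v) - v \<bullet> G (x + s *\<^sub>R v))) (at s)" if "0 \<le> s" "s \<le> 1" for s
  proof -
    have "x + w + s *\<^sub>R v \<in> S" "x + s *\<^sub>R v \<in> S" using near[of s 1] near[of s 0] that by (auto simp: ac_simps)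
    then have "((\<lambda>s. \<psi> (x + w + s *\<^sub>R v)) has_real_derivative v \<bullet> G (x + w + s *\<^sub>R v)) (at s)"
      "((\<lambda>s. \<psi> (x + s *\<^sub>R v)) has_real_derivative v \<bullet> G (x + s *\<^sub>R v)) (at s)"
      using has_derivative_compose[OF line C2_dataD(1)[OF C]]
      by (simp_all add: has_field_derivative_def mult_commute_abs)
    then show ?thesis unfolding \<phi>_def by (intro DERIV_diff)
  qed
  then obtain s where s: "0 < s" "s < 1" "\<phi> 1 - \<phi> 0 = (1 - 0) * (v \<bullet> G (x + w + s *\<^sub>R v) - v \<bullet> G (x + s *\<^sub>R v))"
    using MVT2[of 0 1 \<phi> "\<lambda>s. v \<bullet> G (x + w + s *\<^sub>R v) - v \<bullet> G (x + s *\<^sub>R v)"] by auto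
  define z where "z = x + s *\<^sub>R v"
  have "((\<lambda>t. v \<bullet> G (z + t *\<^sub>R w)) has_real_derivative v \<bullet> (H (z + t *\<^sub>R w) *v w)) (at t)" if "0 \<le> t" "t \<le> 1" for t
  proof -
    have "z + t *\<^sub>R w \<in> S" using near[of s t] that s by (simp add: z_def)
    from has_derivative_inner_right[OF has_derivative_compose[OF line C2_dataD(2)[OF C this]], of v]
    show ?thesis by (simp add: has_field_derivative_def mult_commute_abs matrix_vector_mult_scaleR)
  qed
  then obtain t where t: "0 < t" "t < 1" "v \<bullet> G (z + 1 *\<^sub>R w) - v \<bullet> G (z + 0 *\<^sub>R w) = (1 - 0) * (v \<bullet> (H (z + t *\<^sub>R w) *v w))"
    using MVT2[of 0 1 "\<lambda>t. v \<bullet> G (z + t *\<^sub>R w)" "\<lambda>t. v \<bullet> (H (z + t *\<^sub>R w) *v w)"] by auto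
  show ?thesis
    using s t by (intro that[of s t]) (auto simp: \<phi>_def z_def ac_simps)
qed

text \<open>The mixed second difference is symmetric in its two directions and approximates both
  mixed derivatives, and \<open>H\<close> is continuous. Symmetry has to be proved because
  \<open>nonneg_sym\<close> asks for it while \<open>C2_on\<close> only speaks of the Jacobian of
  the gradient.\<close>

lemma C2_data_hessian_symmetric:
  assumes C: "C2_data S \<psi> G H" and S: "open S" "x \<in> S"
  shows "transpose (H x) = H x"
proof -
  have "H x $ i $ j = H x $ j $ i" for i j
  proof (rule ccontr)
    assume ne: "H x $ i $ j \<noteq> H x $ j $ i"
    define e where "e = \<bar>H x $ i $ j - H x $ j $ i\<bar> / 2"
    have e: "e > 0" using ne by (simp add: e_def)
    have "isCont H x"
      using C2_dataD(3)[OF C] S continuous_on_eq_continuous_at by blast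
    then obtain d1 where d1: "d1 > 0" "\<And>y. dist y x < d1 \<Longrightarrow> dist (H y) (H x) < e"
      unfolding continuous_at_eps_delta using e by metis
    obtain d2 where d2: "d2 > 0" "ball x d2 \<subseteq> S" using S openE by blast
    define r where "r = min d1 d2 / 3"
    have r: "r > 0" using d1 d2 by (simp add: r_def)
    define v where "v k = r *\<^sub>R axis k (1::real)" for k :: 'a
    have close: "dist (x + s *\<^sub>R v k + t *\<^sub>R v l) x < min d1 d2" if "0 \<le> s" "s \<le> 1" "0 \<le> t" "t \<le> 1" for s t k l
    proof -
      have "norm (s *\<^sub>R v k + t *\<^sub>R v l) \<le> s * r + t * r"
        using norm_triangle_ineq[of "s *\<^sub>R v k" "t *\<^sub>R v l"] that r by (simp add: v_def)
      also have "\<dots> \<le> r + r" using that r by (intro add_mono) (auto simp: mult_left_le_one_le)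
      also have "\<dots> < min d1 d2" using d1 d2 by (simp add: r_def min_def)
      finally show ?thesis by (simp add: dist_norm algebra_simps)
    qed
    have inS: "x + s *\<^sub>R v k + t *\<^sub>R v l \<in> S" if "0 \<le> s" "s \<le> 1" "0 \<le> t" "t \<le> 1" for s t k l
      using close[OF that, of k l] d2 by (auto simp: dist_commute)
    have entry: "v k \<bullet> (A *v v l) = r\<^sup>2 * A $ k $ l" for A :: "real^'a^'a" and k l
      by (simp add: v_def matrix_vector_mult_scaleR matrix_vector_mult_basis column_def inner_axis' power2_eq_square)
    obtain s t where st: "0 < s" "s < 1" "0 < t" "t < 1"
      "\<psi> (x + v i + v j) - \<psi> (x + v i) - \<psi> (x + v j) + \<psi> x = v i \<bullet> (H (x + s *\<^sub>R v i + t *\<^sub>R v j) *v v j)"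
      using C2_data_mixed_difference[OF C inS] by blast
    obtain s' t' where st': "0 < s'" "s' < 1" "0 < t'" "t' < 1"
      "\<psi> (x + v j + v i) - \<psi> (x + v j) - \<psi> (x + v i) + \<psi> x = v j \<bullet> (H (x + s' *\<^sub>R v j + t' *\<^sub>R v i) *v v i)"
      using C2_data_mixed_difference[OF C inS] by blast
    have eq: "H (x + s *\<^sub>R v i + t *\<^sub>R v j) $ i $ j = H (x + s' *\<^sub>R v j + t' *\<^sub>R v i) $ j $ i"
    proof -
      have "r\<^sup>2 * H (x + s *\<^sub>R v i + t *\<^sub>R v j) $ i $ j = r\<^sup>2 * H (x + s' *\<^sub>R v j + t' *\<^sub>R v i) $ j $ i"
        using st(5) st'(5) unfolding entry add.assoc[of x] add.commute[of "v j" "v i"] by linarith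
      then show ?thesis using r by (subst (asm) mult_cancel_left) auto
    qed
    have nb: "\<bar>H y $ k $ l - H x $ k $ l\<bar> < e" if "dist y x < d1" for y k l
    proof -
      have "\<bar>(H y - H x) $ k $ l\<bar> \<le> norm ((H y - H x) $ k)" by (rule component_le_norm_cart)
      also have "\<dots> \<le> norm (H y - H x)" by (rule Finite_Cartesian_Product.norm_nth_le)
      also have "\<dots> < e" using d1(2)[OF that] by (simp add: dist_norm)
      finally show ?thesis by simp
    qed
    have tri: "\<bar>p - q\<bar> \<le> \<bar>z - p\<bar> + \<bar>z - q\<bar>" for p q z :: real by linarith
    show False
      using tri[of "H x $ i $ j" "H x $ j $ i" "H (x + s *\<^sub>R v i + t *\<^sub>R v j) $ i $ j"] nb[of "x + s *\<^sub>R v i + t *\<^sub>R v j" i j] nb[of "x + s' *\<^sub>R v j + t' *\<^sub>R v i" j i]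
        close[of s t i j] close[of s' t' j i] st st' eq by (simp add: e_def)
  qed
  then show ?thesis by (simp add: transpose_def vec_eq_iff)
qed

subsection \<open>Mollification\<close>

lemma DERIV_pos_part_power:
  "((\<lambda>t::real. max 0 t ^ (k + 2)) has_real_derivative real (k + 2) * max 0 t ^ (k + 1)) (at t)"
proof (cases "t = 0")
  case False
  show ?thesis
  proof (cases "t > 0")
    case True
    have "((\<lambda>t::real. t ^ (k + 2)) has_real_derivative real (k + 2) * t ^ (k + 1)) (at t)"
      using DERIV_pow[of "k + 2" t] by simp
    then have "((\<lambda>t::real. max 0 t ^ (k + 2)) has_real_derivative real (k + 2) * t ^ (k + 1)) (at t)"
      by (rule has_field_derivative_transform_within_open[where S="{0<..}"]) (use True in auto)
    then show ?thesis using True by simp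
  next
    case neg: False
    have "((\<lambda>t::real. max 0 t ^ (k + 2)) has_real_derivative 0) (at t)"
      by (rule has_field_derivative_transform_within_open[where S="{..<0}" and f="\<lambda>_. 0"])
        (use False neg in auto)
    then show ?thesis using False neg by simp
  qed
next
  case True
  have "((\<lambda>h::real. max 0 h ^ (k + 2) / h) \<longlongrightarrow> 0) (at 0)"
  proof (rule Lim_null_comparison)
    show "((\<lambda>h::real. \<bar>h\<bar> ^ (k + 1)) \<longlongrightarrow> 0) (at 0)"
      by (rule tendsto_eq_intros refl | simp)+
    show "\<forall>\<^sub>F h in at (0::real). norm (max 0 h ^ (k + 2) / h) \<le> \<bar>h\<bar> ^ (k + 1)"
      by (rule always_eventually) (auto simp: max_def mult_nonpos_nonneg)
  qed
  then show ?thesis using True by (simp add: has_field_derivative_iff)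
qed

text \<open>The kernel is a multiple of the cubed positive part \<open>m\<close> of
  \<open>r^2 - |z|^2\<close>: the cube is the lowest integer power with a continuous Hessian, and
  its derivatives are explicit polynomials in \<open>m\<close> and \<open>z\<close>.\<close>

lemma exists_mollifier:
  assumes r: "r > 0"
  obtains \<rho> G H where "C2_data (UNIV :: (real^'n) set) \<rho> G H" "\<And>z. 0 \<le> \<rho> z"
    "\<And>z. r \<le> norm z \<Longrightarrow> \<rho> z = 0 \<and> G z = 0 \<and> H z = 0" "avg r \<rho> = 1"
proof -
  define m where "m z = max 0 (r\<^sup>2 - z \<bullet> z)" for z :: "real^'n"
  define \<beta> where "\<beta> z = m z ^ 3" for z
  define G where "G z = (- 6 * (m z)\<^sup>2) *\<^sub>R z" for z
  define H :: "real^'n \<Rightarrow> real^'n^'n" where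
    "H z = (- 6 * (m z)\<^sup>2) *\<^sub>R mat 1 + (24 * m z) *\<^sub>R (\<chi> i j. z $ i * z $ j)" for z
  have inner: "((\<lambda>z. r\<^sup>2 - z \<bullet> z) has_derivative (\<lambda>h. - 2 * (h \<bullet> z))) (at z)" for z :: "real^'n"
    by (auto intro!: derivative_eq_intros simp: inner_commute)
  have pw: "((\<lambda>z. m z ^ (k + 2)) has_derivative (\<lambda>h. - 2 * real (k + 2) * m z ^ (k + 1) * (h \<bullet> z))) (at z)" for k z
  proof -
    have "((\<lambda>z. m z ^ (k + 2)) has_derivative (\<lambda>h. real (k + 2) * m z ^ (k + 1) * (- 2 * (h \<bullet> z)))) (at z)"
      using has_derivative_compose[OF inner DERIV_pos_part_power[of k, unfolded has_field_derivative_def], of z]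
      by (simp only: m_def[abs_def])
    then show ?thesis by (rule has_derivative_eq_rhs) (simp add: algebra_simps)
  qed
  have d1: "(\<beta> has_derivative (\<lambda>h. h \<bullet> G z)) (at z)" for z
    using pw[of 1 z] by (simp add: \<beta>_def[abs_def] G_def numeral_3_eq_3 numeral_2_eq_2 mult_ac)
  have outer: "(\<chi> i j. z $ i * z $ j) *v h = (h \<bullet> z) *\<^sub>R z" for z h :: "real^'n"
    by (simp add: vec_eq_iff matrix_vector_mult_def inner_vec_def sum_distrib_left mult_ac)
  have d2: "(G has_derivative (\<lambda>h. H z *v h)) (at z)" for z
  proof -
    have "((\<lambda>z. (m z)\<^sup>2) has_derivative (\<lambda>h. - 4 * m z * (h \<bullet> z))) (at z)"
      using pw[of 0 z] by (simp add: numeral_2_eq_2)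
    from has_derivative_scaleR[OF has_derivative_mult_right[OF this, of "- 6"] has_derivative_ident]
    have "(G has_derivative (\<lambda>h. (- 6 * (m z)\<^sup>2) *\<^sub>R h + (- 6 * (- 4 * m z * (h \<bullet> z))) *\<^sub>R z)) (at z)"
      by (simp only: G_def[abs_def])
    moreover have "H z *v h = (- 6 * (m z)\<^sup>2) *\<^sub>R h + (- 6 * (- 4 * m z * (h \<bullet> z))) *\<^sub>R z" for h
      by (simp add: H_def matrix_vector_mult_add_rdistrib scaleR_matrix_vector_assoc[symmetric] outer
        del: scaleR_minus_left) 
    ultimately show ?thesis by (simp only:)
  qed
  have mc: "continuous_on UNIV m"
    unfolding m_def[abs_def] by (intro continuous_intros)
  have "continuous_on UNIV H"
    unfolding H_def[abs_def] by (intro continuous_intros mc continuous_on_vec_lambda)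
  with d1 d2 have C: "C2_data UNIV \<beta> G H" by (simp add: C2_data_def)
  have supp: "m z = 0" if "r \<le> norm z" for z
  proof -
    have "r\<^sup>2 \<le> (norm z)\<^sup>2" using that r by (intro power_mono) auto
    then show ?thesis by (simp add: m_def power2_norm_eq_inner)
  qed
  let ?B = "cbox (- vec r) (vec r) :: (real^'n) set"
  define I where "I = integral ?B \<beta>"
  have bc: "continuous_on ?B \<beta>"
    unfolding \<beta>_def[abs_def] by (intro continuous_intros continuous_on_subset[OF mc]) auto
  have b0: "\<beta> z \<ge> 0" for z by (simp add: \<beta>_def m_def)
  have "I \<noteq> 0"
  proof
    assume "I = 0"
    have ne: "box (- vec r) (vec r :: real^'n) \<noteq> {}" using r by (simp add: interval_eq_empty_cart)
    have "0 \<in> ?B" using r by (simp add: mem_box_cart)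
    have "\<beta> 0 = 0"
      using integral_cbox_eq_0_iff[OF bc ne b0] \<open>I = 0\<close> \<open>0 \<in> ?B\<close> unfolding I_def by blast
    then show False using r by (simp add: \<beta>_def m_def)
  qed
  moreover have "I \<ge> 0" unfolding I_def by (intro integral_nonneg integrable_continuous bc b0)
  ultimately have I: "I > 0" by simp
  show ?thesis
  proof (rule that[of "\<lambda>z. (1 / I) * \<beta> z" "\<lambda>z. (1 / I) *\<^sub>R G z" "\<lambda>z. (1 / I) *\<^sub>R H z"])
    show "C2_data UNIV (\<lambda>z. (1 / I) * \<beta> z) (\<lambda>z. (1 / I) *\<^sub>R G z) (\<lambda>z. (1 / I) *\<^sub>R H z)"
      by (rule C2_data_scale[OF C])
    show "0 \<le> (1 / I) * \<beta> z" for z using I b0 by simp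
    show "(1 / I) * \<beta> z = 0 \<and> (1 / I) *\<^sub>R G z = 0 \<and> (1 / I) *\<^sub>R H z = 0" if "r \<le> norm z" for z
      using supp[OF that] by (simp add: \<beta>_def G_def H_def)
    show "integral ?B (\<lambda>z. (1 / I) * \<beta> z) = 1"
      using I by (simp add: I_def[symmetric])
  qed
qed

text \<open>Differentiation under the integral sign; all derivatives fall on the kernel. The
  derivative is a \<open>blinfun\<close> because the Leibniz rule asks for its continuity as an
  operator.\<close>

lemma has_derivative_convolution:
  fixes \<rho> :: "'a::euclidean_space \<Rightarrow> 'b::euclidean_space" and D :: "'a \<Rightarrow> 'a \<Rightarrow>\<^sub>L 'b"
  assumes der: "\<And>z. (\<rho> has_derivative blinfun_apply (D z)) (at z)"
    and D: "continuous_on UNIV D" and w: "continuous_on UNIV (w :: 'a \<Rightarrow> real)"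
  shows "((\<lambda>x. integral (cbox a b) (\<lambda>y. w y *\<^sub>R \<rho> (x - y))) has_derivative
    (\<lambda>h. integral (cbox a b) (\<lambda>y. w y *\<^sub>R blinfun_apply (D (x - y)) h))) (at x)"
proof -
  have \<rho>: "continuous_on UNIV \<rho>"
    using der by (meson differentiable_at_imp_differentiable_on differentiable_imp_continuous_on differentiableI)
  have shift: "((\<lambda>x. x - y) has_derivative (\<lambda>h. h)) (at x)" for x y :: 'a
    by (auto intro!: derivative_eq_intros)
  have "((\<lambda>x. integral (cbox a b) (\<lambda>y. w y *\<^sub>R \<rho> (x - y))) has_derivative
      integral (cbox a b) (\<lambda>y. w y *\<^sub>R D (x - y))) (at x within UNIV)"
  proof (rule leibniz_rule)
    show "((\<lambda>x. w y *\<^sub>R \<rho> (x - y)) has_derivative blinfun_apply (w y *\<^sub>R D (x - y))) (at x within UNIV)" for x y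
      using has_derivative_scaleR_right[OF has_derivative_compose[OF shift der], of "w y" y x]
      by (simp add: scaleR_blinfun.rep_eq)
    show "(\<lambda>y. w y *\<^sub>R \<rho> (x - y)) integrable_on cbox a b" for x
      by (intro integrable_continuous continuous_intros continuous_on_subset[OF w] continuous_on_compose2[OF \<rho>]) auto
    show "continuous_on (UNIV \<times> cbox a b) (\<lambda>(x, y). w y *\<^sub>R D (x - y))"
      unfolding split_beta
      by (intro continuous_intros continuous_on_compose2[OF w] continuous_on_compose2[OF D]) auto
  qed auto
  moreover have "(\<lambda>y. w y *\<^sub>R D (x - y)) integrable_on cbox a b"
    by (intro integrable_continuous continuous_intros continuous_on_subset[OF w] continuous_on_compose2[OF D]) auto
  then have "blinfun_apply (integral (cbox a b) (\<lambda>y. w y *\<^sub>R D (x - y)))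
      = (\<lambda>h. integral (cbox a b) (\<lambda>y. w y *\<^sub>R blinfun_apply (D (x - y)) h))"
    by (simp add: fun_eq_iff blinfun_apply_integral scaleR_blinfun.rep_eq)
  ultimately show ?thesis by simp
qed

lemma C2_data_convolution:
  fixes w :: "real^'n \<Rightarrow> real"
  assumes C: "C2_data UNIV \<rho> G H" and w: "continuous_on UNIV w"
  shows "C2_data UNIV (\<lambda>x. integral (cbox a b) (\<lambda>y. w y *\<^sub>R \<rho> (x - y)))
    (\<lambda>x. integral (cbox a b) (\<lambda>y. w y *\<^sub>R G (x - y))) (\<lambda>x. integral (cbox a b) (\<lambda>y. w y *\<^sub>R H (x - y)))"
proof -
  have cont: "continuous_on UNIV G" "continuous_on UNIV H"
    using C2_dataD(2,3)[OF C]
    by (meson UNIV_I differentiable_at_imp_differentiable_on differentiable_imp_continuous_on differentiableI)+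
  have i1: "(\<lambda>y. w y *\<^sub>R G (x - y)) integrable_on cbox a b" for x
    by (intro integrable_continuous continuous_intros continuous_on_subset[OF w] continuous_on_compose2[OF cont(1)]) auto
  have i2: "(\<lambda>y. w y *\<^sub>R H (x - y)) integrable_on cbox a b" for x
    by (intro integrable_continuous continuous_intros continuous_on_subset[OF w] continuous_on_compose2[OF cont(2)]) auto
  have "((\<lambda>x. integral (cbox a b) (\<lambda>y. w y *\<^sub>R \<rho> (x - y))) has_derivative
      (\<lambda>h. integral (cbox a b) (\<lambda>y. w y *\<^sub>R blinfun_apply (blinfun_inner_left (G (x - y))) h))) (at x)" for x
    by (rule has_derivative_convolution[OF _ _ w])
      (auto simp: C2_dataD(1)[OF C] intro!: continuous_intros cont)
  moreover have "integral (cbox a b) (\<lambda>y. w y *\<^sub>R blinfun_apply (blinfun_inner_left (G (x - y))) h)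
      = h \<bullet> integral (cbox a b) (\<lambda>y. w y *\<^sub>R G (x - y))" for x h
    using integral_linear[OF i1 bounded_linear_inner_right, of h] by (simp add: o_def)
  moreover
  have lin: "linear (\<lambda>A :: real^'n^'n. Blinfun ((*v) A))"
    by (rule linearI; rule blinfun_eqI)
      (simp_all add: bounded_linear_Blinfun_apply plus_blinfun.rep_eq scaleR_blinfun.rep_eq
        matrix_vector_mult_add_rdistrib scaleR_matrix_vector_assoc[symmetric])
  have "((\<lambda>x. integral (cbox a b) (\<lambda>y. w y *\<^sub>R G (x - y))) has_derivative
      (\<lambda>h. integral (cbox a b) (\<lambda>y. w y *\<^sub>R blinfun_apply (Blinfun ((*v) (H (x - y)))) h))) (at x)" for x
    by (rule has_derivative_convolution[OF _ _ w])
      (auto simp: C2_dataD(2)[OF C] bounded_linear_Blinfun_apply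
        intro!: continuous_on_compose2[OF linear_continuous_on[OF linear_conv_bounded_linear[THEN iffD1, OF lin]] cont(2)])
  moreover have "integral (cbox a b) (\<lambda>y. w y *\<^sub>R blinfun_apply (Blinfun ((*v) (H (x - y)))) h)
      = integral (cbox a b) (\<lambda>y. w y *\<^sub>R H (x - y)) *v h" for x h
  proof -
    have "bounded_linear (\<lambda>A :: real^'n^'n. A *v h)"
      unfolding linear_conv_bounded_linear[symmetric]
      by (rule linearI) (simp_all add: matrix_vector_mult_add_rdistrib scaleR_matrix_vector_assoc[symmetric])
    from integral_linear[OF i2 this] show ?thesis
      by (simp add: o_def bounded_linear_Blinfun_apply scaleR_matrix_vector_assoc[symmetric])
  qed
  moreover have "continuous_on UNIV (\<lambda>x. integral (cbox a b) (\<lambda>y. w y *\<^sub>R H (x - y)))"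
    unfolding split_beta
    by (intro integral_continuous_on_param)
      (auto simp: split_beta intro!: continuous_intros continuous_on_compose2[OF w] continuous_on_compose2[OF cont(2)])
  ultimately show ?thesis by (simp add: C2_data_def)
qed

lemma norm_in_cbox_vec:
  fixes x :: "real^'n"
  assumes "norm x \<le> r"
  shows "x \<in> cbox (- vec r) (vec r)"
  unfolding mem_box_cart
proof
  fix i
  have "\<bar>x $ i\<bar> \<le> r" using component_le_norm_cart[of x i] assms by linarith
  then show "(- vec r :: real^'n) $ i \<le> x $ i \<and> x $ i \<le> (vec r :: real^'n) $ i" by (simp add: abs_le_iff)
qed

lemma integral_cbox_support:
  fixes F :: "'a::euclidean_space \<Rightarrow> real"
  assumes "\<And>y. F y \<noteq> 0 \<Longrightarrow> y \<in> cbox a b"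
  shows "integral (cbox a b) F = integral UNIV F"
proof -
  have "integral UNIV F = integral UNIV (\<lambda>y. if y \<in> cbox a b then F y else 0)"
    using assms by (intro arg_cong[where f="integral UNIV"] ext) auto
  then show ?thesis by (simp add: integral_restrict_UNIV)
qed

text \<open>Substitution \<open>y = x - z\<close>. The left form averages translates of
  \<open>w\<close>, good for inequalities; the right one puts \<open>x\<close> into the kernel, good
  for derivatives. The supports let both boxes be replaced by the whole space.\<close>

lemma convolution_commute:
  fixes w \<rho> :: "real^'n \<Rightarrow> real"
  assumes w: "\<And>y. L \<le> norm y \<Longrightarrow> w y = 0" and \<rho>: "\<And>z. r \<le> norm z \<Longrightarrow> \<rho> z = 0"
  shows "avg r (\<lambda>z. \<rho> z * w (x - z)) =
    integral (cbox (- vec L) (vec L)) (\<lambda>y. w y * \<rho> (x - y))"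
proof -
  define F where "F y = w y * \<rho> (x - y)" for y
  have "avg r (\<lambda>z. \<rho> z * w (x - z))
      = integral (cbox (- vec r) (- (- vec r))) (\<lambda>z. (F \<circ> (+) x) (- z))"
    by (simp add: F_def mult.commute)
  also have "\<dots> = avg r (F \<circ> (+) x)" by (rule integral_reflect)
  also have "\<dots> = integral (cbox (- vec r + x) (vec r + x)) F" by (rule integral_shift_cbox_plus)
  also have "\<dots> = integral UNIV F"
  proof (rule integral_cbox_support)
    fix y assume "F y \<noteq> 0"
    then have "\<not> r \<le> norm (x - y)" using \<rho>[of "x - y"] by (auto simp: F_def)
    then have "norm (y - x) \<le> r" by (simp add: norm_minus_commute)
    from norm_in_cbox_vec[OF this] show "y \<in> cbox (- vec r + x) (vec r + x)"
      by (simp add: mem_box_cart) (smt (verit))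
  qed
  also have "\<dots> = integral (cbox (- vec L) (vec L)) F"
  proof (rule integral_cbox_support[symmetric])
    fix y assume "F y \<noteq> 0"
    then have "\<not> L \<le> norm y" using w[of y] by (auto simp: F_def)
    then show "y \<in> cbox (- vec L) (vec L)" by (intro norm_in_cbox_vec) simp
  qed
  finally show ?thesis by (simp add: F_def[abs_def])
qed

lemma uniformly_continuous_compact_support:
  fixes H :: "'a::euclidean_space \<Rightarrow> 'b::real_normed_vector"
  assumes "continuous_on UNIV H" and supp: "\<And>x. L \<le> norm x \<Longrightarrow> H x = 0"
  shows "uniformly_continuous_on UNIV H"
  unfolding uniformly_continuous_on_def
proof (intro allI impI)
  fix e :: real assume e: "e > 0"
  have "uniformly_continuous_on (cball 0 (L + 1)) H"
    using assms(1) by (intro compact_uniformly_continuous) (auto intro: continuous_on_subset)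
  then obtain d where d: "d > 0"
    "\<And>x y. x \<in> cball 0 (L + 1) \<Longrightarrow> y \<in> cball 0 (L + 1) \<Longrightarrow> dist y x < d \<Longrightarrow> dist (H y) (H x) < e"
    using e unfolding uniformly_continuous_on_def by metis
  \<comment> \<open>Below distance \<open>1\<close>, a pair of which one point leaves the ball of
    radius \<open>L + 1\<close> lies outside the open ball of radius \<open>L\<close>, where
    \<open>H\<close> vanishes.\<close>
  have "dist (H y) (H x) < e" if xy: "dist y x < min d 1" for x y
  proof (cases "norm x \<le> L + 1 \<and> norm y \<le> L + 1")
    case True
    then show ?thesis using d(2)[of x y] xy by simp
  next
    case False
    have "norm x \<le> norm y + dist y x" "norm y \<le> norm x + dist y x"
      using norm_triangle_sub[of x y] norm_triangle_sub[of y x] by (auto simp: dist_norm norm_minus_commute)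
    then have "L \<le> norm x" "L \<le> norm y" using False xy by auto
    then show ?thesis using supp e by simp
  qed
  then show "\<exists>d>0. \<forall>x\<in>UNIV. \<forall>x'\<in>UNIV. dist x' x < d \<longrightarrow> dist (H x') (H x) < e"
    using d(1) by (intro exI[of _ "min d 1"]) auto
qed

text \<open>The support of the new Hessian is bounded, so it is uniformly continuous; this makes the
  error of second differences uniform in the base point.\<close>

lemma smooth_convolution:
  fixes w :: "real^'n \<Rightarrow> real"
  assumes C: "C2_data UNIV \<rho> G H" and \<rho>: "\<And>z. r \<le> norm z \<Longrightarrow> \<rho> z = 0 \<and> G z = 0 \<and> H z = 0"
    and w: "continuous_on UNIV w" and supp: "\<And>y. L \<le> norm y \<Longrightarrow> w y = 0"
  obtains G' H' where
    "C2_data UNIV (\<lambda>x. avg r (\<lambda>z. \<rho> z * w (x - z))) G' H'"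
    "uniformly_continuous_on UNIV H'" "\<And>x. L + r \<le> norm x \<Longrightarrow> H' x = 0"
proof -
  let ?H = "\<lambda>x. integral (cbox (- vec L) (vec L)) (\<lambda>y. w y *\<^sub>R H (x - y))"
  have eq: "(\<lambda>x. avg r (\<lambda>z. \<rho> z * w (x - z)))
      = (\<lambda>x. integral (cbox (- vec L) (vec L)) (\<lambda>y. w y *\<^sub>R \<rho> (x - y)))"
    using convolution_commute[of L w r \<rho>] supp \<rho> by simp
  note C' = C2_data_convolution[OF C w, of "- vec L" "vec L"]
  have zero: "?H x = 0" if "L + r \<le> norm x" for x
  proof -
    have "w y *\<^sub>R H (x - y) = 0" for y
    proof (cases "L \<le> norm y")
      case False
      then have "r \<le> norm (x - y)" using that norm_triangle_ineq2[of x y] by linarith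
      then show ?thesis using \<rho> by simp
    qed (simp add: supp)
    then show ?thesis by (simp only: integral_0)
  qed
  have "C2_data UNIV (\<lambda>x. avg r (\<lambda>z. \<rho> z * w (x - z)))
      (\<lambda>x. integral (cbox (- vec L) (vec L)) (\<lambda>y. w y *\<^sub>R G (x - y))) ?H"
    unfolding eq using C' by (simp only:)
  then show ?thesis
    by (rule that[OF _ uniformly_continuous_compact_support[OF C2_dataD(3)[OF C'] zero] zero])
qed

text \<open>The step bound \<open>h0\<close> must not depend on \<open>x\<close>, because the
  resolvent iterates evaluate functions at ever more distant translates.\<close>

lemma C2_data_uniform_second_difference:
  fixes P :: "real^'n^'n"
  assumes C: "C2_data UNIV \<psi> G H" and uc: "uniformly_continuous_on UNIV H" and e: "e > 0"
  obtains h0 where "h0 > 0" "\<And>h x i. 0 < h \<Longrightarrow> h < h0 \<Longrightarrow>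
    \<bar>\<psi> (x + h *\<^sub>R P $ i) + \<psi> (x - h *\<^sub>R P $ i) - 2 * \<psi> x - h\<^sup>2 * (quad (H x) (P $ i))\<bar> \<le> e * h\<^sup>2"
proof -
  define S where "S = (\<Sum>i\<in>UNIV. P $ i \<bullet> P $ i)"
  have S: "P $ i \<bullet> P $ i \<le> S" for i
    unfolding S_def by (rule member_le_sum) auto
  have S0: "S \<ge> 0" unfolding S_def by (intro sum_nonneg) auto
  have N: "real CARD('n) > 0" by simp
  define e' where "e' = e / (real CARD('n) * (S + 1))"
  have e': "e' > 0" "real CARD('n) * e' * (S + 1) = e" using e S0 by (simp_all add: e'_def)
  obtain d where d: "d > 0" "\<And>x y. dist y x < d \<Longrightarrow> dist (H y) (H x) < e'"
    using uc e' unfolding uniformly_continuous_on_def by (metis UNIV_I)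
  define h0 where "h0 = d / (S + 1)"
  have small: "\<bar>quad (H (x + t *\<^sub>R v)) v - quad (H x) v\<bar> \<le> real CARD('n) * e' * (v \<bullet> v)"
    if "norm v < d" "0 < t" "t < 1" for v x t
  proof -
    have "norm (t *\<^sub>R v) \<le> norm v" using that by (simp add: mult_left_le_one_le)
    then have "norm (H (x + t *\<^sub>R v) - H x) \<le> e'"
      using d(2)[of "x + t *\<^sub>R v" x] that by (simp add: dist_norm)
    then show ?thesis
      by (intro order_trans[OF matrix_quadratic_diff_bound] mult_right_mono mult_left_mono) auto
  qed
  have one: "\<bar>\<psi> (x + v) - \<psi> x - v \<bullet> G x - quad (H x) v / 2\<bar> \<le> real CARD('n) * e' * (v \<bullet> v) / 2"
    if v: "norm v < d" for x v
  proof -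
    obtain t where t: "0 < t" "t < 1" "\<psi> (x + v) = \<psi> x + v \<bullet> G x + quad (H (x + t *\<^sub>R v)) v / 2"
      using C2_data_line_taylor[OF C] by blast
    from small[OF v t(1,2), of x] show ?thesis unfolding t(3) by linarith
  qed
  show ?thesis
  proof (rule that[of h0])
    show "h0 > 0" using d S0 by (simp add: h0_def)
    fix h x i assume h: "0 < h" "h < h0"
    define v where "v = h *\<^sub>R P $ i"
    have vv: "v \<bullet> v = h\<^sup>2 * (P $ i \<bullet> P $ i)" by (simp add: v_def power2_eq_square)
    have "(norm (P $ i))\<^sup>2 \<le> S" using S[of i] by (simp add: power2_norm_eq_inner)
    also have "S \<le> (S + 1)\<^sup>2" using S0 by (simp add: power2_eq_square algebra_simps)
    finally have "norm (P $ i) \<le> S + 1" using S0 by (auto intro: power2_le_imp_le)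
    then have "norm v \<le> h * (S + 1)" using h by (simp add: v_def)
    also have "\<dots> < d" using h S0 by (simp add: h0_def pos_less_divide_eq)
    finally have nv: "norm v < d" .
    have mv: "norm (- v) < d" using nv by simp
    have b: "real CARD('n) * e' * (v \<bullet> v) \<le> e * h\<^sup>2"
    proof -
      have "real CARD('n) * e' * (P $ i \<bullet> P $ i) \<le> real CARD('n) * e' * (S + 1)"
        using S[of i] e' by (intro mult_left_mono) auto
      then have "real CARD('n) * e' * (P $ i \<bullet> P $ i) * h\<^sup>2 \<le> e * h\<^sup>2"
        unfolding e'(2) by (intro mult_right_mono) auto
      then show ?thesis by (simp add: vv mult_ac)
    qed
    have q: "quad (H x) v = h\<^sup>2 * (quad (H x) (P $ i))"
      by (simp add: v_def matrix_vector_mult_scaleR power2_eq_square)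
    show "\<bar>\<psi> (x + h *\<^sub>R P $ i) + \<psi> (x - h *\<^sub>R P $ i) - 2 * \<psi> x - h\<^sup>2 * (quad (H x) (P $ i))\<bar> \<le> e * h\<^sup>2"
    proof -
      have "\<bar>\<psi> (x - v) - \<psi> x + v \<bullet> G x - quad (H x) v / 2\<bar> \<le> real CARD('n) * e' * (v \<bullet> v) / 2"
        using one[OF mv, of x] by (simp add: linear_neg[OF matrix_vector_mul_linear])
      then show ?thesis
        using one[OF nv, of x] b unfolding q[symmetric] v_def[symmetric] abs_le_iff by linarith
    qed
  qed
qed

subsection \<open>A discrete resolvent\<close>

text \<open>The unnormalised sum over the \<open>2 N\<close> neighbours of \<open>x\<close> for a
  walk with steps along the rows of \<open>P\<close>. The range type is left open so that the same
  operator acts on functions, gradients and Hessians.\<close>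

definition walk_sum :: "real^'n^'n \<Rightarrow> real \<Rightarrow> (real^'n \<Rightarrow> 'b::real_vector) \<Rightarrow> real^'n \<Rightarrow> 'b" where
  "walk_sum P h g x = (\<Sum>i\<in>UNIV. g (x + h *\<^sub>R P $ i) + g (x - h *\<^sub>R P $ i))"

text \<open>Iterates of \<open>\<mu> v = \<mu> g + walk_sum v - 2N v\<close>, the equation \<open>l v - L v = l g\<close> with
  \<open>L v = tr (P D\<^sup>2v P\<^sup>T)\<close> discretised with step \<open>h\<close> along the rows of \<open>P\<close>, where
  \<open>\<mu> = l h\<^sup>2\<close>. Each iterate averages finitely many translates of \<open>g\<close>: it is
  monotone in \<open>g\<close>, smooth when \<open>g\<close> is, and commutes with convolutions.\<close>

primrec resolvent :: "real^'n^'n \<Rightarrow> real \<Rightarrow> real \<Rightarrow> (real^'n \<Rightarrow> 'b::real_vector) \<Rightarrow> nat \<Rightarrow> real^'n \<Rightarrow> 'b" where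
  "resolvent P h \<mu> g 0 = (\<lambda>x. 0)"
| "resolvent P h \<mu> g (Suc n) =
    (\<lambda>x. (1 / (\<mu> + 2 * real CARD('n))) *\<^sub>R (\<mu> *\<^sub>R g x + walk_sum P h (resolvent P h \<mu> g n) x))"

lemma walk_sum_mono: "(\<And>x. g x \<le> g' x) \<Longrightarrow> walk_sum P h g x \<le> walk_sum P h (g' :: _ \<Rightarrow> real) x"
  unfolding walk_sum_def by (intro sum_mono add_mono) auto

lemma walk_sum_const: "walk_sum P h (\<lambda>x. c :: real) x = 2 * real CARD('n) * c"
  for P :: "real^'n^'n"
  by (simp add: walk_sum_def)

lemma walk_sum_add: "walk_sum P h (\<lambda>x. f x + g x) x = walk_sum P h f x + walk_sum P h g x"
  by (simp add: walk_sum_def sum.distrib ac_simps)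

lemma walk_sum_cmult: "walk_sum P h (\<lambda>x. c * g x) x = c * walk_sum P h g x" for c :: real
  by (simp add: walk_sum_def sum_distrib_left distrib_left)

lemma walk_sum_square: "walk_sum P h (\<lambda>y. (y - z) \<bullet> (y - z)) x
    = 2 * real CARD('n) * ((x - z) \<bullet> (x - z)) + 2 * h\<^sup>2 * (\<Sum>i\<in>UNIV. P $ i \<bullet> P $ i)"
  for P :: "real^'n^'n"
proof -
  have "(x + h *\<^sub>R P $ i - z) \<bullet> (x + h *\<^sub>R P $ i - z) + (x - h *\<^sub>R P $ i - z) \<bullet> (x - h *\<^sub>R P $ i - z)
      = 2 * ((x - z) \<bullet> (x - z)) + 2 * h\<^sup>2 * (P $ i \<bullet> P $ i)" for i
    by (simp add: inner_add_left inner_add_right inner_diff_left inner_diff_right inner_commute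
        power2_eq_square algebra_simps)
  then show ?thesis
    by (simp add: walk_sum_def sum.distrib sum_distrib_left)
qed

context
  fixes P :: "real^'n^'n" and h \<mu> :: real
  assumes \<mu>: "\<mu> > 0"
begin

lemma resolvent_denominator_pos: "(2 * real CARD('n)) > 0" "\<mu> + (2 * real CARD('n)) > 0"
  using \<mu> by (auto simp: add_pos_pos)

lemma resolvent_Suc_real:
  "(\<mu> + 2 * real CARD('n)) * resolvent P h \<mu> g (Suc n) x = \<mu> * g x + walk_sum P h (resolvent P h \<mu> g n) x"
  for g :: "real^'n \<Rightarrow> real"
  using resolvent_denominator_pos by simp

text \<open>\<open>B\<close> is a discrete supersolution. The iteration starts from zero, which may
  exceed \<open>B\<close> by up to \<open>e\<close>, and each step shrinks this excess by the
  contraction factor \<open>2 N / (\<mu> + 2 N)\<close>.\<close>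

lemma resolvent_barrier:
  fixes g B :: "real^'n \<Rightarrow> real"
  assumes B: "\<And>x. \<mu> * g x + walk_sum P h B x \<le> (\<mu> + 2 * real CARD('n)) * B x" and e: "\<And>x. 0 \<le> B x + e"
  shows "resolvent P h \<mu> g n x \<le> B x + ((2 * real CARD('n)) / (\<mu> + 2 * real CARD('n))) ^ n * e"
proof (induction n arbitrary: x)
  case 0
  then show ?case using e by simp
next
  case (Suc n)
  have "(\<mu> + 2 * real CARD('n)) * resolvent P h \<mu> g (Suc n) x = \<mu> * g x + walk_sum P h (resolvent P h \<mu> g n) x"
    by (rule resolvent_Suc_real)
  also have "\<dots> \<le> \<mu> * g x + walk_sum P h (\<lambda>x. B x + ((2 * real CARD('n)) / (\<mu> + 2 * real CARD('n))) ^ n * e) x"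
    by (intro add_left_mono walk_sum_mono Suc)
  also have "\<dots> = \<mu> * g x + walk_sum P h B x + (2 * real CARD('n)) * (((2 * real CARD('n)) / (\<mu> + 2 * real CARD('n))) ^ n * e)"
    by (simp add: walk_sum_add walk_sum_const)
  also have "\<dots> \<le> (\<mu> + 2 * real CARD('n)) * B x + (2 * real CARD('n)) * (((2 * real CARD('n)) / (\<mu> + 2 * real CARD('n))) ^ n * e)"
    using B by simp
  also have "\<dots> = (\<mu> + 2 * real CARD('n)) * (B x + ((2 * real CARD('n)) / (\<mu> + 2 * real CARD('n))) ^ Suc n * e)"
  proof -
    have "(\<mu> + 2 * real CARD('n)) * (2 * real CARD('n) / (\<mu> + 2 * real CARD('n))) = 2 * real CARD('n)"
      using resolvent_denominator_pos by simp
    then show ?thesis by (simp only: power_Suc distrib_left[of "\<mu> + 2 * real CARD('n)"] mult.assoc[symmetric])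
  qed
  finally show ?case using resolvent_denominator_pos(2) mult_le_cancel_left_pos by blast
qed

text \<open>The weights \<open>\<mu> / (\<mu> + 2 N)\<close> and \<open>2 N / (\<mu> + 2 N)\<close>
  add up to one, so a constant error does not accumulate.\<close>

lemma resolvent_mono:
  fixes f g :: "real^'n \<Rightarrow> real"
  assumes "\<And>x. f x \<le> g x + e" "e \<ge> 0"
  shows "resolvent P h \<mu> f n x \<le> resolvent P h \<mu> g n x + e"
proof (induction n arbitrary: x)
  case (Suc n)
  have "(\<mu> + 2 * real CARD('n)) * resolvent P h \<mu> f (Suc n) x = \<mu> * f x + walk_sum P h (resolvent P h \<mu> f n) x"
    by (rule resolvent_Suc_real)
  also have "\<dots> \<le> \<mu> * (g x + e) + walk_sum P h (\<lambda>x. resolvent P h \<mu> g n x + e) x"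
    using \<mu> by (intro add_mono mult_left_mono walk_sum_mono Suc assms) auto
  also have "\<dots> = (\<mu> + 2 * real CARD('n)) * (resolvent P h \<mu> g (Suc n) x + e)"
    unfolding distrib_left[of "\<mu> + (2 * real CARD('n))"] resolvent_Suc_real
    by (simp add: walk_sum_add walk_sum_const algebra_simps)
  finally show ?case using resolvent_denominator_pos(2) mult_le_cancel_left_pos by blast
qed (use assms in simp)

lemma resolvent_bound:
  fixes g :: "real^'n \<Rightarrow> real"
  assumes "\<And>x. \<bar>g x\<bar> \<le> M"
  shows "\<bar>resolvent P h \<mu> g n x\<bar> \<le> M"
proof (induction n arbitrary: x)
  case 0
  then show ?case using assms[of 0] by simp
next
  case (Suc n)
  have "\<bar>(\<mu> + 2 * real CARD('n)) * resolvent P h \<mu> g (Suc n) x\<bar> \<le> \<mu> * M + (2 * real CARD('n)) * M"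
  proof -
    have "\<bar>walk_sum P h (resolvent P h \<mu> g n) x\<bar> \<le> (\<Sum>i\<in>(UNIV::'n set). M + M)"
      unfolding walk_sum_def
      by (intro order_trans[OF sum_abs] sum_mono order_trans[OF abs_triangle_ineq] add_mono Suc)
    moreover have "\<bar>\<mu> * g x\<bar> \<le> \<mu> * M" using assms[of x] \<mu> by (simp add: abs_mult)
    ultimately show ?thesis unfolding resolvent_Suc_real by simp
  qed
  then have "(\<mu> + 2 * real CARD('n)) * \<bar>resolvent P h \<mu> g (Suc n) x\<bar> \<le> (\<mu> + 2 * real CARD('n)) * M"
    using resolvent_denominator_pos(2) by (simp only: abs_mult) (simp add: distrib_right)
  then show ?case using resolvent_denominator_pos(2) mult_le_cancel_left_pos by blast
qed

text \<open>The difference of successive iterates is the defect in the fixed-point equation; the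
  iteration contracts it by \<open>2 N / (\<mu> + 2 N)\<close> each time.\<close>

lemma resolvent_cauchy:
  fixes g :: "real^'n \<Rightarrow> real"
  assumes "\<And>x. \<bar>g x\<bar> \<le> M"
  shows "\<bar>resolvent P h \<mu> g (Suc n) x - resolvent P h \<mu> g n x\<bar> \<le> ((2 * real CARD('n)) / (\<mu> + 2 * real CARD('n))) ^ n * M"
proof (induction n arbitrary: x)
  case 0
  show ?case using resolvent_bound[of g M "Suc 0" x, OF assms] by simp
next
  case (Suc n)
  let ?t = "((2 * real CARD('n)) / (\<mu> + 2 * real CARD('n))) ^ n * M"
  have "(\<mu> + 2 * real CARD('n)) * (resolvent P h \<mu> g (Suc (Suc n)) x - resolvent P h \<mu> g (Suc n) x)
      = walk_sum P h (resolvent P h \<mu> g (Suc n)) x - walk_sum P h (resolvent P h \<mu> g n) x"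
    unfolding right_diff_distrib resolvent_Suc_real by simp
  also have "\<dots> = (\<Sum>i\<in>UNIV.
      (resolvent P h \<mu> g (Suc n) (x + h *\<^sub>R P $ i) - resolvent P h \<mu> g n (x + h *\<^sub>R P $ i)) +
      (resolvent P h \<mu> g (Suc n) (x - h *\<^sub>R P $ i) - resolvent P h \<mu> g n (x - h *\<^sub>R P $ i)))"
    unfolding walk_sum_def sum_subtractf[symmetric] by (intro sum.cong) auto
  finally have "\<bar>(\<mu> + 2 * real CARD('n)) * (resolvent P h \<mu> g (Suc (Suc n)) x - resolvent P h \<mu> g (Suc n) x)\<bar>
      \<le> (\<Sum>i\<in>(UNIV::'n set). ?t + ?t)"
    by (simp only:) (intro order_trans[OF sum_abs] sum_mono order_trans[OF abs_triangle_ineq] add_mono Suc)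
  then have "(\<mu> + 2 * real CARD('n)) * \<bar>resolvent P h \<mu> g (Suc (Suc n)) x - resolvent P h \<mu> g (Suc n) x\<bar> \<le> (2 * real CARD('n)) * ?t"
    using resolvent_denominator_pos(2) by (simp only: abs_mult) (simp add: mult_ac del: resolvent.simps)
  then have "\<bar>resolvent P h \<mu> g (Suc (Suc n)) x - resolvent P h \<mu> g (Suc n) x\<bar> \<le> (2 * real CARD('n)) * ?t / (\<mu> + 2 * real CARD('n))"
    using resolvent_denominator_pos(2) by (simp only: pos_le_divide_eq mult.commute)
  then show ?case by (simp add: mult_ac)
qed

lemma C2_data_walk_sum:
  assumes "C2_data UNIV g G H"
  shows "C2_data UNIV (walk_sum P h g) (walk_sum P h G) (walk_sum P h H)"
proof -
  have "C2_data UNIV (\<lambda>x. \<Sum>i\<in>A. g (x + h *\<^sub>R P $ i) + g (x - h *\<^sub>R P $ i))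
      (\<lambda>x. \<Sum>i\<in>A. G (x + h *\<^sub>R P $ i) + G (x - h *\<^sub>R P $ i))
      (\<lambda>x. \<Sum>i\<in>A. H (x + h *\<^sub>R P $ i) + H (x - h *\<^sub>R P $ i))" for A :: "'n set"
  proof (induction A rule: infinite_finite_induct)
    case (insert i A)
    have "C2_data UNIV (\<lambda>x. g (x + h *\<^sub>R P $ i) + g (x - h *\<^sub>R P $ i))
      (\<lambda>x. G (x + h *\<^sub>R P $ i) + G (x - h *\<^sub>R P $ i)) (\<lambda>x. H (x + h *\<^sub>R P $ i) + H (x - h *\<^sub>R P $ i))"
      using C2_data_add[OF C2_data_translate[OF assms, of UNIV "h *\<^sub>R P $ i"]
        C2_data_translate[OF assms, of UNIV "- h *\<^sub>R P $ i"]] by simp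
    from C2_data_add[OF this insert(3)] insert(1,2) show ?case by simp
  qed (simp_all add: C2_data_const)
  then show ?thesis unfolding walk_sum_def[abs_def] by blast
qed

lemma C2_data_resolvent:
  assumes "C2_data UNIV g G H"
  shows "C2_data UNIV (resolvent P h \<mu> g n) (resolvent P h \<mu> G n) (resolvent P h \<mu> H n)"
proof (induction n)
  case 0
  then show ?case by (simp add: C2_data_const)
next
  case (Suc n)
  from C2_data_scale[OF C2_data_add[OF C2_data_scale[OF assms, of \<mu>] C2_data_walk_sum[OF Suc]], of "1 / (\<mu> + 2 * real CARD('n))"]
  show ?case by simp
qed

text \<open>The error \<open>\<Delta>\<close> of the second-order expansion is linear in the pair of
  function and Hessian and commutes with translations. An iterate combines translates with
  nonnegative weights of sum at most one, so the bound for \<open>g\<close> is inherited for every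
  \<open>n\<close>.\<close>

lemma resolvent_second_difference:
  fixes g :: "real^'n \<Rightarrow> real" and H :: "real^'n \<Rightarrow> real^'n^'n"
  assumes "\<And>x. \<bar>g (x + v) + g (x - v) - 2 * g x - quad (H x) v\<bar> \<le> e"
  shows "\<bar>resolvent P h \<mu> g n (x + v) + resolvent P h \<mu> g n (x - v) - 2 * resolvent P h \<mu> g n x
    - quad (resolvent P h \<mu> H n x) v\<bar> \<le> e"
proof (induction n arbitrary: x)
  case 0
  have "0 \<le> e" using assms[of 0] by linarith
  then show ?case by simp
next
  case (Suc n)
  define \<Delta> where "\<Delta> f K y = f (y + v) + f (y - v) - 2 * f y - quad (K y) v"
    for f :: "real^'n \<Rightarrow> real" and K :: "real^'n \<Rightarrow> real^'n^'n" and y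
  let ?R = "resolvent P h \<mu> g n" and ?K = "resolvent P h \<mu> H n"
  have walk: "\<Delta> (walk_sum P h ?R) (walk_sum P h ?K) x
      = (\<Sum>i\<in>UNIV. \<Delta> ?R ?K (x + h *\<^sub>R P $ i) + \<Delta> ?R ?K (x - h *\<^sub>R P $ i))"
  proof -
    have mv: "quad (\<Sum>i\<in>UNIV. A i + B i) v = (\<Sum>i\<in>UNIV. quad (A i) v + quad (B i) v)"
      for A B :: "'n \<Rightarrow> real^'n^'n"
    proof -
      have "linear (\<lambda>A :: real^'n^'n. quad A v)"
        by (rule linearI) (simp_all add: matrix_vector_mult_add_rdistrib scaleR_matrix_vector_assoc[symmetric] inner_add_right)
      from linear_sum[OF this, of "\<lambda>i. A i + B i" UNIV] show ?thesis
        by (simp only: matrix_vector_mult_add_rdistrib inner_add_right)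
    qed
    have sh: "x + v + h *\<^sub>R P $ i = x + h *\<^sub>R P $ i + v" "x + v - h *\<^sub>R P $ i = x - h *\<^sub>R P $ i + v"
      "x - v + h *\<^sub>R P $ i = x + h *\<^sub>R P $ i - v" "x - v - h *\<^sub>R P $ i = x - h *\<^sub>R P $ i - v" for i
      by (simp_all add: algebra_simps)
    show ?thesis
      unfolding \<Delta>_def walk_sum_def mv sh sum_distrib_left sum.distrib[symmetric] sum_subtractf[symmetric]
      by (intro sum.cong) (auto simp: algebra_simps)
  qed
  have "(\<mu> + 2 * real CARD('n)) * \<Delta> (resolvent P h \<mu> g (Suc n)) (resolvent P h \<mu> H (Suc n)) x
      = \<mu> * \<Delta> g H x + \<Delta> (walk_sum P h ?R) (walk_sum P h ?K) x"
  proof -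
    let ?c = "\<mu> + 2 * real CARD('n)" and ?S = "resolvent P h \<mu> g (Suc n)" and ?L = "resolvent P h \<mu> H (Suc n)"
    have k: "?c * (quad (?L x) v) = \<mu> * (quad (H x) v) + quad (walk_sum P h ?K x) v"
    proof -
      have "c * (quad (((1 / c) *\<^sub>R A)) v) = quad A v" if "c \<noteq> 0" for c and A :: "real^'n^'n"
        using that by (simp add: scaleR_matrix_vector_assoc[symmetric])
      moreover have "?c \<noteq> 0" using resolvent_denominator_pos(2) by linarith
      ultimately have "?c * (quad (?L x) v) = quad (\<mu> *\<^sub>R H x + walk_sum P h ?K x) v"
        by (simp only: resolvent.simps)
      then show ?thesis
        by (simp only: matrix_vector_mult_add_rdistrib inner_add_right scaleR_matrix_vector_assoc[symmetric]
          inner_scaleR_right)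
    qed
    have "?c * \<Delta> ?S ?L x = ?c * ?S (x + v) + ?c * ?S (x - v) - 2 * (?c * ?S x) - ?c * (quad (?L x) v)"
      by (simp only: \<Delta>_def right_diff_distrib distrib_left[of ?c] mult.left_commute[of ?c 2])
    then show ?thesis unfolding resolvent_Suc_real k
      by (simp add: \<Delta>_def algebra_simps)
  qed
  moreover have "\<bar>\<mu> * \<Delta> g H x\<bar> \<le> \<mu> * e"
    using assms[of x] \<mu> by (simp add: abs_mult \<Delta>_def)
  moreover have "\<bar>\<Delta> (walk_sum P h ?R) (walk_sum P h ?K) x\<bar> \<le> (\<Sum>i\<in>(UNIV::'n set). e + e)"
    unfolding walk
    by (intro order_trans[OF sum_abs] sum_mono order_trans[OF abs_triangle_ineq] add_mono)
      (use Suc in \<open>simp_all add: \<Delta>_def\<close>)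
  ultimately have "\<bar>(\<mu> + 2 * real CARD('n)) * \<Delta> (resolvent P h \<mu> g (Suc n)) (resolvent P h \<mu> H (Suc n)) x\<bar> \<le> \<mu> * e + (2 * real CARD('n)) * e"
    by simp
  then have "(\<mu> + 2 * real CARD('n)) * \<bar>\<Delta> (resolvent P h \<mu> g (Suc n)) (resolvent P h \<mu> H (Suc n)) x\<bar> \<le> (\<mu> + 2 * real CARD('n)) * e"
    using resolvent_denominator_pos(2) by (simp only: abs_mult) (simp add: distrib_right)
  then have "\<bar>\<Delta> (resolvent P h \<mu> g (Suc n)) (resolvent P h \<mu> H (Suc n)) x\<bar> \<le> e"
    using resolvent_denominator_pos(2) mult_le_cancel_left_pos by blast
  then show ?case by (simp only: \<Delta>_def)
qed

lemma continuous_resolvent: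
  fixes g :: "real^'n \<Rightarrow> real"
  assumes g: "continuous_on UNIV g"
  shows "continuous_on UNIV (resolvent P h \<mu> g n)"
proof (induction n)
  case (Suc n)
  show ?case
    by (simp add: walk_sum_def) (intro continuous_intros g continuous_on_compose2[OF Suc]; use resolvent_denominator_pos(2) in force)
qed simp

lemma resolvent_convolution:
  fixes \<rho> w :: "real^'n \<Rightarrow> real"
  assumes \<rho>: "continuous_on UNIV \<rho>" and w: "continuous_on UNIV w"
  shows "resolvent P h \<mu> (\<lambda>x. integral (cbox a b) (\<lambda>z. \<rho> z * w (x - z))) n x
    = integral (cbox a b) (\<lambda>z. \<rho> z * resolvent P h \<mu> w n (x - z))"
proof (induction n arbitrary: x)
  case (Suc n)
  have int: "(\<lambda>z. \<rho> z * f (x - z)) integrable_on cbox a b" if "continuous_on UNIV f" for f and x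
    by (intro integrable_continuous continuous_intros continuous_on_subset[OF \<rho>] continuous_on_compose2[OF that]) auto
  note iw = int[OF w] and ir = int[OF continuous_resolvent[OF w]]
  have "integral (cbox a b) (\<lambda>z. \<rho> z * resolvent P h \<mu> w (Suc n) (x - z))
      = integral (cbox a b) (\<lambda>z. (1 / (\<mu> + 2 * real CARD('n))) * (\<mu> * (\<rho> z * w (x - z)) +
          (\<Sum>i\<in>UNIV. \<rho> z * resolvent P h \<mu> w n (x + h *\<^sub>R P $ i - z) + \<rho> z * resolvent P h \<mu> w n (x - h *\<^sub>R P $ i - z))))"
    by (intro integral_cong) (simp add: walk_sum_def sum_distrib_left algebra_simps)
  also have "\<dots> = (1 / (\<mu> + 2 * real CARD('n))) * (\<mu> * integral (cbox a b) (\<lambda>z. \<rho> z * w (x - z)) +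
      (\<Sum>i\<in>UNIV. integral (cbox a b) (\<lambda>z. \<rho> z * resolvent P h \<mu> w n (x + h *\<^sub>R P $ i - z)) +
         integral (cbox a b) (\<lambda>z. \<rho> z * resolvent P h \<mu> w n (x - h *\<^sub>R P $ i - z))))"
  proof -
    have "integral (cbox a b) (\<lambda>z. \<Sum>i\<in>UNIV. \<rho> z * resolvent P h \<mu> w n (x + h *\<^sub>R P $ i - z)
          + \<rho> z * resolvent P h \<mu> w n (x - h *\<^sub>R P $ i - z))
      = (\<Sum>i\<in>UNIV. integral (cbox a b) (\<lambda>z. \<rho> z * resolvent P h \<mu> w n (x + h *\<^sub>R P $ i - z)
          + \<rho> z * resolvent P h \<mu> w n (x - h *\<^sub>R P $ i - z)))"
      by (intro integral_sum integrable_add ir) simp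
    also have "\<dots> = (\<Sum>i\<in>UNIV. integral (cbox a b) (\<lambda>z. \<rho> z * resolvent P h \<mu> w n (x + h *\<^sub>R P $ i - z)) +
         integral (cbox a b) (\<lambda>z. \<rho> z * resolvent P h \<mu> w n (x - h *\<^sub>R P $ i - z)))"
      by (intro sum.cong refl integral_add ir)
    finally have e: "integral (cbox a b) (\<lambda>z. \<Sum>i\<in>UNIV. \<rho> z * resolvent P h \<mu> w n (x + h *\<^sub>R P $ i - z)
          + \<rho> z * resolvent P h \<mu> w n (x - h *\<^sub>R P $ i - z)) = \<dots>" .
    show ?thesis
      unfolding integral_mult_right e[symmetric]
      by (subst integral_add) (auto intro!: integrable_on_mult_right iw ir integrable_sum integrable_add)
  qed
  finally have E: "integral (cbox a b) (\<lambda>z. \<rho> z * resolvent P h \<mu> w (Suc n) (x - z)) = \<dots>" .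
  show ?case unfolding E by (simp add: walk_sum_def Suc)
qed simp

end

subsection \<open>The sub-mean value property\<close>

text \<open>The constant \<open>12\<close> is \<open>4 + 8\<close>: the Hessian consists of a
  multiple of the identity and a rank-one part, the latter estimated by Cauchy-Schwarz. The power
  comes from the later balance: with \<open>t\<close> of order \<open>1 / l\<close> the value at the
  centre is \<open>A t^2\<close>, of order \<open>1 / l^2\<close>, whereas a plain paraboloid would
  cost \<open>1 / l\<close>, as much as the gain.\<close>

lemma quartic_barrier:
  fixes P :: "real^'n^'n" and z :: "real^'n"
  assumes A: "A \<ge> 0" and t: "t \<ge> 0"
  obtains G H where "C2_data UNIV (\<lambda>x. A * ((x - z) \<bullet> (x - z) + t)\<^sup>2) G H"
    "\<And>x. quad_sum P (H x)
      \<le> 12 * (\<Sum>i\<in>UNIV. P $ i \<bullet> P $ i) * (A * ((x - z) \<bullet> (x - z) + t))"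
proof -
  have tr: "transpose (2 *\<^sub>R mat 1 :: real^'n^'n) = 2 *\<^sub>R mat 1"
    by (simp add: vec_eq_iff transpose_def mat_def)
  have quad: "C2_data UNIV (\<lambda>x. t + 0 \<bullet> (x - z) + quad (2 *\<^sub>R mat 1) (x - z) / 2)
      (\<lambda>x. 0 + (2 *\<^sub>R mat 1) *v (x - z)) (\<lambda>x. 2 *\<^sub>R mat 1)"
    by (rule C2_data_quadratic[OF tr])
  have c: "C2_data UNIV (\<lambda>x. (x - z) \<bullet> (x - z) + t) (\<lambda>x. 2 *\<^sub>R (x - z)) (\<lambda>x. 2 *\<^sub>R mat 1)"
    by (rule C2_data_cong[OF quad]) (simp_all flip: scaleR_matrix_vector_assoc)
  define H where "H x = A *\<^sub>R ((2 * ((x - z) \<bullet> (x - z) + t)) *\<^sub>R (2 *\<^sub>R mat 1) +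
     2 *\<^sub>R (\<chi> i j. (2 *\<^sub>R (x - z)) $ i * (2 *\<^sub>R (x - z)) $ j))" for x
  note C = C2_data_scale[OF C2_data_square[OF c], of A, folded H_def]
  have outer: "(\<chi> i j. a $ i * a $ j) *v v = (v \<bullet> a) *\<^sub>R a" for a v :: "real^'n"
    by (simp add: vec_eq_iff matrix_vector_mult_def inner_vec_def sum_distrib_left mult_ac)
  have "quad (H x) (P $ i) \<le> 12 * (P $ i \<bullet> P $ i) * (A * ((x - z) \<bullet> (x - z) + t))" for x i
  proof -
    define v where "v = P $ i"
    have "quad (H x) v = A * (4 * ((x - z) \<bullet> (x - z) + t) * (v \<bullet> v) + 8 * (v \<bullet> (x - z))\<^sup>2)"
      unfolding H_def
      by (simp add: scaleR_matrix_vector_assoc[symmetric] matrix_vector_mult_add_rdistrib outer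
          inner_add_right power2_eq_square del: vector_scaleR_component)
    also have "\<dots> \<le> A * (4 * ((x - z) \<bullet> (x - z) + t) * (v \<bullet> v) + 8 * (((x - z) \<bullet> (x - z) + t) * (v \<bullet> v)))"
    proof -
      have "(v \<bullet> (x - z))\<^sup>2 \<le> (v \<bullet> v) * ((x - z) \<bullet> (x - z))" by (rule Cauchy_Schwarz_ineq)
      also have "\<dots> \<le> (v \<bullet> v) * ((x - z) \<bullet> (x - z) + t)" using t by (intro mult_left_mono) auto
      finally show ?thesis using A by (intro mult_left_mono add_left_mono) (auto simp: mult.commute)
    qed
    finally show ?thesis by (simp add: v_def algebra_simps)
  qed
  then have "quad_sum P (H x)
      \<le> 12 * (\<Sum>i\<in>UNIV. P $ i \<bullet> P $ i) * (A * ((x - z) \<bullet> (x - z) + t))" for x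
    unfolding sum_distrib_left sum_distrib_right by (intro sum_mono)
  with C show ?thesis by (rule that)
qed

text \<open>Comparison of \<open>u\<close> with the resolvent of a smooth \<open>g \<ge> u - \<eta>\<close>.
  The quartic barrier absorbs the boundary values at cost \<open>O(1/l\<^sup>2)\<close>, below the \<open>q/l\<close> that is
  to be gained.\<close>

lemma resolvent_submean:
  fixes P :: "real^'n^'n" and u g :: "real^'n \<Rightarrow> real"
  assumes r: "r > 0" and q: "q \<ge> 0" and l1: "l \<ge> 1" and h: "h > 0" and \<eta>: "\<eta> \<ge> 0" and \<epsilon>: "\<epsilon> \<ge> 0"
    and u: "continuous_on (cball z r) u"
    and sub: "\<And>x \<psi> G H. \<lbrakk>x \<in> ball z r; C2_data UNIV \<psi> G H; local_max_at (\<lambda>y. u y - \<psi> y) x\<rbrakk>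
      \<Longrightarrow> q \<le> quad_sum P (H x)"
    and g: "C2_data UNIV g G H" and gM: "\<And>x. \<bar>g x\<bar> \<le> M" and uM: "\<And>x. x \<in> cball z r \<Longrightarrow> \<bar>u x\<bar> \<le> M"
    and ug: "\<And>x. x \<in> cball z r \<Longrightarrow> u x \<le> g x + \<eta>"
    and diff: "\<And>x i. \<bar>g (x + h *\<^sub>R P $ i) + g (x - h *\<^sub>R P $ i) - 2 * g x - h\<^sup>2 * (quad (H x) (P $ i))\<bar> \<le> \<epsilon> * h\<^sup>2"
  defines "S \<equiv> \<Sum>i\<in>UNIV. P $ i \<bullet> P $ i"
    and "\<theta> \<equiv> 2 * real CARD('n) / (l * h\<^sup>2 + 2 * real CARD('n))"
  shows "u z \<le> resolvent P h (l * h\<^sup>2) g (Suc n) z + (2 * M + q) * (12 * S)\<^sup>2 / r ^ 4 / l\<^sup>2 + \<eta> - q / l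
    + (2 * real CARD('n) * \<theta> ^ n * M / h\<^sup>2 + real CARD('n) * \<epsilon>) / l"
proof -
  define \<mu> where "\<mu> = l * h\<^sup>2"
  have \<mu>: "\<mu> > 0" using l1 h by (simp add: \<mu>_def)
  have M: "M \<ge> 0" using gM[of 0] by linarith
  have S: "S \<ge> 0" unfolding S_def by (intro sum_nonneg) auto
  \<comment> \<open>Makes the barrier at least \<open>2 * M + q\<close> on the sphere of radius
    \<open>r\<close>, where \<open>u - R\<close> is at most \<open>2 * M\<close>.\<close>
  define A where "A = (2 * M + q) / r ^ 4"
  have A: "A \<ge> 0" using M q r by (simp add: A_def)
  \<comment> \<open>This shift gives
    \<open>12 * S \<le> l * ((x - z) \<bullet> (x - z) + t)\<close>, so that the trace for the
    barrier stays below \<open>l * b x\<close>.\<close>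
  define t where "t = 12 * S / l"
  have t: "t \<ge> 0" using S l1 by (simp add: t_def)
  define b where "b x = A * ((x - z) \<bullet> (x - z) + t)\<^sup>2" for x
  obtain Gb Hb where Cb: "C2_data UNIV (\<lambda>x. A * ((x - z) \<bullet> (x - z) + t)\<^sup>2) Gb Hb"
    and Lb: "\<And>x. quad_sum P (Hb x)
      \<le> 12 * (\<Sum>i\<in>UNIV. P $ i \<bullet> P $ i) * (A * ((x - z) \<bullet> (x - z) + t))"
    by (rule quartic_barrier[OF A t, where z=z and P=P]) (rule that)
  note b = Cb[folded b_def] and Lb = Lb[folded S_def]
  have Lb': "quad_sum P (Hb x) \<le> l * b x" for x
  proof -
    have "12 * S = l * t" using l1 by (simp add: t_def)
    also have "\<dots> \<le> l * ((x - z) \<bullet> (x - z) + t)" using l1 by (intro mult_left_mono) auto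
    finally have "12 * S * (A * ((x - z) \<bullet> (x - z) + t)) \<le> l * ((x - z) \<bullet> (x - z) + t) * (A * ((x - z) \<bullet> (x - z) + t))"
      using A t by (intro mult_right_mono) auto
    then show ?thesis using Lb[of x] by (simp add: b_def power2_eq_square mult_ac)
  qed
  define R where "R = resolvent P h \<mu> g (Suc n)"
  define K where "K = resolvent P h \<mu> H (Suc n)"
  define E where "E = 2 * real CARD('n) * \<theta> ^ n * M / h\<^sup>2 + real CARD('n) * \<epsilon>"
  have E: "E \<ge> 0" using M \<epsilon> l1 by (simp add: E_def \<theta>_def)
  have CR: "C2_data UNIV R (resolvent P h \<mu> G (Suc n)) K"
    unfolding R_def K_def by (rule C2_data_resolvent[OF \<mu> g])
  have RM: "\<bar>R x\<bar> \<le> M" for x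
    unfolding R_def by (rule resolvent_bound[OF \<mu> gM])
  \<comment> \<open>\<open>R\<close> solves the discrete equation up to the defect of one more
    iteration, and its second differences match its Hessian up to \<open>\<epsilon>\<close>;
    \<open>E\<close> collects both errors after division by \<open>h^2\<close>.\<close>
  have LR: "quad_sum P (K x) \<le> l * (R x - g x) + E" for x
  proof -
    have d: "h\<^sup>2 * (quad (K x) (P $ i)) \<le> R (x + h *\<^sub>R P $ i) + R (x - h *\<^sub>R P $ i) - 2 * R x + \<epsilon> * h\<^sup>2" for i
      using resolvent_second_difference[OF \<mu>, of g "h *\<^sub>R P $ i" H "\<epsilon> * h\<^sup>2" P h "Suc n" x] diff[of _ i]
      unfolding R_def K_def
      by (simp add: matrix_vector_mult_scaleR power2_eq_square mult.assoc del: resolvent.simps)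
    have "h\<^sup>2 * quad_sum P (K x)
        \<le> (\<Sum>i\<in>UNIV. R (x + h *\<^sub>R P $ i) + R (x - h *\<^sub>R P $ i) - 2 * R x + \<epsilon> * h\<^sup>2)"
      unfolding sum_distrib_left by (intro sum_mono d)
    also have "\<dots> = walk_sum P h R x - 2 * real CARD('n) * R x + real CARD('n) * \<epsilon> * h\<^sup>2"
      by (simp add: walk_sum_def sum.distrib sum_subtractf)
    also have "walk_sum P h R x \<le> walk_sum P h (\<lambda>x. resolvent P h \<mu> g n x + \<theta> ^ n * M) x"
    proof (rule walk_sum_mono)
      show "R y \<le> resolvent P h \<mu> g n y + \<theta> ^ n * M" for y
        using resolvent_cauchy[where g=g and M=M and n=n and x=y and P=P and h=h, OF \<mu> gM] unfolding R_def \<theta>_def \<mu>_def[symmetric] abs_le_iff by linarith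
    qed
    also have "\<dots> = (\<mu> + 2 * real CARD('n)) * R x - \<mu> * g x + 2 * real CARD('n) * (\<theta> ^ n * M)"
      unfolding R_def resolvent_Suc_real[OF \<mu>] by (simp add: walk_sum_add walk_sum_const)
    finally have "h\<^sup>2 * quad_sum P (K x)
        \<le> \<mu> * (R x - g x) + 2 * real CARD('n) * (\<theta> ^ n * M) + real CARD('n) * \<epsilon> * h\<^sup>2"
      by (simp add: algebra_simps)
    also have "\<dots> = h\<^sup>2 * (l * (R x - g x) + E)"
      using h by (simp add: E_def \<mu>_def field_simps)
    finally show ?thesis using h by (simp add: mult_le_cancel_left_pos)
  qed
  define \<Phi> where "\<Phi> x = u x - (R x + b x)" for x
  have "continuous_on (cball z r) \<Phi>"
  proof -
    have "continuous_on UNIV R" "continuous_on UNIV b"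
      using C2_dataD(1)[OF CR UNIV_I] C2_dataD(1)[OF b UNIV_I]
      by (meson differentiable_at_imp_differentiable_on differentiable_imp_continuous_on differentiableI)+
    then show ?thesis unfolding \<Phi>_def[abs_def] by (intro continuous_intros u) (auto intro: continuous_on_subset)
  qed
  then obtain x1 where x1: "x1 \<in> cball z r" "\<And>y. y \<in> cball z r \<Longrightarrow> \<Phi> y \<le> \<Phi> x1"
    using continuous_attains_sup[of "cball z r" \<Phi>] r by auto
  have b0: "b x \<ge> 0" for x using A by (simp add: b_def)
  have l0: "l > 0" using l1 by simp
  have "\<Phi> x1 \<le> \<eta> - q / l + E / l"
  proof (cases "x1 \<in> ball z r")
    case True
    \<comment> \<open>At an interior maximum \<open>R + b\<close> is itself a test function for
      \<open>u\<close>, so its trace, at most \<open>l * (R - g + b) + E\<close>, is at least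
      \<open>q\<close>.\<close>
    have "local_max_at (\<lambda>y. u y - (R y + b y)) x1"
      unfolding local_max_at_def eventually_nhds
      using True x1(2) by (intro exI[of _ "ball z r"]) (auto simp: \<Phi>_def)
    from sub[OF True C2_data_add[OF CR b] this]
    have "q \<le> quad_sum P (K x1) + quad_sum P (Hb x1)"
      by (simp add: matrix_vector_mult_add_rdistrib inner_add_right sum.distrib)
    also have "\<dots> \<le> l * (R x1 - g x1) + E + l * b x1" by (intro add_mono LR Lb')
    finally have "(q - E) / l \<le> R x1 - g x1 + b x1"
      using l0 by (simp only: pos_divide_le_eq[OF l0]) (simp add: algebra_simps)
    then show ?thesis using ug[OF x1(1)] by (simp add: \<Phi>_def diff_divide_distrib)
  next
    case False
    then have d: "(x1 - z) \<bullet> (x1 - z) = r\<^sup>2"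
      using x1(1) by (simp add: dist_norm norm_minus_commute power2_norm_eq_inner[symmetric])
    have "2 * M + q = A * (r\<^sup>2)\<^sup>2" using r by (simp add: A_def)
    also have "\<dots> \<le> b x1" unfolding b_def d using A t by (intro mult_left_mono power_mono) auto
    finally have "\<Phi> x1 \<le> - q"
      using uM[OF x1(1)] RM[of x1] unfolding \<Phi>_def abs_le_iff by linarith
    also have "- q \<le> - q / l" using q l1 by (simp add: divide_le_eq) (metis mult.commute mult_right_mono mult_1)
    finally show ?thesis using \<eta> E l0 by (simp add: add_increasing2 add.commute add_increasing)
  qed
  moreover have "\<Phi> z \<le> \<Phi> x1" using x1(2)[of z] r by simp
  moreover have "b z = (2 * M + q) * (12 * S)\<^sup>2 / r ^ 4 / l\<^sup>2"
    by (simp add: b_def A_def t_def power_divide)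
  ultimately show ?thesis unfolding \<Phi>_def R_def E_def \<mu>_def by linarith
qed


section \<open>Averages with a nonnegative kernel of unit mass\<close>

context
  fixes \<rho> :: "real^'n \<Rightarrow> real" and r :: real
  assumes cont: "continuous_on UNIV \<rho>" and nonneg: "\<And>z. 0 \<le> \<rho> z"
    and supp: "\<And>z. r \<le> norm z \<Longrightarrow> \<rho> z = 0" and mass: "avg r \<rho> = 1"
begin

lemma mollifier_average_mono:
  assumes f: "continuous_on UNIV f" and g: "continuous_on UNIV g"
    and le: "\<And>z. norm z < r \<Longrightarrow> f z \<le> g z"
  shows "avg r (\<lambda>z. \<rho> z * f z) \<le> avg r (\<lambda>z. \<rho> z * g z)"
proof (rule integral_le)
  show "(\<lambda>z. \<rho> z * f z) integrable_on cbox (- vec r) (vec r)" "(\<lambda>z. \<rho> z * g z) integrable_on cbox (- vec r) (vec r)"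
    by (intro integrable_continuous continuous_intros continuous_on_subset[OF cont]
        continuous_on_subset[OF f] continuous_on_subset[OF g] subset_UNIV)+
  show "\<rho> z * f z \<le> \<rho> z * g z" for z
  proof (cases "r \<le> norm z")
    case False
    then show ?thesis using le nonneg by (intro mult_left_mono) auto
  qed (simp add: supp)
qed

lemma mollifier_average_const: "avg r (\<lambda>z. \<rho> z * c) = c"
  by (simp add: mass)

lemma mollifier_average_add_const:
  assumes f: "continuous_on UNIV f"
  shows "avg r (\<lambda>z. \<rho> z * (f z + c)) = avg r (\<lambda>z. \<rho> z * f z) + c"
proof -
  have "avg r (\<lambda>z. \<rho> z * f z + \<rho> z * c)
      = avg r (\<lambda>z. \<rho> z * f z) + avg r (\<lambda>z. \<rho> z * c)"
    by (intro integral_add integrable_continuous continuous_intros continuous_on_subset[OF cont]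
        continuous_on_subset[OF f] subset_UNIV)
  then show ?thesis by (simp only: mollifier_average_const distrib_left)
qed

lemma mollifier_average_bound:
  assumes f: "continuous_on UNIV f" and le: "\<And>z. norm z < r \<Longrightarrow> \<bar>f z - c\<bar> \<le> e"
  shows "\<bar>avg r (\<lambda>z. \<rho> z * f z) - c\<bar> \<le> e"
proof -
  have "avg r (\<lambda>z. \<rho> z * f z) \<le> avg r (\<lambda>z. \<rho> z * (c + e))"
    using le by (intro mollifier_average_mono f continuous_intros) (auto simp: abs_le_iff algebra_simps)
  moreover have "avg r (\<lambda>z. \<rho> z * (c - e)) \<le> avg r (\<lambda>z. \<rho> z * f z)"
  proof (intro mollifier_average_mono f continuous_intros)
    fix z :: "real^'n" assume "norm z < r"
    from le[OF this] show "c - e \<le> f z" by linarith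
  qed
  ultimately show ?thesis unfolding mollifier_average_const by linarith
qed

end

lemma continuous_translated_reflection:
  fixes w :: "'a::real_normed_vector \<Rightarrow> real"
  assumes "continuous_on UNIV w"
  shows "continuous_on UNIV (\<lambda>z. w (x - z))"
  by (intro continuous_on_compose2[OF assms] continuous_intros) auto

lemma C2_data_continuous:
  assumes "C2_data UNIV \<psi> G H"
  shows "continuous_on S \<psi>" "continuous_on S G"
  using C2_dataD(1,2)[OF assms UNIV_I]
  by (meson differentiable_at_imp_differentiable_on differentiable_imp_continuous_on differentiableI)+

lemma smooth_approximation:
  fixes w :: "real^'n \<Rightarrow> real"
  assumes w: "continuous_on UNIV w" and supp: "\<And>y. L \<le> norm y \<Longrightarrow> w y = 0"
    and M: "\<And>x. \<bar>w x\<bar> \<le> M" and e: "e > 0"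
  obtains g G H where "C2_data UNIV g G H" "uniformly_continuous_on UNIV H"
    "\<And>x. \<bar>g x\<bar> \<le> M" "\<And>x. \<bar>g x - w x\<bar> \<le> e"
proof -
  obtain d where d: "d > 0" "\<And>x y. dist y x < d \<Longrightarrow> dist (w y) (w x) < e"
    using uniformly_continuous_compact_support[OF w supp] e unfolding uniformly_continuous_on_def by (metis UNIV_I)
  obtain \<rho> G\<rho> H\<rho> where \<rho>: "C2_data (UNIV :: (real^'n) set) \<rho> G\<rho> H\<rho>" "\<And>z. 0 \<le> \<rho> z"
    "\<And>z. d \<le> norm z \<Longrightarrow> \<rho> z = 0 \<and> G\<rho> z = 0 \<and> H\<rho> z = 0" "avg d \<rho> = 1"
    by (rule exists_mollifier[OF d(1)]) (rule that)
  define g where "g x = avg d (\<lambda>z. \<rho> z * w (x - z))" for x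
  obtain G H where gH: "C2_data UNIV g G H" "uniformly_continuous_on UNIV H"
    unfolding g_def[abs_def] by (rule smooth_convolution[OF \<rho>(1,3) w supp])
  have zero: "\<And>z. d \<le> norm z \<Longrightarrow> \<rho> z = 0" using \<rho>(3) by blast
  note avg = mollifier_average_bound[OF C2_data_continuous(1)[OF \<rho>(1)] \<rho>(2) zero \<rho>(4) continuous_translated_reflection[OF w]]
  have "\<bar>g x - w x\<bar> \<le> e" for x
    unfolding g_def
  proof (rule avg)
    fix z :: "real^'n" assume "norm z < d"
    then show "\<bar>w (x - z) - w x\<bar> \<le> e" using d(2)[of "x - z" x] by (simp add: dist_norm)
  qed
  moreover have "\<bar>g x\<bar> \<le> M" for x
    using avg[of x 0 M] M by (simp add: g_def)
  ultimately show ?thesis using gH that by blast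
qed

text \<open>The radii nest: for \<open>x\<close> within \<open>r\<close> of \<open>a\<close>, the
  average uses points within \<open>2 * r\<close>, and the sub-mean inequality at these uses balls
  of radius \<open>r\<close> around them. Bounding the resolvent of \<open>W\<close> at
  \<open>x\<close> is delicate because the resolvent is not local: values of \<open>L W\<close> far
  from \<open>x\<close> enter, and a quadratic majorant of \<open>L W\<close> keeps their effect of
  order \<open>1 / l^2\<close>.\<close>

lemma mollified_subsolution:
  fixes P :: "real^'n^'n" and w \<rho> :: "real^'n \<Rightarrow> real"
  assumes r: "r > 0" and q: "q \<ge> 0"
    and \<rho>: "continuous_on UNIV \<rho>" "\<And>z. 0 \<le> \<rho> z" "\<And>z. r \<le> norm z \<Longrightarrow> \<rho> z = 0"
      "avg r \<rho> = 1"
    and w: "continuous_on UNIV w" and supp: "\<And>y. L \<le> norm y \<Longrightarrow> w y = 0"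
    and sub: "\<And>x \<psi> G H. \<lbrakk>x \<in> ball a (3 * r); C2_data UNIV \<psi> G H; local_max_at (\<lambda>y. w y - \<psi> y) x\<rbrakk>
      \<Longrightarrow> q \<le> quad_sum P (H x)"
    and W: "C2_data UNIV (\<lambda>x. avg r (\<lambda>z. \<rho> z * w (x - z))) G H"
    and uc: "uniformly_continuous_on UNIV H" and suppH: "\<And>x. L' \<le> norm x \<Longrightarrow> H x = 0"
    and x: "x \<in> cball a r"
  shows "q \<le> quad_sum P (H x)"
proof (rule field_le_epsilon)
  fix e :: real assume e: "e > 0"
  \<comment> \<open>Six errors of size \<open>e1\<close> are collected at the end.\<close>
  define e1 where "e1 = e / 8"
  have e1: "e1 > 0" using e by (simp add: e1_def)
  let ?N = "real CARD('n)"
  define LW where "LW y = quad_sum P (H y)" for y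
  define S where "S = (\<Sum>i\<in>UNIV. P $ i \<bullet> P $ i)"
  have S: "S \<ge> 0" unfolding S_def by (intro sum_nonneg) auto
  define W where "W x = avg r (\<lambda>z. \<rho> z * w (x - z))" for x
  note W' = W[folded W_def]
  have bdd: "\<exists>M. \<forall>x. \<bar>f x\<bar> \<le> M" if "continuous_on UNIV f" "\<And>x. L \<le> norm x \<Longrightarrow> f x = 0"
    for f :: "real^'n \<Rightarrow> real" and L
  proof -
    have "compact (f ` cball 0 L)" using that(1) by (intro compact_continuous_image) (auto intro: continuous_on_subset)
    then obtain M where M: "\<And>x. x \<in> cball 0 L \<Longrightarrow> \<bar>f x\<bar> \<le> M"
      using compact_imp_bounded bounded_real by (metis imageI)
    have "\<bar>f x\<bar> \<le> max M 0" for x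
      using M[of x] that(2)[of x] by (cases "norm x \<le> L") auto
    then show ?thesis by blast
  qed
  obtain M where M: "\<And>x. \<bar>w x\<bar> \<le> M" using bdd[OF w supp] by auto
  have M0: "M \<ge> 0" using M[of 0] by linarith
  have LWc: "continuous_on UNIV LW"
  proof -
    have "linear (\<lambda>A :: real^'n^'n. \<Sum>i\<in>UNIV. quad A (P $ i))"
      by (rule linearI) (simp_all add: matrix_vector_mult_add_rdistrib scaleR_matrix_vector_assoc[symmetric]
          inner_add_right sum.distrib sum_distrib_left)
    then have "continuous_on UNIV (\<lambda>A :: real^'n^'n. \<Sum>i\<in>UNIV. quad A (P $ i))"
      by (simp add: linear_continuous_on linear_conv_bounded_linear)
    from continuous_on_compose2[OF this C2_dataD(3)[OF W]] show ?thesis by (simp add: LW_def[abs_def])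
  qed
  obtain B where B: "\<And>x. \<bar>LW x\<bar> \<le> B"
    using bdd[OF LWc, of L'] suppH by (auto simp: LW_def)
  \<comment> \<open>Continuity handles points close to \<open>x\<close>; from distance
    \<open>d\<close> on, \<open>2 * B / d^2\<close> times the squared distance is at least
    \<open>2 * B\<close>, which bounds the oscillation of \<open>LW\<close>.\<close>
  obtain C where C: "C \<ge> 0" "\<And>y. LW y \<le> LW x + e1 + C * ((y - x) \<bullet> (y - x))"
  proof -
    obtain d where d: "d > 0" "\<And>y. dist y x < d \<Longrightarrow> dist (LW y) (LW x) < e1"
      using LWc e1 unfolding continuous_on_iff by (metis UNIV_I)
    have "LW y \<le> LW x + e1 + 2 * B / d\<^sup>2 * ((y - x) \<bullet> (y - x))" for y
    proof (cases "dist y x < d")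
      case True
      have "0 \<le> B" using B[of x] by linarith
      then have "0 \<le> 2 * B / d\<^sup>2 * ((y - x) \<bullet> (y - x))" by simp
      then show ?thesis using d(2)[OF True] unfolding dist_real_def by linarith
    next
      case False
      have "d\<^sup>2 \<le> (y - x) \<bullet> (y - x)"
        using False d(1) by (simp add: dist_norm power2_norm_eq_inner[symmetric] power_mono)
      moreover have "0 \<le> B" using B[of x] by linarith
      ultimately have "2 * B / d\<^sup>2 * d\<^sup>2 \<le> 2 * B / d\<^sup>2 * ((y - x) \<bullet> (y - x))" by (intro mult_left_mono) auto
      then have "2 * B \<le> 2 * B / d\<^sup>2 * ((y - x) \<bullet> (y - x))" using d(1) by simp
      then show ?thesis using B[of x] B[of y] e1 unfolding abs_le_iff by linarith
    qed
    moreover have "0 \<le> 2 * B / d\<^sup>2" using B[of x] by simp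
    ultimately show ?thesis using that by blast
  qed
  define K where "K = (2 * M + q) * (12 * S)\<^sup>2 / r ^ 4"
  \<comment> \<open>The \<open>1 / l^2\<close> contributions, from the sub-mean inequality and from
    the quadratic majorant, are multiplied by \<open>l\<close> at the end; this \<open>l\<close>
    makes them at most \<open>e1\<close>.\<close>
  define l where "l = max 1 ((2 * S * C + K) / e1)"
  have l: "l \<ge> 1" "(2 * S * C + K) / l \<le> e1"
  proof -
    show "l \<ge> 1" by (simp add: l_def)
    then have "l > 0" by linarith
    have "(2 * S * C + K) / e1 \<le> l" by (simp add: l_def)
    then show "(2 * S * C + K) / l \<le> e1" using e1 \<open>l > 0\<close> by (simp add: pos_divide_le_eq mult.commute)
  qed
  have l0: "l > 0" using l by linarith
  \<comment> \<open>The smoothing error enters twice and is multiplied by \<open>l\<close> at the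
    end.\<close>
  define \<eta> where "\<eta> = e1 / (2 * l)"
  have \<eta>: "\<eta> > 0" "2 * \<eta> * l = e1" using e1 l0 by (simp_all add: \<eta>_def)
  define \<epsilon> where "\<epsilon> = e1 / ?N"
  have \<epsilon>: "\<epsilon> > 0" "?N * \<epsilon> = e1" using e1 by (simp_all add: \<epsilon>_def)
  obtain g Gg Hg where g: "C2_data UNIV g Gg Hg" "uniformly_continuous_on UNIV Hg"
    "\<And>x. \<bar>g x\<bar> \<le> M" "\<And>x. \<bar>g x - w x\<bar> \<le> \<eta>"
    using smooth_approximation[OF w supp M \<eta>(1)] by blast
  obtain h1 where h1: "h1 > 0" "\<And>h x i. 0 < h \<Longrightarrow> h < h1 \<Longrightarrow>
    \<bar>g (x + h *\<^sub>R P $ i) + g (x - h *\<^sub>R P $ i) - 2 * g x - h\<^sup>2 * (quad (Hg x) (P $ i))\<bar> \<le> \<epsilon> * h\<^sup>2"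
    using C2_data_uniform_second_difference[OF g(1,2) \<epsilon>(1), of P] by blast
  obtain h2 where h2: "h2 > 0" "\<And>h x i. 0 < h \<Longrightarrow> h < h2 \<Longrightarrow>
    \<bar>W (x + h *\<^sub>R P $ i) + W (x - h *\<^sub>R P $ i) - 2 * W x - h\<^sup>2 * (quad (H x) (P $ i))\<bar> \<le> \<epsilon> * h\<^sup>2"
    using C2_data_uniform_second_difference[OF W' uc \<epsilon>(1), of P] by blast
  define h where "h = min h1 h2 / 2"
  have h: "h > 0" "h < h1" "h < h2" using h1(1) h2(1) by (auto simp: h_def min_def)
  define \<mu> where "\<mu> = l * h\<^sup>2"
  have \<mu>: "\<mu> > 0" using l0 h by (simp add: \<mu>_def)
  define \<theta> where "\<theta> = 2 * ?N / (\<mu> + 2 * ?N)"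
  have \<theta>: "0 \<le> \<theta>" "\<theta> < 1" using \<mu> by (auto simp: \<theta>_def divide_less_eq add_pos_pos)
  \<comment> \<open>The discrete operator applied to \<open>W\<close>, divided by
    \<open>h^2\<close>, will be at most \<open>k + C |y - x|^2\<close> at every
    \<open>y\<close>.\<close>
  define k where "k = LW x + e1 + ?N * \<epsilon>"
  \<comment> \<open>Large enough for \<open>V + e0\<close> below to be nonnegative, as the iteration
    starts from zero.\<close>
  define e0 where "e0 = M + \<bar>k\<bar> / l"
  \<comment> \<open>The number of iterations is chosen last: the factor \<open>\<theta>\<close>
    depends on \<open>l\<close> and \<open>h\<close>, and the error is divided by
    \<open>h^2\<close>.\<close>
  have "(\<lambda>n. l * (\<theta> * \<theta> ^ n * e0) + 2 * ?N * \<theta> ^ n * M / h\<^sup>2) \<longlonglongrightarrow> l * (\<theta> * 0 * e0) + 2 * ?N * 0 * M / h\<^sup>2"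
    using \<theta> h by (intro tendsto_intros LIMSEQ_realpow_zero) auto
  then have "\<forall>\<^sub>F n in sequentially. l * (\<theta> * \<theta> ^ n * e0) + 2 * ?N * \<theta> ^ n * M / h\<^sup>2 < e1"
    using e1 by (intro order_tendstoD(2)) auto
  then obtain n where n: "l * (\<theta> * \<theta> ^ n * e0) + 2 * ?N * \<theta> ^ n * M / h\<^sup>2 < e1"
    using eventually_happens by force
  define R where "R f = resolvent P h \<mu> f (Suc n)" for f :: "real^'n \<Rightarrow> real"
  define Z where "Z = K / l\<^sup>2 + \<eta> - q / l + (2 * ?N * \<theta> ^ n * M / h\<^sup>2 + ?N * \<epsilon>) / l"
  have local: "w y \<le> R w y + (Z + \<eta>)" if y: "y \<in> cball a (2 * r)" for y
  proof -
    have "w y \<le> R g y + Z"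
    proof -
      have "w y \<le> R g y + K / l\<^sup>2 + \<eta> - q / l + (2 * ?N * \<theta> ^ n * M / h\<^sup>2 + ?N * \<epsilon>) / l"
        unfolding R_def K_def S_def \<theta>_def \<mu>_def
      proof (rule resolvent_submean[OF r q l(1) h(1) less_imp_le[OF \<eta>(1)] less_imp_le[OF \<epsilon>(1)] _ _ g(1) g(3)])
        show "continuous_on (cball y r) w" using w by (rule continuous_on_subset) simp
        show "\<bar>w z\<bar> \<le> M" for z by (rule M)
        show "w z \<le> g z + \<eta>" for z using g(4)[of z] by linarith
        show "\<bar>g (x + h *\<^sub>R P $ i) + g (x - h *\<^sub>R P $ i) - 2 * g x - h\<^sup>2 * (quad (Hg x) (P $ i))\<bar> \<le> \<epsilon> * h\<^sup>2" for x i
          by (rule h1(2)[OF h(1,2)])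
        fix z \<psi> Ga Ha
        assume z: "z \<in> ball y r" and C: "C2_data UNIV \<psi> Ga Ha" "local_max_at (\<lambda>y. w y - \<psi> y) z"
        have "dist a z \<le> dist a y + dist y z" by (rule dist_triangle)
        then have "z \<in> ball a (3 * r)" using z y by simp
        then show "q \<le> quad_sum P (Ha z)" by (rule sub[OF _ C])
      qed
      then show ?thesis by (simp add: Z_def)
    qed
    also have "R g y \<le> R w y + \<eta>"
      unfolding R_def using g(4) \<eta>(1)
      by (intro resolvent_mono[OF \<mu>]) (auto simp: abs_le_iff algebra_simps)
    finally show ?thesis by simp
  qed
  have Rc: "continuous_on UNIV (R w)"
    unfolding R_def by (rule continuous_resolvent[OF \<mu> w])
  have "W x \<le> avg r (\<lambda>z. \<rho> z * (R w (x - z) + (Z + \<eta>)))"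
    unfolding W_def
  proof (intro mollifier_average_mono[OF \<rho>] continuous_intros continuous_translated_reflection w Rc)
    fix z :: "real^'n" assume "norm z < r"
    moreover have "dist a (x - z) \<le> dist a x + dist x (x - z)" by (rule dist_triangle)
    ultimately show "w (x - z) \<le> R w (x - z) + (Z + \<eta>)"
      using x by (intro local) (simp add: dist_norm)
  qed
  also have "\<dots> = avg r (\<lambda>z. \<rho> z * R w (x - z)) + (Z + \<eta>)"
    by (rule mollifier_average_add_const[OF \<rho> continuous_translated_reflection[OF Rc]])
  also have "avg r (\<lambda>z. \<rho> z * R w (x - z)) = R W x"
    unfolding R_def W_def[abs_def] by (rule resolvent_convolution[OF \<mu> \<rho>(1) w, symmetric])
  finally have lower: "W x \<le> R W x + (Z + \<eta>)" .
  \<comment> \<open>Ansatz for a discrete supersolution with source \<open>W\<close>: the source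
    plus \<open>1 / l\<close> times the majorant of its trace. The constant
    \<open>2 * S * C / l^2\<close> pays for the walk sum of the quadratic term.\<close>
  define V where "V y = W y + (k / l + 2 * S * C / l\<^sup>2 + C / l * ((y - x) \<bullet> (y - x)))" for y
  have WM: "\<bar>W y\<bar> \<le> M" for y
    unfolding W_def using mollifier_average_bound[OF \<rho> continuous_translated_reflection[OF w], of y 0 M] M by simp
  have "R W x \<le> V x + \<theta> ^ Suc n * e0"
    unfolding R_def \<theta>_def
  proof (rule resolvent_barrier[OF \<mu>])
    fix y
    have "walk_sum P h W y - 2 * ?N * W y = (\<Sum>i\<in>UNIV. W (y + h *\<^sub>R P $ i) + W (y - h *\<^sub>R P $ i) - 2 * W y)"
      by (simp add: walk_sum_def sum.distrib sum_subtractf)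
    also have "\<dots> \<le> (\<Sum>i\<in>UNIV. h\<^sup>2 * (quad (H y) (P $ i)) + \<epsilon> * h\<^sup>2)"
      by (rule sum_mono) (use h2(2)[OF h(1,3), of y] in \<open>simp add: abs_le_iff algebra_simps\<close>)
    also have "\<dots> = h\<^sup>2 * (LW y + ?N * \<epsilon>)"
      by (simp add: LW_def sum.distrib sum_distrib_left algebra_simps)
    also have "\<dots> \<le> h\<^sup>2 * (k + C * ((y - x) \<bullet> (y - x)))"
      using C(2)[of y] by (intro mult_left_mono) (auto simp: k_def)
    finally have 1: "walk_sum P h W y - 2 * ?N * W y \<le> h\<^sup>2 * (k + C * ((y - x) \<bullet> (y - x)))" .
    have 2: "walk_sum P h V y = walk_sum P h W y + 2 * ?N * (k / l + 2 * S * C / l\<^sup>2)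
        + C / l * (2 * ?N * ((y - x) \<bullet> (y - x)) + 2 * h\<^sup>2 * S)"
      unfolding V_def[abs_def] walk_sum_add walk_sum_cmult walk_sum_const walk_sum_square S_def by (simp add: distrib_left)
    have 3: "\<mu> * (k / l + 2 * S * C / l\<^sup>2 + C / l * ((y - x) \<bullet> (y - x)))
        = h\<^sup>2 * (k + C * ((y - x) \<bullet> (y - x))) + C / l * (2 * h\<^sup>2 * S)"
      using l0 by (simp add: \<mu>_def field_simps power2_eq_square)
    show "\<mu> * W y + walk_sum P h V y \<le> (\<mu> + 2 * ?N) * V y"
    proof -
      have "\<mu> * p + (z + 2 * ?N * t + c * (2 * ?N * d + s)) \<le> (\<mu> + 2 * ?N) * (p + (t + c * d))"
        if "z - 2 * ?N * p \<le> v" "\<mu> * (t + c * d) = v + c * s" for p t c d z s v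
        using that by (simp add: algebra_simps)
      from this[OF 1 3] show ?thesis unfolding 2 V_def .
    qed
    show "0 \<le> V y + e0"
    proof -
      have "- \<bar>k\<bar> / l \<le> k / l" using l0 by (intro divide_right_mono) auto
      moreover have "0 \<le> 2 * S * C / l\<^sup>2" "0 \<le> C / l * ((y - x) \<bullet> (y - x))" using S C l0 by auto
      ultimately show ?thesis using WM[of y] unfolding V_def e0_def abs_le_iff by simp
    qed
  qed
  with lower have "0 \<le> k / l + 2 * S * C / l\<^sup>2 + \<theta> ^ Suc n * e0 + Z + \<eta>" by (simp add: V_def)
  then have "0 \<le> l * (k / l + 2 * S * C / l\<^sup>2 + \<theta> ^ Suc n * e0 + Z + \<eta>)" using l0 by simp
  also have "\<dots> = k + (2 * S * C + K) / l + l * (\<theta> * \<theta> ^ n * e0) + 2 * \<eta> * l - q + (2 * ?N * \<theta> ^ n * M / h\<^sup>2 + ?N * \<epsilon>)"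
    using l0 by (simp add: Z_def field_simps power2_eq_square)
  finally have "q \<le> LW x + e1 + e1 + e1 + e1 + e1 + e1"
    using n l(2) \<eta>(2) \<epsilon>(2) unfolding k_def by linarith
  then show "q \<le> quad_sum P (H x) + e"
    using e by (simp add: LW_def e1_def)
qed

subsection \<open>Viscosity solutions\<close>

lemma viscosity_subsolutionD:
  assumes "viscosity_subsolution p b f \<Omega> u" "open \<Omega>" "x \<in> \<Omega>" "C2_data \<Omega> \<psi> G H"
    "local_max_at (\<lambda>x. u x - \<psi> x) x"
  shows "f x + b * norm (G x) powr p \<le> monge_ampere (H x)"
  using assms C2_data_imp_C2_on[OF assms(4,2)] C2_data_hessian(2)[OF assms(4,2,3)] C2_data_grad[OF assms(4,3)]
  unfolding viscosity_subsolution_def by metis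

lemma viscosity_subsolutionI:
  assumes "convex_on \<Omega> u"
    and "\<And>x \<psi> G H. \<lbrakk>x \<in> \<Omega>; C2_data \<Omega> \<psi> G H; local_max_at (\<lambda>x. u x - \<psi> x) x\<rbrakk>
      \<Longrightarrow> f x + b * norm (G x) powr p \<le> monge_ampere (H x)"
  shows "viscosity_subsolution p b f \<Omega> u"
  using assms C2_on_imp_C2_data unfolding viscosity_subsolution_def by blast

lemma viscosity_supersolutionD:
  assumes "viscosity_supersolution p b f \<Omega> u" "open \<Omega>" "x \<in> \<Omega>" "C2_data \<Omega> \<psi> G H"
    "local_min_at (\<lambda>x. u x - \<psi> x) x" "nonneg_sym (H x)"
  shows "monge_ampere (H x) \<le> f x + b * norm (G x) powr p"
  using assms C2_data_imp_C2_on[OF assms(4,2)] C2_data_hessian(2)[OF assms(4,2,3)] C2_data_grad[OF assms(4,3)]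
  unfolding viscosity_supersolution_def by metis

lemma viscosity_supersolutionI:
  assumes "convex_on \<Omega> u"
    and "\<And>x \<psi> G H. \<lbrakk>x \<in> \<Omega>; C2_data \<Omega> \<psi> G H; local_min_at (\<lambda>x. u x - \<psi> x) x; nonneg_sym (H x)\<rbrakk>
      \<Longrightarrow> monge_ampere (H x) \<le> f x + b * norm (G x) powr p"
  shows "viscosity_supersolution p b f \<Omega> u"
  using assms C2_on_imp_C2_data unfolding viscosity_supersolution_def by blast

lemma convex_touched_above_nonneg_sym:
  assumes "convex_on S u" "C2_data S \<psi> G H" "open S" "x \<in> S" "local_max_at (\<lambda>y. u y - \<psi> y) x"
  shows "nonneg_sym (H x)"
  using convex_touched_above(1)[OF assms] C2_data_hessian_symmetric[OF assms(2-4)]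
  by (simp add: nonneg_sym_def)

lemma C2_data_touching:
  assumes "C2_data S \<phi> G' H'" "C2_data S \<psi> G H" "open S" "x \<in> S" "local_max_at (\<lambda>y. \<phi> y - \<psi> y) x"
  shows "G x = G' x" and "quad (H' x) v \<le> quad (H x) v"
proof -
  have C: "C2_data S (\<lambda>y. \<phi> y + (- 1) * \<psi> y) (\<lambda>y. G' y + (- 1) *\<^sub>R G y) (\<lambda>y. H' y + (- 1) *\<^sub>R H y)"
    by (intro C2_data_add C2_data_scale assms)
  have m: "local_max_at (\<lambda>y. \<phi> y + (- 1) * \<psi> y) x" using assms(5) by simp
  show "G x = G' x" using C2_data_local_max(1)[OF C assms(3,4) m] by simp
  have "quad ((H' x + (- 1) *\<^sub>R H x)) v \<le> 0" by (rule C2_data_local_max(2)[OF C assms(3,4) m])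
  then show "quad (H' x) v \<le> quad (H x) v"
    by (simp only: matrix_vector_mult_add_rdistrib scaleR_matrix_vector_assoc[symmetric] inner_add_right inner_scaleR_right)
qed

section \<open>Shifting a matrix by a multiple of the identity\<close>

lemma transpose_shift: "transpose X = X \<Longrightarrow> transpose (X + c *\<^sub>R mat 1) = X + c *\<^sub>R (mat 1 :: real^'n^'n)"
  by (simp add: vec_eq_iff transpose_def mat_def)

lemma quadratic_form_shift: "quad (X + c *\<^sub>R mat 1) v = quad X v + c * (v \<bullet> v)"
  for X :: "real^'n^'n"
  by (simp add: matrix_vector_mult_add_rdistrib scaleR_matrix_vector_assoc[symmetric] inner_add_right)

lemma nonneg_sym_shift:
  assumes "nonneg_sym X" "c \<ge> 0"
  shows "nonneg_sym (X + c *\<^sub>R mat 1)"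
  using assms unfolding nonneg_sym_def by (simp only: transpose_shift quadratic_form_shift) auto

lemma nonneg_sym_mat: "c \<ge> 0 \<Longrightarrow> nonneg_sym (c *\<^sub>R mat 1)"
  using nonneg_sym_shift[of 0 c] by (simp add: nonneg_sym_def vec_eq_iff transpose_def)

lemma monge_ampere_mat: "c \<ge> 0 \<Longrightarrow> monge_ampere (c *\<^sub>R mat 1 :: real^'n^'n) = c"
  using monge_ampere_scale[OF nonneg_sym_mat[of 1], of c] by (simp add: monge_ampere_def)

lemma det_nonneg: "nonneg_sym X \<Longrightarrow> 0 \<le> det X"
proof -
  assume X: "nonneg_sym X"
  obtain Q d where Q: "orthogonal_matrix Q" "\<And>i. X *v (Q $ i) = d i *\<^sub>R (Q $ i)"
    using symmetric_matrix_diagonalizable X unfolding nonneg_sym_def by blast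
  have "d i \<ge> 0" for i using X eigenvalue_eq[OF Q, of i] by (simp add: nonneg_sym_def)
  then show "0 \<le> det X" by (simp add: det_eq_prod_eigenvalues[OF Q] prod_nonneg)
qed

text \<open>The determinant is a polynomial in \<open>c\<close>, and a power with positive exponent
  is continuous at \<open>0\<close> along nonnegative bases. It serves to let the margin
  \<open>k\<close> of a strict contact tend to zero.\<close>

lemma monge_ampere_shift_tendsto:
  fixes X :: "real^'n^'n"
  assumes X: "nonneg_sym X"
  shows "((\<lambda>c. monge_ampere (X + c *\<^sub>R mat 1)) \<longlongrightarrow> monge_ampere X) (at_right 0)"
proof -
  have "((\<lambda>c. det (X + c *\<^sub>R mat 1)) \<longlongrightarrow> det (X + 0 *\<^sub>R mat 1)) (at_right 0)"
    unfolding det_def by (intro tendsto_intros)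
  moreover have "\<forall>\<^sub>F c in at_right 0. 0 \<le> det (X + c *\<^sub>R mat 1)"
    unfolding eventually_at_right_field
    by (intro exI[of _ 1]) (auto intro!: det_nonneg nonneg_sym_shift X)
  ultimately show ?thesis
    unfolding monge_ampere_def by (intro tendsto_powr' tendsto_const) auto
qed

text \<open>Since \<open>X\<close> dominates \<open>\<mu>\<close> times the identity, subtracting
  \<open>k\<close> times the identity leaves at least \<open>(1 - k / \<mu>) * X\<close>;
  monotonicity and homogeneity conclude.\<close>

lemma monge_ampere_shift_down:
  fixes X :: "real^'n^'n"
  assumes X: "nonneg_sym X" and up: "\<And>v. quad X v \<le> M * (v \<bullet> v)"
    and c: "0 < c" "c \<le> monge_ampere X" and \<mu>: "\<mu> = c ^ CARD('n) / M ^ (CARD('n) - 1)" "\<mu> > 0"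
    and k: "0 \<le> k" "k \<le> \<mu>"
  shows "nonneg_sym (X + (- k) *\<^sub>R mat 1)" and "(1 - k / \<mu>) * c \<le> monge_ampere (X + (- k) *\<^sub>R mat 1)"
proof -
  have low: "\<mu> * (v \<bullet> v) \<le> quad X v" for v
    unfolding \<mu>(1) by (rule quadratic_form_lower_bound[OF X up c])
  have s: "0 \<le> 1 - k / \<mu>" using k \<mu>(2) by simp
  have form: "quad (((1 - k / \<mu>) *\<^sub>R X)) v \<le> quad ((X + (- k) *\<^sub>R mat 1)) v" for v
  proof -
    have "k / \<mu> * (\<mu> * (v \<bullet> v)) \<le> k / \<mu> * (quad X v)" using k \<mu>(2) by (intro mult_left_mono low) auto
    then show ?thesis using \<mu>(2)
      by (simp add: quadratic_form_shift scaleR_matrix_vector_assoc[symmetric] algebra_simps)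
  qed
  have nn: "nonneg_sym ((1 - k / \<mu>) *\<^sub>R X)"
    using X s unfolding nonneg_sym_def
    by (auto simp: scaleR_matrix_vector_assoc[symmetric] transpose_def vec_eq_iff)
  have tr: "transpose (X + (- k) *\<^sub>R mat 1) = X + (- k) *\<^sub>R mat 1"
    using X by (intro transpose_shift) (simp add: nonneg_sym_def)
  show "nonneg_sym (X + (- k) *\<^sub>R mat 1)"
    unfolding nonneg_sym_def using tr nn form by (meson nonneg_sym_def order_trans)
  have "(1 - k / \<mu>) * c \<le> monge_ampere ((1 - k / \<mu>) *\<^sub>R X)"
    using s c(2) monge_ampere_scale[OF X s] by (simp add: mult_left_mono)
  also have "\<dots> \<le> monge_ampere (X + (- k) *\<^sub>R mat 1)" by (rule monge_ampere_mono[OF nn tr form])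
  finally show "(1 - k / \<mu>) * c \<le> monge_ampere (X + (- k) *\<^sub>R mat 1)" .
qed

lemma convex_onI_tangents:
  fixes u :: "'a::real_inner \<Rightarrow> real"
  assumes "convex S" and tan: "\<And>z. z \<in> S \<Longrightarrow> \<exists>g. \<forall>x\<in>S. u z + g \<bullet> (x - z) \<le> u x"
  shows "convex_on S u"
  unfolding convex_on_def
proof (intro conjI ballI allI impI)
  fix x y and s t :: real assume xy: "x \<in> S" "y \<in> S" and st: "0 \<le> s" "0 \<le> t" "s + t = 1"
  define z where "z = s *\<^sub>R x + t *\<^sub>R y"
  have z: "z \<in> S" using assms(1) xy st unfolding z_def convex_def by blast
  obtain g where g: "\<And>x. x \<in> S \<Longrightarrow> u z + g \<bullet> (x - z) \<le> u x" using tan[OF z] by blast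
  have "u z = s * (u z + g \<bullet> (x - z)) + t * (u z + g \<bullet> (y - z))"
  proof -
    have "s * (u z + g \<bullet> (x - z)) + t * (u z + g \<bullet> (y - z)) = (s + t) * u z + g \<bullet> (s *\<^sub>R x + t *\<^sub>R y - (s + t) *\<^sub>R z)"
      by (simp add: algebra_simps inner_diff_right inner_add_right)
    then show ?thesis using st by (simp add: z_def)
  qed
  also have "\<dots> \<le> s * u x + t * u y" using g xy st by (intro add_mono mult_left_mono) auto
  finally show "u (s *\<^sub>R x + t *\<^sub>R y) \<le> s * u x + t * u y" by (simp add: z_def)
qed (rule assms(1))

lemma quadratic_tangent:
  fixes X :: "real^'n^'n"
  assumes "nonneg_sym X"
  shows "(a + g \<bullet> (z - c) + quad X (z - c) / 2) + (g + X *v (z - c)) \<bullet> (x - z)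
    \<le> a + g \<bullet> (x - c) + quad X (x - c) / 2"
proof -
  define w where "w = z - c"
  define d where "d = x - z"
  have x: "x - c = w + d" by (simp add: w_def d_def)
  have "0 \<le> quad X d" using assms by (simp add: nonneg_sym_def)
  moreover have "d \<bullet> (X *v w) = w \<bullet> (X *v d)"
    using assms symmetric_matrix_inner[of X d w] by (simp add: nonneg_sym_def inner_commute)
  ultimately show ?thesis
    unfolding x d_def[symmetric] w_def[symmetric]
    by (simp add: matrix_vector_right_distrib inner_add_left inner_add_right inner_commute[of "X *v w"])
qed

lemma continuous_on_rhs:
  fixes g :: "real^'n \<Rightarrow> real ^ 'm"
  assumes "continuous_on S f" "continuous_on S g" "p > 0"
  shows "continuous_on S (\<lambda>x. f x + b * norm (g x) powr p)"
  using assms by (intro continuous_intros continuous_on_powr') auto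

text \<open>Adding \<open>k\<close> to the Hessian yields \<open>k / 2\<close> times the squared
  distance; half of this absorbs the Taylor remainder, the other half is the margin
  \<open>k / 4\<close> that makes the contact strict.\<close>

lemma Taylor_quadratic_above:
  fixes u :: "real^'n \<Rightarrow> real"
  assumes C: "C2_data S \<psi> G H" "open S" "x0 \<in> S" and max: "local_max_at (\<lambda>y. u y - \<psi> y) x0" and k: "k > 0"
  obtains r where "r > 0" "cball x0 r \<subseteq> S"
    "\<And>x. x \<in> cball x0 r \<Longrightarrow> u x \<le> u x0 + (G x0 \<bullet> (x - x0) + quad (H x0 + k *\<^sub>R mat 1) (x - x0) / 2)
      - k / 4 * ((x - x0) \<bullet> (x - x0))"
proof -
  obtain d where d: "d > 0" "ball x0 d \<subseteq> S"
    "\<And>w. norm w < d \<Longrightarrow> \<bar>\<psi> (x0 + w) - \<psi> x0 - w \<bullet> G x0 - quad (H x0) w / 2\<bar> \<le> k / 4 * (w \<bullet> w)"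
    using C2_data_taylor[OF C, of "k / 4"] k by auto
  obtain e where e: "e > 0" "\<And>y. dist y x0 < e \<Longrightarrow> u y - \<psi> y \<le> u x0 - \<psi> x0"
    using max unfolding local_max_at_def eventually_nhds_metric by blast
  show ?thesis
  proof (rule that[of "min d e / 2"])
    show "min d e / 2 > 0" using d e by simp
    show "cball x0 (min d e / 2) \<subseteq> S" using d e by (auto simp: min_def subset_eq split: if_splits)
    fix x assume x: "x \<in> cball x0 (min d e / 2)"
    then have xd: "norm (x - x0) < d" "dist x x0 < e"
      using d(1) e(1) by (auto simp: dist_norm norm_minus_commute min_def split: if_splits)
    show "u x \<le> u x0 + (G x0 \<bullet> (x - x0) + quad (H x0 + k *\<^sub>R mat 1) (x - x0) / 2)
      - k / 4 * ((x - x0) \<bullet> (x - x0))"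
      using d(3)[OF xd(1)] e(2)[OF xd(2)]
      unfolding quadratic_form_shift abs_le_iff by (simp add: inner_commute[of "G x0"]) argo
  qed
qed

lemma Taylor_quadratic_below:
  fixes u :: "real^'n \<Rightarrow> real"
  assumes C: "C2_data S \<psi> G H" "open S" "x0 \<in> S" and min: "local_min_at (\<lambda>y. u y - \<psi> y) x0" and k: "k > 0"
  obtains r where "r > 0" "cball x0 r \<subseteq> S"
    "\<And>x. x \<in> cball x0 r \<Longrightarrow> u x0 + (G x0 \<bullet> (x - x0) + quad ((H x0 + (- k) *\<^sub>R mat 1)) (x - x0) / 2)
      + k / 4 * ((x - x0) \<bullet> (x - x0)) \<le> u x"
proof -
  have C': "C2_data S (\<lambda>x. (- 1) * \<psi> x) (\<lambda>x. (- 1) *\<^sub>R G x) (\<lambda>x. (- 1) *\<^sub>R H x)"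
    by (rule C2_data_scale[OF C(1)])
  have "local_max_at (\<lambda>y. - u y - (- 1) * \<psi> y) x0"
    using min unfolding local_max_at_def local_min_at_def by (simp add: algebra_simps)
  from Taylor_quadratic_above[OF C' C(2,3) this k] obtain r where r: "r > 0" "cball x0 r \<subseteq> S"
    "\<And>x. x \<in> cball x0 r \<Longrightarrow> - u x \<le> - u x0 + (((- 1) *\<^sub>R G x0) \<bullet> (x - x0) + quad (((- 1) *\<^sub>R H x0 + k *\<^sub>R mat 1)) (x - x0) / 2)
      - k / 4 * ((x - x0) \<bullet> (x - x0))" by metis
  have neg: "quad (- H x0) v = - (quad (H x0) v)" for v
    using scaleR_matrix_vector_assoc[of "-1" "H x0" v] by (simp flip: inner_minus_right)
  show ?thesis
  proof (rule that[OF r(1,2)])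
    fix x assume "x \<in> cball x0 r"
    from r(3)[OF this] show "u x0 + (G x0 \<bullet> (x - x0) + quad ((H x0 + (- k) *\<^sub>R mat 1)) (x - x0) / 2)
      + k / 4 * ((x - x0) \<bullet> (x - x0)) \<le> u x"
      unfolding quadratic_form_shift by (simp add: neg) argo
  qed
qed

subsection \<open>Existence: Perron's method\<close>

text \<open>Strict contact is stable: a member of the family close to \<open>u\<close> at
  \<open>x0\<close> has its own contact with the quadratic near \<open>x0\<close>, where its
  inequality applies. Members are convex, hence continuous, so the maximum over a closed ball
  exists.\<close>

lemma viscosity_subsolution_Sup:
  fixes \<Omega> :: "(real^'n) set"
  assumes \<Omega>: "open \<Omega>" and f: "continuous_on \<Omega> f" and p: "p > 0"
    and ne: "F \<noteq> {}" and sub: "\<And>w. w \<in> F \<Longrightarrow> viscosity_subsolution p b f \<Omega> w"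
    and bdd: "\<And>x. x \<in> \<Omega> \<Longrightarrow> bdd_above ((\<lambda>w. w x) ` F)"
    and u: "\<And>x. x \<in> \<Omega> \<Longrightarrow> u x = (SUP w\<in>F. w x)"
  shows "viscosity_subsolution p b f \<Omega> u"
proof -
  have conv: "convex_on \<Omega> w" if "w \<in> F" for w using sub[OF that] by (simp add: viscosity_subsolution_def)
  obtain w0 where w0: "w0 \<in> F" using ne by blast
  have cs: "convex \<Omega>" using conv[OF w0] by (rule convex_on_imp_convex)
  have le: "w x \<le> u x" if "w \<in> F" "x \<in> \<Omega>" for w x
    unfolding u[OF that(2)] using that bdd by (intro cSUP_upper) auto
  have cu: "convex_on \<Omega> u"
    unfolding convex_on_def
  proof (intro conjI ballI allI impI cs)
    fix x y and s t :: real assume xy: "x \<in> \<Omega>" "y \<in> \<Omega>" and st: "0 \<le> s" "0 \<le> t" "s + t = 1"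
    have z: "s *\<^sub>R x + t *\<^sub>R y \<in> \<Omega>" using cs xy st unfolding convex_def by blast
    show "u (s *\<^sub>R x + t *\<^sub>R y) \<le> s * u x + t * u y"
      unfolding u[OF z]
    proof (rule cSUP_least[OF ne])
      fix w assume w: "w \<in> F"
      have "w (s *\<^sub>R x + t *\<^sub>R y) \<le> s * w x + t * w y"
        using conv[OF w] xy st unfolding convex_on_def by blast
      also have "\<dots> \<le> s * u x + t * u y" using le[OF w] xy st by (intro add_mono mult_left_mono) auto
      finally show "w (s *\<^sub>R x + t *\<^sub>R y) \<le> s * u x + t * u y" .
    qed
  qed
  show ?thesis
  proof (rule viscosity_subsolutionI[OF cu])
    fix x0 \<psi> G H assume x0: "x0 \<in> \<Omega>" and C: "C2_data \<Omega> \<psi> G H" and max: "local_max_at (\<lambda>x. u x - \<psi> x) x0"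
    have nn: "nonneg_sym (H x0)" by (rule convex_touched_above_nonneg_sym[OF cu C \<Omega> x0 max])
    have step: "f x0 + b * norm (G x0) powr p \<le> monge_ampere (H x0 + k *\<^sub>R mat 1)" if k: "k > 0" for k
    proof (rule ccontr)
      define X where "X = H x0 + k *\<^sub>R mat 1"
      define Q where "Q x = 0 + G x0 \<bullet> (x - x0) + quad X (x - x0) / 2" for x
      define g where "g x = G x0 + X *v (x - x0)" for x
      have tr: "transpose X = X" unfolding X_def using nn by (intro transpose_shift) (simp add: nonneg_sym_def)
      have CQ: "C2_data S Q g (\<lambda>x. X)" for S
        unfolding Q_def[abs_def] g_def[abs_def] by (rule C2_data_quadratic[OF tr])
      assume "\<not> f x0 + b * norm (G x0) powr p \<le> monge_ampere (H x0 + k *\<^sub>R mat 1)"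
      then have lt: "monge_ampere X < f x0 + b * norm (g x0) powr p" by (simp add: X_def g_def)
      have gc: "continuous_on \<Omega> g"
        unfolding g_def[abs_def] by (intro continuous_intros matrix_vector_mult_linear_continuous_on
            continuous_on_compose2[OF matrix_vector_mult_linear_continuous_on[of UNIV]]) auto
      obtain s1 where s1: "s1 > 0" "\<And>x. x \<in> \<Omega> \<Longrightarrow> dist x x0 < s1 \<Longrightarrow> monge_ampere X < f x + b * norm (g x) powr p"
      proof -
        have "\<forall>\<^sub>F x in at x0 within \<Omega>. monge_ampere X < f x + b * norm (g x) powr p"
          using continuous_on_rhs[OF f gc p, of b] x0 lt unfolding continuous_on_def by (intro order_tendstoD(1)) auto
        then obtain s where s: "s > 0" "\<And>x. x \<in> \<Omega> \<Longrightarrow> x \<noteq> x0 \<Longrightarrow> dist x x0 < s \<Longrightarrow> monge_ampere X < f x + b * norm (g x) powr p"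
          unfolding eventually_at by blast
        then show ?thesis using lt by (intro that[of s]) metis+
      qed
      obtain r where r: "r > 0" "cball x0 r \<subseteq> \<Omega>"
        "\<And>x. x \<in> cball x0 r \<Longrightarrow> u x \<le> u x0 + Q x - k / 4 * ((x - x0) \<bullet> (x - x0))"
        using Taylor_quadratic_above[OF C \<Omega> x0 max k] unfolding Q_def X_def add_0 by metis
      define s where "s = min r s1"
      have s: "s > 0" "s \<le> r" "s \<le> s1" using r s1 by (auto simp: s_def)
      \<comment> \<open>The deficit \<open>k / 4 * s^2\<close> is what the margin charges at
        distance \<open>s\<close>, so the maximum of \<open>w - Q\<close> falls inside the ball of
        radius \<open>s\<close>.\<close>
      have "u x0 - k / 4 * s\<^sup>2 < (SUP w\<in>F. w x0)" using k s u[OF x0] by simp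
      then obtain w where w: "w \<in> F" "u x0 - k / 4 * s\<^sup>2 < w x0"
        using less_cSUP_iff[OF ne bdd[OF x0]] by blast
      have wc: "continuous_on \<Omega> w" by (rule convex_on_continuous[OF \<Omega> conv[OF w(1)]])
      have "continuous_on (cball x0 r) (\<lambda>x. w x - Q x)"
        using C2_dataD(1)[OF CQ[of UNIV]] r(2)
        by (intro continuous_intros continuous_on_subset[OF wc])
          (meson UNIV_I differentiable_at_imp_differentiable_on differentiable_imp_continuous_on differentiableI)+
      then obtain x1 where x1: "x1 \<in> cball x0 r" "\<And>y. y \<in> cball x0 r \<Longrightarrow> w y - Q y \<le> w x1 - Q x1"
        using continuous_attains_sup[of "cball x0 r" "\<lambda>x. w x - Q x"] r(1) by auto
      have x1\<Omega>: "x1 \<in> \<Omega>" using x1 r by blast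
      have "w x0 - Q x0 \<le> w x1 - Q x1" using x1(2)[of x0] r(1) by simp
      moreover have "w x1 \<le> u x1" by (rule le[OF w(1) x1\<Omega>])
      moreover have "Q x0 = 0" by (simp add: Q_def)
      ultimately have "k / 4 * ((x1 - x0) \<bullet> (x1 - x0)) < k / 4 * s\<^sup>2"
        using r(3)[OF x1(1)] w(2) by linarith
      then have "(norm (x1 - x0))\<^sup>2 < s\<^sup>2" using k by (simp add: power2_norm_eq_inner)
      then have d: "dist x1 x0 < s" using s(1) by (simp add: dist_norm power2_less_imp_less)
      have "local_max_at (\<lambda>x. w x - Q x) x1"
        unfolding local_max_at_def eventually_nhds
        using d s x1(2) by (intro exI[of _ "ball x0 r"]) (auto simp: dist_commute)
      from viscosity_subsolutionD[OF sub[OF w(1)] \<Omega> x1\<Omega> CQ this] s1(2)[OF x1\<Omega>] d s(3)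
      show False by simp
    qed
    show "f x0 + b * norm (G x0) powr p \<le> monge_ampere (H x0)"
      by (rule tendsto_lowerbound[OF monge_ampere_shift_tendsto[OF nn]])
        (auto intro: step simp: eventually_at_right_field intro!: exI[of _ 1])
  qed
qed

lemma C2_data_sqdist:
  "C2_data S (\<lambda>x. a + 0 \<bullet> (x - c) + quad (((2 * K) *\<^sub>R mat 1 :: real^'n^'n)) (x - c) / 2)
    (\<lambda>x. 0 + ((2 * K) *\<^sub>R mat 1) *v (x - c)) (\<lambda>x. (2 * K) *\<^sub>R mat 1)"
  by (rule C2_data_quadratic) (simp add: vec_eq_iff transpose_def mat_def)

text \<open>On the ball the gradient has length at most \<open>2 K R\<close>, and the Hessian is
  \<open>2 K\<close> times the identity, so the hypothesis on \<open>K\<close> is the inequality at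
  the steepest slope.\<close>

lemma paraboloid_subsolution:
  fixes \<Omega> :: "(real^'n) set"
  assumes \<Omega>: "open \<Omega>" "convex \<Omega>" and K: "K > 0" and p: "p > 0" and b: "b > 0"
    and sub: "\<Omega> \<subseteq> ball y R" and f: "\<And>x. x \<in> \<Omega> \<Longrightarrow> f x + b * (2 * K * R) powr p \<le> 2 * K"
  shows "viscosity_subsolution p b f \<Omega> (\<lambda>x. K * ((x - y) \<bullet> (x - y) - R\<^sup>2))"
proof -
  let ?X = "(2 * K) *\<^sub>R mat 1 :: real^'n^'n"
  let ?w = "\<lambda>x. K * ((x - y) \<bullet> (x - y) - R\<^sup>2)"
  have nn: "nonneg_sym ?X" using K by (intro nonneg_sym_mat) simp
  have w: "?w x = - K * R\<^sup>2 + 0 \<bullet> (x - y) + quad ?X (x - y) / 2" for x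
    by (simp add: scaleR_matrix_vector_assoc[symmetric] algebra_simps)
  have C: "C2_data \<Omega> ?w (\<lambda>x. (2 * K) *\<^sub>R (x - y)) (\<lambda>x. ?X)"
    by (rule C2_data_cong[OF C2_data_sqdist[of \<Omega> "- K * R\<^sup>2" y K] w])
      (simp_all add: scaleR_matrix_vector_assoc[symmetric])
  have conv: "convex_on \<Omega> ?w"
  proof (rule convex_onI_tangents[OF \<Omega>(2)])
    fix z assume "z \<in> \<Omega>"
    show "\<exists>g. \<forall>x\<in>\<Omega>. ?w z + g \<bullet> (x - z) \<le> ?w x"
      unfolding w using quadratic_tangent[OF nn] by blast
  qed
  show ?thesis
  proof (rule viscosity_subsolutionI[OF conv])
    fix x \<psi> G H assume x: "x \<in> \<Omega>" and C': "C2_data \<Omega> \<psi> G H" and max: "local_max_at (\<lambda>x. ?w x - \<psi> x) x"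
    have G: "G x = (2 * K) *\<^sub>R (x - y)" by (rule C2_data_touching(1)[OF C C' \<Omega>(1) x max])
    have "norm (x - y) < R" using x sub by (auto simp: dist_norm norm_minus_commute)
    then have "norm (G x) \<le> 2 * K * R" using K by (simp add: G)
    then have "norm (G x) powr p \<le> (2 * K * R) powr p" using p by (intro powr_mono2) auto
    then have "f x + b * norm (G x) powr p \<le> 2 * K"
      using f[OF x] b mult_left_mono[of "norm (G x) powr p" "(2 * K * R) powr p" b] by linarith
    also have "2 * K = monge_ampere ?X" using K by (simp add: monge_ampere_mat)
    also have "\<dots> \<le> monge_ampere (H x)"
      by (rule monge_ampere_mono[OF nn C2_data_hessian_symmetric[OF C' \<Omega>(1) x] C2_data_touching(2)[OF C C' \<Omega>(1) x max]])
    finally show "f x + b * norm (G x) powr p \<le> monge_ampere (H x)" .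
  qed
qed

text \<open>Here \<open>t = 2 K\<close>. One lower bound gives \<open>M \<le> t / 2\<close>, the
  other \<open>b (t R)^p \<le> t / 2\<close>; the latter means
  \<open>t^(1 - p) \<ge> 2 b R^p\<close>, true for large \<open>t\<close> because
  \<open>p < 1\<close>.\<close>

lemma exists_paraboloid_constant:
  fixes p b R M :: real
  assumes "0 < p" "p < 1" "0 < b" "0 < R"
  obtains K where "K > 0" "M + b * (2 * K * R) powr p \<le> 2 * K"
proof -
  define t where "t = max (2 * \<bar>M\<bar> + 1) ((2 * b * R powr p) powr (1 / (1 - p)))"
  have t: "t > 0" "2 * M \<le> t" by (auto simp: t_def)
  have "2 * b * R powr p = ((2 * b * R powr p) powr (1 / (1 - p))) powr (1 - p)"
    using assms by (simp add: powr_powr)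
  also have "\<dots> \<le> t powr (1 - p)" using assms by (intro powr_mono2) (auto simp: t_def)
  finally have "2 * b * R powr p * t powr p \<le> t powr (1 - p) * t powr p" by (intro mult_right_mono) auto
  also have "\<dots> = t" using t by (simp flip: powr_add)
  finally have "2 * (b * (t * R) powr p) \<le> t" using t assms by (simp add: powr_mult mult_ac)
  then show ?thesis using t by (intro that[of "t / 2"]) auto
qed


text \<open>Where the quadratic exceeds \<open>u\<close>, its tangent planes lie below the glued function even
  outside the ball: along a ray such a plane starts above the convex \<open>u\<close> and is below it on the
  shell, hence stays below it.\<close>

lemma convex_on_glue_quadratic:
  fixes u :: "real^'n \<Rightarrow> real" and X :: "real^'n^'n" and a :: real and g x0 :: "real^'n"
  assumes u: "convex_on \<Omega> u" and r: "r > 0" and X: "nonneg_sym X"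
  defines "Q \<equiv> \<lambda>x. a + g \<bullet> (x - x0) + quad X (x - x0) / 2"
  assumes shell: "\<And>x. r / 2 \<le> dist x0 x \<Longrightarrow> dist x0 x < r \<Longrightarrow> Q x \<le> u x"
  shows "convex_on \<Omega> (\<lambda>x. if x \<in> ball x0 r then max (u x) (Q x) else u x)" (is "convex_on \<Omega> ?v")
  unfolding convex_on_def
proof (intro conjI ballI allI impI)
  show cs: "convex \<Omega>" using u by (rule convex_on_imp_convex)
  fix x y and s t :: real assume xy: "x \<in> \<Omega>" "y \<in> \<Omega>" and st: "0 \<le> s" "0 \<le> t" "s + t = 1"
  define z where "z = s *\<^sub>R x + t *\<^sub>R y"
  have z: "z \<in> \<Omega>" using cs xy st unfolding z_def convex_def by blast
  have uv: "u w \<le> ?v w" for w by auto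
  have "?v z \<le> s * ?v x + t * ?v y"
  proof (cases "?v z = u z")
    case True
    have "u z \<le> s * u x + t * u y" using u xy st unfolding convex_on_def z_def by blast
    also have "\<dots> \<le> s * ?v x + t * ?v y" using uv st by (intro add_mono mult_left_mono) auto
    finally show ?thesis using True by simp
  next
    case False
    then have zb: "z \<in> ball x0 r" and Qz: "?v z = Q z" "u z < Q z" by (auto split: if_splits simp: max_def)
    then have zr: "dist x0 z < r / 2" using shell[of z] by force
    define T where "T w = Q z + (g + X *v (z - x0)) \<bullet> (w - z)" for w
    have TQ: "T w \<le> Q w" for w unfolding T_def Q_def by (rule quadratic_tangent[OF X])
    have Tv: "T w \<le> ?v w" if w: "w \<in> \<Omega>" for w
    proof (cases "w \<in> ball x0 r")
      case True
      then show ?thesis using TQ[of w] by auto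
    next
      case False
      have "\<exists>\<tau>\<ge>0. \<tau> \<le> 1 \<and> dist x0 (z + \<tau> *\<^sub>R (w - z)) = r / 2"
      proof (rule IVT')
        show "dist x0 (z + 0 *\<^sub>R (w - z)) \<le> r / 2" using zr by simp
        show "r / 2 \<le> dist x0 (z + 1 *\<^sub>R (w - z))" using False r by simp
      qed (auto intro!: continuous_intros)
      then obtain \<tau> where \<tau>: "0 \<le> \<tau>" "\<tau> \<le> 1" "dist x0 (z + \<tau> *\<^sub>R (w - z)) = r / 2" by blast
      have "\<tau> \<noteq> 0" using \<tau>(3) zr by auto
      then have \<tau>0: "\<tau> > 0" using \<tau>(1) by simp
      define z' where "z' = z + \<tau> *\<^sub>R (w - z)"
      have z': "z' = (1 - \<tau>) *\<^sub>R z + \<tau> *\<^sub>R w" by (simp add: z'_def algebra_simps)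
      have "T z' \<le> u z'" using TQ[of z'] shell[of z'] \<tau>(3) r by (simp add: z'_def)
      also have "u z' \<le> (1 - \<tau>) * u z + \<tau> * u w"
        unfolding z' using convex_onD[OF u \<tau>(1,2) z w] .
      also have "\<dots> \<le> (1 - \<tau>) * Q z + \<tau> * u w" using Qz \<tau> by (intro add_right_mono mult_left_mono) auto
      also have "T z' = (1 - \<tau>) * Q z + \<tau> * T w"
        by (simp add: T_def z'_def algebra_simps)
      finally have "\<tau> * T w \<le> \<tau> * u w" by simp
      then have "T w \<le> u w" using \<tau>0 by simp
      then show ?thesis using uv[of w] by (rule order_trans)
    qed
    have "Q z = s * T x + t * T y"
    proof -
      have "s * T x + t * T y = (s + t) * Q z + (g + X *v (z - x0)) \<bullet> (s *\<^sub>R x + t *\<^sub>R y - (s + t) *\<^sub>R z)"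
        by (simp add: T_def algebra_simps inner_diff_right inner_add_right)
      then show ?thesis using st by (simp add: z_def)
    qed
    also have "\<dots> \<le> s * ?v x + t * ?v y" using Tv xy st by (intro add_mono mult_left_mono) auto
    finally show ?thesis using Qz by simp
  qed
  then show "?v (s *\<^sub>R x + t *\<^sub>R y) \<le> s * ?v x + t * ?v y" by (simp only: z_def)
qed

lemma quadratic_form_norm_bound:
  fixes X :: "real^'n^'n"
  shows "quad X v \<le> (real CARD('n) * norm X + 1) * (v \<bullet> v)"
proof -
  have "quad X v \<le> real CARD('n) * norm X * (v \<bullet> v)"
    using matrix_quadratic_diff_bound[of v X 0] by simp
  also have "\<dots> \<le> (real CARD('n) * norm X + 1) * (v \<bullet> v)"
    by (intro mult_right_mono) auto
  finally show ?thesis .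
qed

text \<open>If the supersolution inequality fails, a quadratic with slightly smaller Hessian still
  satisfies the strict subsolution inequality near \<open>x0\<close> and lies strictly below
  \<open>u\<close> off \<open>x0\<close>. Lifted by \<open>\<sigma>\<close>, it overtakes
  \<open>u\<close> only close to \<open>x0\<close>, and the maximum of both is a larger
  competitor.\<close>

lemma Perron_bump:
  fixes \<Omega> :: "(real^'n) set"
  assumes \<Omega>: "open \<Omega>" and f: "continuous_on \<Omega> f" and fpos: "\<And>x. x \<in> \<Omega> \<Longrightarrow> f x > 0" and p: "p > 0" and b: "b > 0"
    and sub: "viscosity_subsolution p b f \<Omega> u" and neg: "\<And>x. x \<in> \<Omega> \<Longrightarrow> u x \<le> 0"
    and x0: "x0 \<in> \<Omega>" and C: "C2_data \<Omega> \<psi> G H" and min: "local_min_at (\<lambda>x. u x - \<psi> x) x0"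
    and nn: "nonneg_sym (H x0)" and bad: "f x0 + b * norm (G x0) powr p < monge_ampere (H x0)"
  obtains v where "viscosity_subsolution p b f \<Omega> v" "\<And>x. x \<in> \<Omega> \<Longrightarrow> v x \<le> 0" "u x0 < v x0"
proof -
  have cu: "convex_on \<Omega> u" using sub by (simp add: viscosity_subsolution_def)
  have uc: "continuous_on \<Omega> u" by (rule convex_on_continuous[OF \<Omega> cu])
  \<comment> \<open>If \<open>u\<close> reached \<open>0\<close> at \<open>x0\<close>, the constant
    \<open>0\<close> would touch it from above there and force \<open>f x0 \<le> 0\<close>.\<close>
  have u0: "u x0 < 0"
  proof (rule ccontr)
    assume "\<not> u x0 < 0"
    then have z: "u x0 = 0" using neg[OF x0] by simp
    have "local_max_at (\<lambda>x. u x - 0) x0"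
      unfolding local_max_at_def eventually_nhds using \<Omega> x0 neg z by (intro exI[of _ \<Omega>]) auto
    from viscosity_subsolutionD[OF sub \<Omega> x0 C2_data_const this]
    have "f x0 \<le> monge_ampere (0 *\<^sub>R mat 1 :: real^'n^'n)" by simp
    then show False using fpos[OF x0] unfolding monge_ampere_mat[OF order_refl] by simp
  qed
  define c where "c = monge_ampere (H x0)"
  define \<rho>0 where "\<rho>0 = f x0 + b * norm (G x0) powr p"
  have \<rho>0: "0 < \<rho>0" "\<rho>0 < c" using bad fpos[OF x0] b by (auto simp: \<rho>0_def c_def intro!: add_pos_nonneg)
  have c: "0 < c" using \<rho>0 by simp
  define M where "M = real CARD('n) * norm (H x0) + 1"
  have M: "M > 0" by (simp add: M_def add_nonneg_pos)
  define \<mu> where "\<mu> = c ^ CARD('n) / M ^ (CARD('n) - 1)"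
  have \<mu>: "\<mu> > 0" using c M by (simp add: \<mu>_def)
  \<comment> \<open>With this \<open>k\<close> the number \<open>(1 - k / \<mu>) * c\<close> is the
    midpoint of \<open>\<rho>0\<close> and \<open>c\<close>.\<close>
  define k where "k = \<mu> * (c - \<rho>0) / (2 * c)"
  have k: "0 < k" "k \<le> \<mu>" "(1 - k / \<mu>) * c > \<rho>0"
    using \<mu> c \<rho>0 by (auto simp: k_def field_simps)
  define X where "X = H x0 + (- k) *\<^sub>R mat 1"
  have X: "nonneg_sym X" "(1 - k / \<mu>) * c \<le> monge_ampere X"
  proof -
    have up: "quad (H x0) v \<le> M * (v \<bullet> v)" for v
      unfolding M_def by (rule quadratic_form_norm_bound)
    have cle: "c \<le> monge_ampere (H x0)" by (simp add: c_def)
    show "nonneg_sym X" "(1 - k / \<mu>) * c \<le> monge_ampere X"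
      unfolding X_def by (rule monge_ampere_shift_down[OF nn up c cle \<mu>_def \<mu> less_imp_le[OF k(1)] k(2)])+
  qed
  have FX: "\<rho>0 < monge_ampere X" using k(3) X(2) by linarith
  define Q where "Q x = G x0 \<bullet> (x - x0) + quad X (x - x0) / 2" for x
  define g where "g x = G x0 + X *v (x - x0)" for x
  have tr: "transpose X = X" using X(1) by (simp add: nonneg_sym_def)
  obtain r1 where r1: "r1 > 0" "cball x0 r1 \<subseteq> \<Omega>"
    "\<And>x. x \<in> cball x0 r1 \<Longrightarrow> u x0 + Q x + k / 4 * ((x - x0) \<bullet> (x - x0)) \<le> u x"
    using Taylor_quadratic_below[OF C \<Omega> x0 min k(1)] unfolding Q_def X_def by metis
  have gc: "continuous_on UNIV g"
    unfolding g_def[abs_def] by (intro continuous_intros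
        continuous_on_compose2[OF matrix_vector_mult_linear_continuous_on[of UNIV]]) auto
  have Qc: "continuous_on UNIV Q"
    unfolding Q_def[abs_def] by (intro continuous_intros
        continuous_on_compose2[OF matrix_vector_mult_linear_continuous_on[of UNIV]]) auto
  have "\<forall>\<^sub>F x in at x0 within \<Omega>. f x + b * norm (g x) powr p < monge_ampere X"
    using continuous_on_rhs[OF f continuous_on_subset[OF gc subset_UNIV] p, of b] x0 FX
    unfolding continuous_on_def by (intro order_tendstoD(2)) (auto simp: \<rho>0_def g_def)
  moreover have "\<forall>\<^sub>F x in at x0 within \<Omega>. u x0 + Q x < u x0 / 2"
  proof (rule order_tendstoD(2))
    show "((\<lambda>x. u x0 + Q x) \<longlongrightarrow> u x0 + Q x0) (at x0 within \<Omega>)"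
      using Qc by (intro tendsto_intros) (auto simp: continuous_on_def intro: tendsto_within_subset)
    show "u x0 + Q x0 < u x0 / 2" using u0 by (simp add: Q_def)
  qed
  ultimately have "\<forall>\<^sub>F x in at x0 within \<Omega>. f x + b * norm (g x) powr p < monge_ampere X \<and> u x0 + Q x < u x0 / 2"
    by (rule eventually_conj)
  then obtain r2 where r2: "r2 > 0" "\<And>x. x \<in> \<Omega> \<Longrightarrow> x \<noteq> x0 \<Longrightarrow> dist x x0 < r2 \<Longrightarrow>
      f x + b * norm (g x) powr p < monge_ampere X \<and> u x0 + Q x < u x0 / 2"
    unfolding eventually_at by blast
  define r where "r = min r1 r2"
  have r: "r > 0" using r1 r2 by (simp add: r_def)
  have in_ball: "x \<in> \<Omega> \<and> f x + b * norm (g x) powr p < monge_ampere X \<and> u x0 + Q x < u x0 / 2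
      \<and> u x0 + Q x + k / 4 * ((x - x0) \<bullet> (x - x0)) \<le> u x" if "x \<in> ball x0 r" for x
  proof -
    have x: "x \<in> cball x0 r1" "x \<in> \<Omega>" "dist x x0 < r2" using that r1(2) by (auto simp: r_def dist_commute)
    show ?thesis
    proof (cases "x = x0")
      case True
      then show ?thesis using FX u0 x r1(3)[OF x(1)] by (simp add: \<rho>0_def g_def Q_def)
    next
      case False
      then show ?thesis using r2(2)[OF x(2) False x(3)] r1(3)[OF x(1)] x(2) by blast
    qed
  qed
  \<comment> \<open>The first bound keeps the lifted quadratic below \<open>u\<close> at distances
    from \<open>r / 2\<close> to \<open>r\<close>, where the margin is at least
    \<open>k / 4 * r^2 / 4\<close>; the second keeps it nonpositive, since
    \<open>u x0 + Q x < u x0 / 2\<close>.\<close>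
  define \<sigma> where "\<sigma> = min (k * r\<^sup>2 / 16) (- u x0 / 2)"
  have \<sigma>: "\<sigma> > 0" "\<sigma> \<le> k * r\<^sup>2 / 16" "\<sigma> \<le> - u x0 / 2" using k r u0 by (auto simp: \<sigma>_def)
  define q where "q x = (u x0 + \<sigma>) + G x0 \<bullet> (x - x0) + quad X (x - x0) / 2" for x
  have qQ: "q x = u x0 + Q x + \<sigma>" for x by (simp add: q_def Q_def)
  have Cq: "C2_data S q g (\<lambda>x. X)" for S
    unfolding q_def[abs_def] g_def[abs_def] by (rule C2_data_quadratic[OF tr])
  have shell: "q x \<le> u x" if "r / 2 \<le> dist x0 x" "dist x0 x < r" for x
  proof -
    have "(r / 2)\<^sup>2 \<le> (dist x0 x)\<^sup>2" using that r by (intro power_mono) auto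
    then have "r\<^sup>2 / 4 \<le> (x - x0) \<bullet> (x - x0)"
      by (simp add: dist_norm norm_minus_commute[of x0] power2_norm_eq_inner power_divide)
    then have "k / 4 * (r\<^sup>2 / 4) \<le> k / 4 * ((x - x0) \<bullet> (x - x0))" using k by (intro mult_left_mono) auto
    moreover have "u x0 + Q x + k / 4 * ((x - x0) \<bullet> (x - x0)) \<le> u x" using in_ball[of x] that(2) by simp
    ultimately show ?thesis using \<sigma>(2) unfolding qQ by linarith
  qed
  define v where "v x = (if x \<in> ball x0 r then max (u x) (q x) else u x)" for x
  have cv: "convex_on \<Omega> v"
    unfolding v_def q_def by (rule convex_on_glue_quadratic[OF cu r X(1)]) (use shell in \<open>simp add: q_def\<close>)
  show ?thesis
  proof (rule that[of v])
    show "v x \<le> 0" if "x \<in> \<Omega>" for x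
      using neg[OF that] in_ball[of x] \<sigma>(3) by (auto simp: v_def qQ)
    show "u x0 < v x0" using r \<sigma>(1) by (simp add: v_def qQ Q_def)
    show "viscosity_subsolution p b f \<Omega> v"
    proof (rule viscosity_subsolutionI[OF cv])
      fix x \<phi> G' H' assume x: "x \<in> \<Omega>" and C': "C2_data \<Omega> \<phi> G' H'" and max: "local_max_at (\<lambda>x. v x - \<phi> x) x"
      show "f x + b * norm (G' x) powr p \<le> monge_ampere (H' x)"
      proof (cases "v x = u x")
        case True
        have "u y \<le> v y" for y by (simp add: v_def)
        then have "local_max_at (\<lambda>x. u x - \<phi> x) x"
          using max True unfolding local_max_at_def by (auto elim!: eventually_mono intro: order_trans[OF diff_right_mono])
        then show ?thesis by (rule viscosity_subsolutionD[OF sub \<Omega> x C'])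
      next
        case False
        then have xb: "x \<in> ball x0 r" and vq: "v x = q x" by (auto simp: v_def max_def split: if_splits)
        have "\<forall>\<^sub>F y in nhds x. y \<in> ball x0 r" using xb by (intro eventually_nhds_in_open) auto
        then have m: "local_max_at (\<lambda>x. q x - \<phi> x) x"
          using max unfolding local_max_at_def
        proof eventually_elim
          case (elim y)
          then show ?case using vq by (simp add: v_def)
        qed
        have "f x + b * norm (g x) powr p \<le> monge_ampere X" using in_ball[OF xb] by simp
        also have "\<dots> \<le> monge_ampere (H' x)"
          by (rule monge_ampere_mono[OF X(1) C2_data_hessian_symmetric[OF C' \<Omega> x] C2_data_touching(2)[OF Cq C' \<Omega> x m]])
        finally show ?thesis using C2_data_touching(1)[OF Cq C' \<Omega> x m] by simp
      qed
    qed
  qed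
qed

text \<open>A frontier point is missed by some defining ball and, as a limit of points of that ball,
  lies on its sphere. Hence every frontier point carries a paraboloid that vanishes there.\<close>

lemma boundary_touching_ball:
  fixes \<Omega> :: "'a::metric_space set"
  assumes "\<Omega> = (\<Inter>y\<in>Y. ball y R)" "open \<Omega>" "z \<in> frontier \<Omega>"
  obtains y where "y \<in> Y" "\<Omega> \<subseteq> ball y R" "dist y z = R"
proof -
  have "z \<notin> \<Omega>" "z \<in> closure \<Omega>" using assms(2,3) by (auto simp: frontier_def interior_open)
  then obtain y where y: "y \<in> Y" "\<not> dist y z < R" using assms(1) by auto
  have "\<Omega> \<subseteq> ball y R" using assms(1) y by auto
  then have "closure \<Omega> \<subseteq> cball y R" by (meson ball_subset_cball closed_cball closure_minimal order_trans)
  then have "dist y z \<le> R" using \<open>z \<in> closure \<Omega>\<close> by auto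
  with y \<open>\<Omega> \<subseteq> ball y R\<close> show ?thesis by (intro that[of y]) auto
qed

theorem dirichlet_solution_exists:
  fixes \<Omega> :: "(real^'n) set"
  assumes p: "0 < p" "p < 1" and b: "0 < b" and \<Omega>: "open \<Omega>" "bounded \<Omega>" "\<Omega> \<noteq> {}" and uc: "uniformly_convex_set \<Omega>"
    and f: "continuous_on \<Omega> f" and fpos: "\<And>x. x \<in> \<Omega> \<Longrightarrow> f x > 0" and fM: "\<And>x. x \<in> \<Omega> \<Longrightarrow> f x \<le> M"
  shows "\<exists>u. dirichlet_solution p b f \<Omega> u"
proof -
  obtain R Y where R: "R > 0" and Y: "\<Omega> = (\<Inter>y\<in>Y. ball y R)"
    using uc unfolding uniformly_convex_set_def by blast
  have convex: "convex \<Omega>" unfolding Y by (intro convex_INT) auto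
  have "Y \<noteq> {}" using Y \<Omega>(2) not_bounded_UNIV by auto
  then obtain y0 where y0: "y0 \<in> Y" by blast
  obtain K where K: "K > 0" "M + b * (2 * K * R) powr p \<le> 2 * K"
    using exists_paraboloid_constant[OF p b R] by metis
  define w where "w y x = K * ((x - y) \<bullet> (x - y) - R\<^sup>2)" for y x :: "real^'n"
  define F where "F = {v. viscosity_subsolution p b f \<Omega> v \<and> (\<forall>x\<in>\<Omega>. v x \<le> 0)}"
  have wF: "w y \<in> F" if y: "y \<in> Y" for y
  proof -
    have s: "\<Omega> \<subseteq> ball y R" using Y y by auto
    have "f x + b * (2 * K * R) powr p \<le> 2 * K" if "x \<in> \<Omega>" for x using fM[OF that] K(2) by linarith
    then have "viscosity_subsolution p b f \<Omega> (w y)"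
      unfolding w_def[abs_def] by (rule paraboloid_subsolution[OF \<Omega>(1) convex K(1) p(1) b s])
    moreover have "w y x \<le> 0" if "x \<in> \<Omega>" for x
    proof -
      have "norm (x - y) < R" using s that by (auto simp: dist_norm norm_minus_commute)
      then have "(norm (x - y))\<^sup>2 \<le> R\<^sup>2" by (intro power_mono) auto
      then show ?thesis using K by (simp add: w_def power2_norm_eq_inner mult_nonneg_nonpos)
    qed
    ultimately show ?thesis by (simp add: F_def)
  qed
  have ne: "F \<noteq> {}" using wF[OF y0] by blast
  have bdd: "bdd_above ((\<lambda>v. v x) ` F)" if "x \<in> \<Omega>" for x
    using that by (intro bdd_aboveI[of _ 0]) (auto simp: F_def)
  define u where "u x = (if x \<in> \<Omega> then (SUP v\<in>F. v x) else 0)" for x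
  have ule: "v x \<le> u x" if "v \<in> F" "x \<in> \<Omega>" for v x
    using that bdd by (auto simp: u_def intro!: cSUP_upper)
  have uneg: "u x \<le> 0" for x
    using ne by (auto simp: u_def F_def intro!: cSUP_least)
  have sub: "viscosity_subsolution p b f \<Omega> u"
    by (rule viscosity_subsolution_Sup[OF \<Omega>(1) f p(1) ne _ bdd]) (auto simp: F_def u_def)
  have cu: "convex_on \<Omega> u" using sub by (simp add: viscosity_subsolution_def)
  have sup: "viscosity_supersolution p b f \<Omega> u"
  proof (rule viscosity_supersolutionI[OF cu], rule ccontr)
    fix x \<psi> G H assume x: "x \<in> \<Omega>" and C: "C2_data \<Omega> \<psi> G H" "local_min_at (\<lambda>x. u x - \<psi> x) x" "nonneg_sym (H x)"
      and "\<not> monge_ampere (H x) \<le> f x + b * norm (G x) powr p"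
    then have "f x + b * norm (G x) powr p < monge_ampere (H x)" by simp
    from Perron_bump[OF \<Omega>(1) f fpos p(1) b sub uneg x C this] obtain v where
      v: "viscosity_subsolution p b f \<Omega> v" "\<And>x. x \<in> \<Omega> \<Longrightarrow> v x \<le> 0" "u x < v x" by metis
    then have "v \<in> F" by (simp add: F_def)
    from ule[OF this x] v(3) show False by simp
  qed
  have cont: "continuous_on (closure \<Omega>) u"
    unfolding continuous_on_def
  proof
    fix x assume x: "x \<in> closure \<Omega>"
    show "(u \<longlongrightarrow> u x) (at x within closure \<Omega>)"
    proof (cases "x \<in> \<Omega>")
      case True
      have "continuous_on \<Omega> u" by (rule convex_on_continuous[OF \<Omega>(1) cu])
      then have "(u \<longlongrightarrow> u x) (at x)"
        using True continuous_on_eq_continuous_at[OF \<Omega>(1)] isCont_def by blast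
      then show ?thesis by (rule tendsto_within_subset) simp
    next
      case False
      then have "x \<in> frontier \<Omega>" using x \<Omega>(1) by (simp add: frontier_def interior_open)
      then obtain y where y: "y \<in> Y" "\<Omega> \<subseteq> ball y R" "dist y x = R"
        by (rule boundary_touching_ball[OF Y \<Omega>(1)]) (rule that)
      have "w y x = 0" using y(3) by (simp add: w_def dist_norm norm_minus_commute[of y] power2_norm_eq_inner[symmetric])
      moreover have "(w y \<longlongrightarrow> w y x) (at x within closure \<Omega>)"
        unfolding w_def[abs_def] by (intro tendsto_intros)
      ultimately have lim: "((\<lambda>z. \<bar>w y z\<bar>) \<longlongrightarrow> 0) (at x within closure \<Omega>)"
        using tendsto_rabs by fastforce
      \<comment> \<open>Inside \<open>\<Omega>\<close>, \<open>u\<close> is squeezed between the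
        competitor \<open>w y\<close> and \<open>0\<close>, and \<open>w y\<close> vanishes at the
        boundary point \<open>x\<close>.\<close>
      have "norm (u z) \<le> \<bar>w y z\<bar>" for z
        using uneg[of z] ule[OF wF[OF y(1)], of z] by (cases "z \<in> \<Omega>") (auto simp: u_def)
      then have "(u \<longlongrightarrow> 0) (at x within closure \<Omega>)"
        by (intro Lim_null_comparison[OF always_eventually lim]) simp
      then show ?thesis using False by (simp add: u_def)
    qed
  qed
  have "dirichlet_solution p b f \<Omega> u"
    unfolding dirichlet_solution_def using cont sub sup \<Omega>(1) by (auto simp: u_def frontier_def interior_open)
  then show ?thesis by blast
qed

subsection \<open>Uniqueness: the comparison principle\<close>

lemma C2_data_scaled_sqdist:
  "C2_data S (\<lambda>x. K * ((x - c) \<bullet> (x - c))) (\<lambda>x. (2 * K) *\<^sub>R (x - c)) (\<lambda>x. (2 * K) *\<^sub>R (mat 1 :: real^'n^'n))"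
  by (rule C2_data_cong[OF C2_data_sqdist[of S 0 c K]]) (simp_all add: scaleR_matrix_vector_assoc[symmetric])

text \<open>Penalised maxima with \<open>a = 1, 2, ...\<close> exist by compactness. As their values
  stay above \<open>w x0 - v x0 > 0\<close>, a cluster point is on the diagonal with
  \<open>v < w\<close>, hence not on the frontier. Far along the subsequence both points are
  interior and \<open>f\<close> nearly agrees at them.\<close>

lemma doubling_maximum:
  fixes \<Omega> :: "(real^'n) set" and f w v :: "real^'n \<Rightarrow> real"
  assumes \<Omega>: "open \<Omega>" "bounded \<Omega>" and f: "continuous_on \<Omega> f" and \<delta>: "\<delta> > 0"
    and w: "continuous_on (closure \<Omega>) w" and v: "continuous_on (closure \<Omega>) v"
    and bd: "\<And>x. x \<in> frontier \<Omega> \<Longrightarrow> w x \<le> v x" and x0: "x0 \<in> \<Omega>" "v x0 < w x0"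
  obtains a x1 y1 where "a > 0" "x1 \<in> \<Omega>" "y1 \<in> \<Omega>" "\<bar>f x1 - f y1\<bar> < \<delta>"
    "\<And>x y. x \<in> \<Omega> \<Longrightarrow> y \<in> \<Omega> \<Longrightarrow>
      w x - v y - a / 2 * ((x - y) \<bullet> (x - y)) \<le> w x1 - v y1 - a / 2 * ((x1 - y1) \<bullet> (x1 - y1))"
proof -
  let ?K = "closure \<Omega>"
  have K: "compact ?K" using \<Omega>(2) by simp
  have sub: "\<Omega> \<subseteq> ?K" by (rule closure_subset)
  define \<Phi> where "\<Phi> n z = w (fst z) - v (snd z) - real (Suc n) / 2 * ((fst z - snd z) \<bullet> (fst z - snd z))"
    for n and z :: "(real^'n) \<times> (real^'n)"
  have "continuous_on (?K \<times> ?K) (\<Phi> n)" for n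
    unfolding \<Phi>_def[abs_def]
    by (intro continuous_intros continuous_on_compose2[OF w] continuous_on_compose2[OF v]) auto
  then have "\<exists>z\<in>?K \<times> ?K. \<forall>z'\<in>?K \<times> ?K. \<Phi> n z' \<le> \<Phi> n z" for n
    using K x0 sub by (intro continuous_attains_sup compact_Times) auto
  then obtain Z where Z: "\<And>n. Z n \<in> ?K \<times> ?K" "\<And>n z'. z' \<in> ?K \<times> ?K \<Longrightarrow> \<Phi> n z' \<le> \<Phi> n (Z n)"
    by metis
  have ge: "w x0 - v x0 \<le> \<Phi> n (Z n)" for n
    using Z(2)[of "(x0, x0)" n] x0 sub by (auto simp: \<Phi>_def)
  obtain z s where zs: "z \<in> ?K \<times> ?K" "strict_mono (s :: nat \<Rightarrow> nat)" "(Z \<circ> s) \<longlonglongrightarrow> z"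
    using compact_Times[OF K K] Z(1) unfolding compact_def by metis
  have lim1: "(\<lambda>n. fst (Z (s n))) \<longlonglongrightarrow> fst z" and lim2: "(\<lambda>n. snd (Z (s n))) \<longlonglongrightarrow> snd z"
    using tendsto_fst[OF zs(3)] tendsto_snd[OF zs(3)] by (simp_all add: o_def)
  have zK: "fst z \<in> ?K" "snd z \<in> ?K" using zs(1) by auto
  have ZK: "fst (Z n) \<in> ?K" "snd (Z n) \<in> ?K" for n using Z(1)[of n] by auto
  have wl: "(\<lambda>n. w (fst (Z (s n)))) \<longlonglongrightarrow> w (fst z)"
    by (rule continuous_on_tendsto_compose[OF w lim1 zK(1)]) (simp add: ZK)
  have vl: "(\<lambda>n. v (snd (Z (s n)))) \<longlonglongrightarrow> v (snd z)"
    by (rule continuous_on_tendsto_compose[OF v lim2 zK(2)]) (simp add: ZK)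
  have diff: "(\<lambda>n. w (fst (Z (s n))) - v (snd (Z (s n)))) \<longlonglongrightarrow> w (fst z) - v (snd z)"
    by (intro tendsto_diff wl vl)
  have eq: "fst z = snd z"
  proof (rule ccontr)
    assume "fst z \<noteq> snd z"
    define D where "D n = (fst (Z (s n)) - snd (Z (s n))) \<bullet> (fst (Z (s n)) - snd (Z (s n)))" for n
    have "D \<longlonglongrightarrow> (fst z - snd z) \<bullet> (fst z - snd z)"
      unfolding D_def[abs_def] by (intro tendsto_intros lim1 lim2)
    moreover have "(\<lambda>n. 2 * (w (fst (Z (s n))) - v (snd (Z (s n))) - (w x0 - v x0)) * inverse (real (Suc n))) \<longlonglongrightarrow>
        2 * (w (fst z) - v (snd z) - (w x0 - v x0)) * 0"
      by (intro tendsto_mult tendsto_diff diff tendsto_const LIMSEQ_inverse_real_of_nat)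
    moreover have "D n \<le> 2 * (w (fst (Z (s n))) - v (snd (Z (s n))) - (w x0 - v x0)) * inverse (real (Suc n))" for n
    proof -
      have D0: "D n \<ge> 0" by (simp add: D_def)
      \<comment> \<open>A strictly increasing \<open>s\<close> satisfies \<open>n \<le> s n\<close>,
        so the penalty forces \<open>D n\<close> to be of order \<open>1 / n\<close>.\<close>
      have "real (Suc n) * D n \<le> real (Suc (s n)) * D n"
        using seq_suble[OF zs(2), of n] D0 by (intro mult_right_mono) auto
      also have "\<dots> \<le> 2 * (w (fst (Z (s n))) - v (snd (Z (s n))) - (w x0 - v x0))"
        using ge[of "s n"] by (simp add: \<Phi>_def D_def field_simps)
      finally show ?thesis by (simp add: field_simps)
    qed
    ultimately have "(fst z - snd z) \<bullet> (fst z - snd z) \<le> 2 * (w (fst z) - v (snd z) - (w x0 - v x0)) * 0"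
      by (intro LIMSEQ_le) auto
    then have "(fst z - snd z) \<bullet> (fst z - snd z) \<le> 0" by (simp only: mult_zero_right)
    then show False using \<open>fst z \<noteq> snd z\<close>
      by (metis eq_iff_diff_eq_0 inner_gt_zero_iff not_less)
  qed
  have "w x0 - v x0 \<le> w (fst (Z n)) - v (snd (Z n))" for n
  proof -
    have "0 \<le> real (Suc n) / 2 * ((fst (Z n) - snd (Z n)) \<bullet> (fst (Z n) - snd (Z n)))" by simp
    then show ?thesis using ge[of n] unfolding \<Phi>_def by linarith
  qed
  then have "w x0 - v x0 \<le> w (fst z) - v (snd z)"
    by (intro LIMSEQ_le_const[OF diff]) auto
  then have "v (fst z) < w (fst z)" using x0 eq by simp
  then have z\<Omega>: "fst z \<in> \<Omega>" using bd[of "fst z"] zK \<Omega>(1) by (force simp: frontier_def interior_open)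
  have fc: "isCont f (fst z)" using f z\<Omega> \<Omega>(1) by (simp add: continuous_on_eq_continuous_at)
  have "(\<lambda>n. f (fst (Z (s n))) - f (snd (Z (s n)))) \<longlonglongrightarrow> f (fst z) - f (fst z)"
  proof (rule tendsto_diff)
    show "(\<lambda>n. f (fst (Z (s n)))) \<longlonglongrightarrow> f (fst z)" by (rule isCont_tendsto_compose[OF fc lim1])
    show "(\<lambda>n. f (snd (Z (s n)))) \<longlonglongrightarrow> f (fst z)" by (rule isCont_tendsto_compose[OF fc lim2[folded eq]])
  qed
  then have "(\<lambda>n. \<bar>f (fst (Z (s n))) - f (snd (Z (s n)))\<bar>) \<longlonglongrightarrow> 0"
    using tendsto_rabs by fastforce
  then have "\<forall>\<^sub>F n in sequentially. \<bar>f (fst (Z (s n))) - f (snd (Z (s n)))\<bar> < \<delta>"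
    using \<delta> by (rule order_tendstoD(2))
  moreover have "\<forall>\<^sub>F n in sequentially. fst (Z (s n)) \<in> \<Omega>"
    using topological_tendstoD[OF lim1 \<Omega>(1) z\<Omega>] .
  moreover have "\<forall>\<^sub>F n in sequentially. snd (Z (s n)) \<in> \<Omega>"
    using topological_tendstoD[OF lim2 \<Omega>(1)] z\<Omega> eq by simp
  ultimately have "\<forall>\<^sub>F n in sequentially. \<bar>f (fst (Z (s n))) - f (snd (Z (s n)))\<bar> < \<delta> \<and> fst (Z (s n)) \<in> \<Omega> \<and> snd (Z (s n)) \<in> \<Omega>"
    by eventually_elim blast
  then obtain n where n: "\<bar>f (fst (Z (s n))) - f (snd (Z (s n)))\<bar> < \<delta>" "fst (Z (s n)) \<in> \<Omega>" "snd (Z (s n)) \<in> \<Omega>"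
    using eventually_happens by force
  show ?thesis
  proof (rule that[OF _ n(2,3,1)])
    show "real (Suc (s n)) > 0" by simp
    fix x y assume "x \<in> \<Omega>" "y \<in> \<Omega>"
    then have "(x, y) \<in> ?K \<times> ?K" using sub by blast
    from Z(2)[OF this, of "s n"]
    show "w x - v y - real (Suc (s n)) / 2 * ((x - y) \<bullet> (x - y)) \<le> w (fst (Z (s n))) - v (snd (Z (s n)))
       - real (Suc (s n)) / 2 * ((fst (Z (s n)) - snd (Z (s n))) \<bullet> (fst (Z (s n)) - snd (Z (s n))))"
      by (simp only: \<Phi>_def fst_conv snd_conv)
  qed
qed

text \<open>\<open>G x\<close> is a subgradient of \<open>w\<close> at \<open>x\<close>. A step of
  length \<open>r\<close> in the direction of \<open>G x - q\<close> makes \<open>w\<close> rise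
  above the plane with slope \<open>q\<close> by \<open>r\<close> times \<open>|G x - q|\<close> at
  least, while the paraboloid caps the rise by \<open>a / 2 * (2 r)^2\<close>. The gradient term of
  the equation is thus nearly constant around \<open>x1\<close>.\<close>

lemma convex_gradient_stability:
  fixes w :: "real^'n \<Rightarrow> real"
  assumes conv: "convex_on \<Omega> w" and \<Omega>: "open \<Omega>" and a: "a > 0" and r: "r > 0" "ball x1 (2 * r) \<subseteq> \<Omega>"
    and up: "\<And>x. x \<in> \<Omega> \<Longrightarrow> w x \<le> w x1 + q \<bullet> (x - x1) + a / 2 * ((x - x1) \<bullet> (x - x1))"
    and x: "x \<in> ball x1 r" and C: "C2_data \<Omega> \<psi> G H" and max: "local_max_at (\<lambda>y. w y - \<psi> y) x"
  shows "norm (G x - q) \<le> 2 * a * r"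
proof (cases "G x = q")
  case False
  have x1: "x1 \<in> \<Omega>" "x \<in> \<Omega>" using r x by (auto simp: subset_eq)
  define \<phi> where "\<phi> y = 0 + q \<bullet> (y - x1) + quad (a *\<^sub>R mat 1 :: real^'n^'n) (y - x1) / 2" for y
  have C\<phi>: "C2_data \<Omega> \<phi> (\<lambda>y. q + (a *\<^sub>R mat 1) *v (y - x1)) (\<lambda>y. a *\<^sub>R mat 1)"
    unfolding \<phi>_def[abs_def] by (rule C2_data_quadratic) (simp add: vec_eq_iff transpose_def mat_def)
  have "local_max_at (\<lambda>y. w y - \<phi> y) x1"
    unfolding local_max_at_def eventually_nhds
  proof (intro exI[of _ \<Omega>] conjI ballI \<Omega> x1)
    fix y assume "y \<in> \<Omega>"
    from up[OF this] show "w y - \<phi> y \<le> w x1 - \<phi> x1"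
      by (simp add: \<phi>_def scaleR_matrix_vector_assoc[symmetric])
  qed
  note g1 = convex_touched_above(2)[OF conv C\<phi> \<Omega> x1(1) this]
  note g2 = convex_touched_above(2)[OF conv C \<Omega> x1(2) max]
  define d where "d = G x - q"
  have d: "norm d > 0" using False by (simp add: d_def)
  define y where "y = x + (r / norm d) *\<^sub>R d"
  have yx: "norm (y - x) = r" using r d by (simp add: y_def)
  have "norm (y - x1) \<le> norm (y - x) + norm (x - x1)" using norm_triangle_ineq[of "y - x" "x - x1"] by simp
  then have yn: "norm (y - x1) < 2 * r" using yx x by (simp add: dist_norm norm_minus_commute)
  then have y: "y \<in> \<Omega>" using r(2) by (auto simp: dist_norm norm_minus_commute)
  have "(y - x1) \<bullet> (y - x1) \<le> (2 * r)\<^sup>2"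
    using yn unfolding power2_norm_eq_inner[symmetric] by (intro power_mono) auto
  then have "a / 2 * ((y - x1) \<bullet> (y - x1)) \<le> a / 2 * (2 * r)\<^sup>2" using a by (intro mult_left_mono) auto
  then have sq: "a / 2 * ((y - x1) \<bullet> (y - x1)) \<le> 2 * a * r\<^sup>2" by (simp add: power2_eq_square)
  have l: "w x1 + (x - x1) \<bullet> q \<le> w x" using g1[OF x1(2)] by simp
  have "(y - x) \<bullet> d \<le> a / 2 * ((y - x1) \<bullet> (y - x1))"
    using up[OF y] g2[OF y] l
    by (simp add: d_def inner_diff_left inner_diff_right inner_commute)
  moreover have "(y - x) \<bullet> d = r * norm d"
    using d by (simp add: y_def power2_norm_eq_inner[symmetric] power2_eq_square)
  ultimately have "r * norm d \<le> 2 * a * r\<^sup>2" using sq by linarith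
  then have "r * norm d \<le> r * (2 * a * r)" by (simp add: power2_eq_square mult_ac)
  then show ?thesis using r(1) by (simp add: d_def)
qed (use a r in simp)

text \<open>The nearest-point projection onto the ball extends \<open>w\<close>; the cutoff factor
  is one on the ball and zero from distance one on.\<close>

lemma continuous_extension_compact_support:
  fixes w :: "'a::euclidean_space \<Rightarrow> real"
  assumes w: "continuous_on (cball c r) w" and r: "r \<ge> 0"
  obtains w' L where "continuous_on UNIV w'" "\<And>x. x \<in> cball c r \<Longrightarrow> w' x = w x" "\<And>x. L \<le> norm x \<Longrightarrow> w' x = 0"
proof (rule that)
  let ?w = "\<lambda>x. w (closest_point (cball c r) x) * max 0 (min 1 (1 + r - dist x c))"
  show "continuous_on UNIV ?w"
    using r by (intro continuous_intros continuous_on_compose2[OF w continuous_on_closest_point])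
      (auto intro!: closest_point_in_set[THEN subsetD[OF subset_refl]] closest_point_in_set)
  show "?w x = w x" if "x \<in> cball c r" for x
    using that by (simp add: closest_point_self dist_commute)
  show "?w x = 0" if "norm c + r + 1 \<le> norm x" for x
  proof -
    have "norm x \<le> dist x c + norm c" using norm_triangle_sub[of x c] by (simp add: dist_norm)
    then show ?thesis using that by simp
  qed
qed

text \<open>The bound by \<open>c\<close> is unfolded into linear inequalities for all
  \<open>P\<close> with \<open>|det P| = 1\<close>, each of which passes to the same mollification,
  and is then folded back by \<open>monge_ampere_geI\<close>.\<close>

lemma smooth_subsolution_approximation:
  fixes w :: "real^'n \<Rightarrow> real"
  assumes w: "continuous_on (cball x1 (3 * r)) w" and r: "r > 0" and c: "c > 0" and e: "e > 0"
    and sub: "\<And>x \<psi> G H. \<lbrakk>x \<in> ball x1 (3 * r); C2_data UNIV \<psi> G H; local_max_at (\<lambda>y. w y - \<psi> y) x\<rbrakk>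
      \<Longrightarrow> nonneg_sym (H x) \<and> c \<le> monge_ampere (H x)"
  obtains W G H where "C2_data UNIV W G H" "\<And>x. x \<in> cball x1 r \<Longrightarrow> \<bar>W x - w x\<bar> \<le> e"
    "\<And>x. x \<in> cball x1 r \<Longrightarrow> nonneg_sym (H x) \<and> c \<le> monge_ampere (H x)"
proof -
  obtain w' L where w': "continuous_on UNIV w'" "\<And>x. x \<in> cball x1 (3 * r) \<Longrightarrow> w' x = w x" "\<And>x. L \<le> norm x \<Longrightarrow> w' x = 0"
    using continuous_extension_compact_support[OF w] r by (metis mult_nonneg_nonneg less_imp_le zero_le_numeral)
  obtain d where d: "d > 0" "\<And>x y. dist y x < d \<Longrightarrow> dist (w' y) (w' x) < e"
    using uniformly_continuous_compact_support[OF w'(1,3)] e unfolding uniformly_continuous_on_def by (metis UNIV_I)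
  \<comment> \<open>With \<open>\<delta> \<le> r / 2\<close> the balls of radius
    \<open>3 * \<delta>\<close> around points of \<open>cball x1 r\<close> stay inside
    \<open>ball x1 (3 * r)\<close>.\<close>
  define \<delta> where "\<delta> = min d (r / 2)"
  have \<delta>: "\<delta> > 0" "\<delta> \<le> d" "\<delta> \<le> r / 2" using d r by (auto simp: \<delta>_def)
  obtain \<rho> G\<rho> H\<rho> where \<rho>: "C2_data (UNIV :: (real^'n) set) \<rho> G\<rho> H\<rho>" "\<And>z. 0 \<le> \<rho> z"
    "\<And>z. \<delta> \<le> norm z \<Longrightarrow> \<rho> z = 0 \<and> G\<rho> z = 0 \<and> H\<rho> z = 0" "avg \<delta> \<rho> = 1"
    by (rule exists_mollifier[OF \<delta>(1)]) (rule that)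
  have zero: "\<And>z. \<delta> \<le> norm z \<Longrightarrow> \<rho> z = 0" using \<rho>(3) by blast
  note \<rho>c = C2_data_continuous(1)[OF \<rho>(1)]
  define W where "W x = avg \<delta> (\<lambda>z. \<rho> z * w' (x - z))" for x
  obtain G H where C0: "C2_data UNIV (\<lambda>x. avg \<delta> (\<lambda>z. \<rho> z * w' (x - z))) G H"
    and uc: "uniformly_continuous_on UNIV H"
    and supp: "\<And>x. L + \<delta> \<le> norm x \<Longrightarrow> H x = 0"
    by (rule smooth_convolution[where r=\<delta> and L=L, OF \<rho>(1,3) w'(1,3)], assumption, assumption, rule that)
  note C = C0[folded W_def]
  show ?thesis
  proof (rule that[OF C])
    fix x assume x: "x \<in> cball x1 r"
    have "x \<in> cball x1 (3 * r)" using x r by simp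
    have "\<bar>W x - w' x\<bar> \<le> e"
      unfolding W_def
    proof (rule mollifier_average_bound[OF \<rho>c \<rho>(2) zero \<rho>(4) continuous_translated_reflection[OF w'(1)]])
      fix z :: "real^'n" assume "norm z < \<delta>"
      then show "\<bar>w' (x - z) - w' x\<bar> \<le> e" using d(2)[of "x - z" x] \<delta> by (simp add: dist_norm)
    qed
    then show "\<bar>W x - w x\<bar> \<le> e" using w'(2)[OF \<open>x \<in> cball x1 (3 * r)\<close>] by simp
    have sym: "transpose (H x) = H x" by (rule C2_data_hessian_symmetric[OF C open_UNIV UNIV_I])
    have lin: "real CARD('n) * c \<le> quad_sum P (H x)" if P: "\<bar>det P\<bar> = 1" for P :: "real^'n^'n"
    proof (rule mollified_subsolution[OF \<delta>(1) _ \<rho>c \<rho>(2) zero \<rho>(4) w'(1,3) _ C0 uc supp])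
      show "0 \<le> real CARD('n) * c" using c by simp
      show "x \<in> cball x \<delta>" using \<delta> by simp
      fix y \<psi> G' H' assume y: "y \<in> ball x (3 * \<delta>)" and C': "C2_data UNIV \<psi> G' H'" and max: "local_max_at (\<lambda>y. w' y - \<psi> y) y"
      have "dist x1 y \<le> dist x1 x + dist x y" by (rule dist_triangle)
      then have yb: "y \<in> ball x1 (3 * r)" using y x \<delta> by simp
      have "\<forall>\<^sub>F z in nhds y. z \<in> ball x1 (3 * r)" using yb by (intro eventually_nhds_in_open) auto
      then have "local_max_at (\<lambda>y. w y - \<psi> y) y"
        using max unfolding local_max_at_def
      proof eventually_elim
        case (elim z)
        then show ?case using w'(2)[of z] w'(2)[of y] yb by (simp add: less_imp_le)
      qed
      from sub[OF yb C' this] have F: "nonneg_sym (H' y)" "c \<le> monge_ampere (H' y)" by auto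
      have "real CARD('n) * c \<le> real CARD('n) * monge_ampere (H' y)" using F by (intro mult_left_mono) auto
      also have "\<dots> \<le> quad_sum P (H' y)" by (rule monge_ampere_le_congruence[OF F(1) P])
      finally show "real CARD('n) * c \<le> quad_sum P (H' y)" .
    qed
    show "nonneg_sym (H x) \<and> c \<le> monge_ampere (H x)"
      using monge_ampere_geI[OF sym c lin] by blast
  qed
qed


lemma norm_powr_continuity:
  fixes q :: "'a::real_normed_vector"
  assumes p: "p > 0" and e: "e > 0"
  obtains s where "s > 0" "\<And>g. norm (g - q) \<le> s \<Longrightarrow> \<bar>b * norm g powr p - b * norm q powr p\<bar> \<le> e"
proof -
  have "continuous_on UNIV (\<lambda>g :: 'a. b * norm g powr p)"
    using p by (intro continuous_intros continuous_on_powr') auto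
  then obtain d where d: "d > 0" "\<And>g. dist g q < d \<Longrightarrow> dist (b * norm g powr p) (b * norm q powr p) < e"
    using e unfolding continuous_on_iff by (metis UNIV_I)
  show ?thesis
  proof (rule that[of "d / 2"])
    fix g assume "norm (g - q) \<le> d / 2"
    then have "dist g q < d" using d(1) by (simp add: dist_norm)
    from d(2)[OF this] show "\<bar>b * norm g powr p - b * norm q powr p\<bar> \<le> e" by (simp add: dist_real_def)
  qed (use d in simp)
qed

lemma open_continuous_ball:
  fixes \<Omega> :: "'a::metric_space set" and f :: "'a \<Rightarrow> real"
  assumes "open \<Omega>" "continuous_on \<Omega> f" "x \<in> \<Omega>" "e > 0"
  obtains s where "s > 0" "ball x s \<subseteq> \<Omega>" "\<And>y. y \<in> ball x s \<Longrightarrow> \<bar>f y - f x\<bar> \<le> e"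
proof -
  obtain d1 where d1: "d1 > 0" "ball x d1 \<subseteq> \<Omega>" using assms openE by blast
  obtain d2 where d2: "d2 > 0" "\<And>y. y \<in> \<Omega> \<Longrightarrow> dist y x < d2 \<Longrightarrow> dist (f y) (f x) < e"
    using assms(2-4) unfolding continuous_on_iff by metis
  show ?thesis
  proof (rule that[of "min d1 d2"])
    fix y assume y: "y \<in> ball x (min d1 d2)"
    then have "y \<in> \<Omega>" using d1(2) by auto
    from d2(2)[OF this] y show "\<bar>f y - f x\<bar> \<le> e" by (simp add: dist_commute dist_real_def)
  qed (use d1 d2 in auto)
qed

text \<open>After doubling, \<open>w\<close> is replaced near \<open>xh\<close> by a
  \<open>C^2\<close> function \<open>W\<close>, and the doubled function is maximised again over a
  product of small balls, with penalties of weight \<open>k\<close>. Along the pairs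
  \<open>(y + h, y)\<close> the coupling term is constant, so \<open>W (y + h)\<close> minus the
  penalties touches \<open>v\<close> from below, up to a constant.\<close>

lemma strict_comparison:
  fixes \<Omega> :: "(real^'n) set"
  assumes \<Omega>: "open \<Omega>" "bounded \<Omega>" and f: "continuous_on \<Omega> f" and fpos: "\<And>x. x \<in> \<Omega> \<Longrightarrow> f x > 0"
    and p: "p > 0" and b: "b > 0" and \<delta>: "\<delta> > 0"
    and w: "continuous_on (closure \<Omega>) w" "convex_on \<Omega> w"
    and strict: "\<And>x \<psi> G H. \<lbrakk>x \<in> \<Omega>; C2_data \<Omega> \<psi> G H; local_max_at (\<lambda>y. w y - \<psi> y) x\<rbrakk>
      \<Longrightarrow> f x + b * norm (G x) powr p + \<delta> \<le> monge_ampere (H x)"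
    and v: "continuous_on (closure \<Omega>) v" "viscosity_supersolution p b f \<Omega> v"
    and bd: "\<And>x. x \<in> frontier \<Omega> \<Longrightarrow> w x \<le> v x" and x0: "x0 \<in> \<Omega>"
  shows "w x0 \<le> v x0"
proof (rule ccontr)
  assume "\<not> w x0 \<le> v x0"
  then have "v x0 < w x0" by simp
  moreover have "\<delta> / 4 > 0" using \<delta> by simp
  ultimately obtain a xh yh where a: "a > 0" and xh: "xh \<in> \<Omega>" and yh: "yh \<in> \<Omega>" and fxy: "\<bar>f xh - f yh\<bar> < \<delta> / 4"
    and max: "\<And>x y. x \<in> \<Omega> \<Longrightarrow> y \<in> \<Omega> \<Longrightarrow>
      w x - v y - a / 2 * ((x - y) \<bullet> (x - y)) \<le> w xh - v yh - a / 2 * ((xh - yh) \<bullet> (xh - yh))"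
    using doubling_maximum[OF \<Omega> f _ w(1) v(1) bd x0] by metis
  define q where "q = a *\<^sub>R (xh - yh)"
  have up: "w x \<le> w xh + q \<bullet> (x - xh) + a / 2 * ((x - xh) \<bullet> (x - xh))" if "x \<in> \<Omega>" for x
  proof -
    define s where "s = x - xh"
    define t where "t = xh - yh"
    have st: "x - yh = s + t" by (simp add: s_def t_def)
    then have "w x - a / 2 * ((s + t) \<bullet> (s + t)) \<le> w xh - a / 2 * (t \<bullet> t)"
      using max[OF that yh] unfolding st t_def[symmetric] by linarith
    then show ?thesis
      unfolding q_def s_def[symmetric] t_def[symmetric]
      by (simp add: inner_add_left inner_add_right inner_commute[of s t] distrib_left)
  qed
  \<comment> \<open>A quarter of the slack \<open>\<delta>\<close> is spent on freezing
    \<open>f\<close> and the gradient term near \<open>xh\<close>. The rest goes, a quarter each, to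
    the Hessian shift, to \<open>f xh - f yh\<close> and to freezing at \<open>yh\<close>; the
    strict bound for \<open>f xh - f yh\<close> gives the contradiction.\<close>
  define c where "c = f xh + b * norm q powr p + 3 * \<delta> / 4"
  have c: "c > 0" using fpos[OF xh] b \<delta> by (auto simp: c_def intro!: add_pos_pos add_pos_nonneg)
  have \<delta>8: "\<delta> / 8 > 0" using \<delta> by simp
  obtain s0 where s0: "s0 > 0" "\<And>g :: real^'n. norm (g - q) \<le> s0 \<Longrightarrow> \<bar>b * norm g powr p - b * norm q powr p\<bar> \<le> \<delta> / 8"
    using norm_powr_continuity[OF p \<delta>8, of q b] by blast
  obtain s1 where s1: "s1 > 0" "ball xh s1 \<subseteq> \<Omega>" "\<And>x. x \<in> ball xh s1 \<Longrightarrow> \<bar>f x - f xh\<bar> \<le> \<delta> / 8"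
    using open_continuous_ball[OF \<Omega>(1) f xh \<delta>8] by blast
  obtain s2 where s2: "s2 > 0" "ball yh s2 \<subseteq> \<Omega>" "\<And>x. x \<in> ball yh s2 \<Longrightarrow> \<bar>f x - f yh\<bar> \<le> \<delta> / 8"
    using open_continuous_ball[OF \<Omega>(1) f yh \<delta>8] by blast
  \<comment> \<open>Room for the ball of radius \<open>6 * r\<close> in \<open>\<Omega>\<close>, and
    for a gradient deviation \<open>2 * a * (3 * r)\<close> of at most \<open>s0\<close>.\<close>
  define r where "r = min (s1 / 7) (s0 / (6 * a))"
  have r: "r > 0" "7 * r \<le> s1" "2 * a * (3 * r) \<le> s0"
  proof -
    show "r > 0" using s0 s1 a by (simp add: r_def)
    have "r \<le> s1 / 7" "r \<le> s0 / (6 * a)" by (auto simp: r_def)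
    then show "7 * r \<le> s1" "2 * a * (3 * r) \<le> s0" using a by (auto simp: field_simps)
  qed
  have r\<Omega>: "cball xh (3 * r) \<subseteq> \<Omega>" "ball xh (2 * (3 * r)) \<subseteq> \<Omega>"
    using s1(1,2) r by (auto simp: subset_eq)
  have loc: "nonneg_sym (H x) \<and> c \<le> monge_ampere (H x)"
    if x: "x \<in> ball xh (3 * r)" and C: "C2_data UNIV \<psi> G H" and m: "local_max_at (\<lambda>y. w y - \<psi> y) x" for x \<psi> G H
  proof -
    have x\<Omega>: "x \<in> \<Omega>" using r\<Omega>(1) x by auto
    note C' = C2_data_subset[OF C subset_UNIV, of \<Omega>]
    have "norm (G x - q) \<le> 2 * a * (3 * r)"
      using r by (intro convex_gradient_stability[OF w(2) \<Omega>(1) a _ r\<Omega>(2) up x C' m]) auto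
    then have "\<bar>b * norm (G x) powr p - b * norm q powr p\<bar> \<le> \<delta> / 8" using r(3) by (intro s0(2)) auto
    moreover have "\<bar>f x - f xh\<bar> \<le> \<delta> / 8" using x r by (intro s1(3)) auto
    ultimately have "c \<le> monge_ampere (H x)"
      using strict[OF x\<Omega> C' m] unfolding c_def abs_le_iff by linarith
    then show ?thesis using convex_touched_above_nonneg_sym[OF w(2) C' \<Omega>(1) x\<Omega> m] by simp
  qed
  define M where "M = a + 2"
  have M: "M > 0" using a by (simp add: M_def)
  define \<mu> where "\<mu> = c ^ CARD('n) / M ^ (CARD('n) - 1)"
  have \<mu>: "\<mu> > 0" using c M by (simp add: \<mu>_def)
  \<comment> \<open>The two penalties together shift the Hessian by \<open>4 * k\<close>; the last
    entry limits the resulting loss in the operator to \<open>\<delta> / 4\<close>. The bound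
    \<open>1\<close> keeps \<open>a + 2 * k\<close> below \<open>M\<close>.\<close>
  define k where "k = min 1 (min (\<mu> / 4) (\<mu> * \<delta> / (16 * c)))"
  have k: "k > 0" "k \<le> 1" "4 * k \<le> \<mu>" "c - \<delta> / 4 \<le> (1 - 4 * k / \<mu>) * c"
  proof -
    show "k > 0" "k \<le> 1" using \<mu> \<delta> c by (auto simp: k_def)
    have "k \<le> \<mu> / 4" by (simp add: k_def)
    then show "4 * k \<le> \<mu>" by simp
    have "k \<le> \<mu> * \<delta> / (16 * c)" by (simp add: k_def)
    then have "4 * k / \<mu> * c \<le> \<delta> / 4" using \<mu> c by (simp add: field_simps)
    then show "c - \<delta> / 4 \<le> (1 - 4 * k / \<mu>) * c" by (simp add: algebra_simps)
  qed
  define s where "s = min (min r (s2 / 2)) (s0 / (2 * a + 2))"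
  have s: "s > 0" "s \<le> r" "s < s2" "(2 * a + 2) * s \<le> s0"
  proof -
    have a2: "2 * a + 2 > 0" using a by simp
    show "s > 0" using r s0 s2 a2 by (simp add: s_def)
    show "s \<le> r" by (simp add: s_def)
    have "s \<le> s2 / 2" by (simp only: s_def min_le_iff_disj order_refl simp_thms)
    then show "s < s2" using s2 by simp
    have "s \<le> s0 / (2 * a + 2)" by (simp add: s_def)
    then show "(2 * a + 2) * s \<le> s0" using a2 by (simp add: pos_le_divide_eq mult.commute)
  qed
  \<comment> \<open>Replacing \<open>w\<close> by \<open>W\<close> costs at most
    \<open>2 * e\<close>, less than what the penalties charge at distance \<open>s\<close>; so the
    new maximum is interior.\<close>
  define e where "e = k * s\<^sup>2 / 4"
  have e: "e > 0" "2 * e < k * s\<^sup>2" using k s by (auto simp: e_def)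
  have wc: "continuous_on (cball xh (3 * r)) w"
    using w(1) r\<Omega>(1) closure_subset by (meson continuous_on_subset order_trans)
  obtain W G H where C: "C2_data UNIV W G H" and We: "\<And>x. x \<in> cball xh r \<Longrightarrow> \<bar>W x - w x\<bar> \<le> e"
    and WF: "\<And>x. x \<in> cball xh r \<Longrightarrow> nonneg_sym (H x) \<and> c \<le> monge_ampere (H x)"
    by (rule smooth_subsolution_approximation[OF wc r(1) c e(1)], rule loc, assumption, assumption, assumption, rule that)
  let ?D = "cball xh s \<times> cball yh s"
  define \<Psi> where "\<Psi> x y = W x - v y - a / 2 * ((x - y) \<bullet> (x - y)) - k * ((x - xh) \<bullet> (x - xh)) - k * ((y - yh) \<bullet> (y - yh))" for x y
  have y\<Omega>: "cball yh s \<subseteq> \<Omega>" using s(3) s2(2) by (auto simp: subset_eq)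
  have "continuous_on ?D (\<lambda>z. \<Psi> (fst z) (snd z))"
    unfolding \<Psi>_def
    by (intro continuous_intros continuous_on_compose2[OF C2_data_continuous(1)[OF C]] continuous_on_compose2[OF v(1)])
      (use y\<Omega> closure_subset in auto)
  moreover have "compact ?D" by (intro compact_Times compact_cball)
  moreover have "(xh, yh) \<in> ?D" using s by simp
  ultimately obtain z where z: "z \<in> ?D" "\<And>z'. z' \<in> ?D \<Longrightarrow> \<Psi> (fst z') (snd z') \<le> \<Psi> (fst z) (snd z)"
    using continuous_attains_sup[of ?D "\<lambda>z. \<Psi> (fst z) (snd z)"] by blast
  define x1 where "x1 = fst z"
  define y1 where "y1 = snd z"
  have xy1: "x1 \<in> cball xh s" "y1 \<in> cball yh s" using z(1) by (auto simp: x1_def y1_def)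
  have max1: "\<Psi> x y \<le> \<Psi> x1 y1" if "x \<in> cball xh s" "y \<in> cball yh s" for x y
    using z(2)[of "(x, y)"] that by (simp add: x1_def y1_def)
  have x1\<Omega>: "x1 \<in> \<Omega>" "x1 \<in> cball xh r" using xy1(1) s(2) r\<Omega>(1) r(1) by (auto simp: subset_eq)
  have y1\<Omega>: "y1 \<in> \<Omega>" using xy1(2) y\<Omega> by blast
  have small: "k * ((x1 - xh) \<bullet> (x1 - xh)) + k * ((y1 - yh) \<bullet> (y1 - yh)) < k * s\<^sup>2"
  proof -
    have "\<Psi> xh yh \<le> \<Psi> x1 y1" using s by (intro max1) auto
    then have "W xh - v yh - a / 2 * ((xh - yh) \<bullet> (xh - yh)) \<le> \<Psi> x1 y1" by (simp add: \<Psi>_def)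
    moreover have "xh \<in> cball xh r" using r by simp
    ultimately show ?thesis
      using We[OF x1\<Omega>(2)] We[of xh] max[OF x1\<Omega>(1) y1\<Omega>] e(2) unfolding \<Psi>_def abs_le_iff by linarith
  qed
  have x1s: "norm (x1 - xh) < s" and y1s: "norm (y1 - yh) < s"
  proof -
    have "0 \<le> k * ((x1 - xh) \<bullet> (x1 - xh))" "0 \<le> k * ((y1 - yh) \<bullet> (y1 - yh))" using k by auto
    then have "k * ((x1 - xh) \<bullet> (x1 - xh)) < k * s\<^sup>2" "k * ((y1 - yh) \<bullet> (y1 - yh)) < k * s\<^sup>2" using small by linarith+
    then have "(norm (x1 - xh))\<^sup>2 < s\<^sup>2" "(norm (y1 - yh))\<^sup>2 < s\<^sup>2" using k by (simp_all add: power2_norm_eq_inner)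
    then show "norm (x1 - xh) < s" "norm (y1 - yh) < s" using s by (auto intro: power2_less_imp_less)
  qed
  have Cx: "C2_data UNIV (\<lambda>x. a / 2 * ((x - y1) \<bullet> (x - y1)) + k * ((x - xh) \<bullet> (x - xh)))
      (\<lambda>x. (2 * (a / 2)) *\<^sub>R (x - y1) + (2 * k) *\<^sub>R (x - xh))
      (\<lambda>x. (2 * (a / 2)) *\<^sub>R mat 1 + (2 * k) *\<^sub>R mat 1)"
    by (intro C2_data_add C2_data_scaled_sqdist)
  have mx: "local_max_at (\<lambda>x. W x - (a / 2 * ((x - y1) \<bullet> (x - y1)) + k * ((x - xh) \<bullet> (x - xh)))) x1"
    unfolding local_max_at_def eventually_nhds
  proof (intro exI[of _ "ball xh s"] conjI ballI open_ball)
    show "x1 \<in> ball xh s" using x1s by (simp add: dist_norm norm_minus_commute)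
    fix x assume "x \<in> ball xh s"
    then have "\<Psi> x y1 \<le> \<Psi> x1 y1" using xy1 by (intro max1) auto
    then show "W x - (a / 2 * ((x - y1) \<bullet> (x - y1)) + k * ((x - xh) \<bullet> (x - xh)))
        \<le> W x1 - (a / 2 * ((x1 - y1) \<bullet> (x1 - y1)) + k * ((x1 - xh) \<bullet> (x1 - xh)))"
      unfolding \<Psi>_def by linarith
  qed
  have Gx: "G x1 = a *\<^sub>R (x1 - y1) + (2 * k) *\<^sub>R (x1 - xh)"
    using C2_data_touching(1)[OF C Cx open_UNIV UNIV_I mx] by simp
  \<comment> \<open>Maximality in the first variable alone bounds the Hessian of \<open>W\<close>
    from above; with the bound \<open>c\<close> for the operator it becomes uniformly positive, so
    that the shift by \<open>4 * k\<close> is affordable.\<close>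
  have Hx: "quad (H x1) u \<le> M * (u \<bullet> u)" for u
  proof -
    have "quad (H x1) u \<le> u \<bullet> (((2 * (a / 2)) *\<^sub>R mat 1 + (2 * k) *\<^sub>R mat 1) *v u)"
      by (rule C2_data_touching(2)[OF C Cx open_UNIV UNIV_I mx])
    also have "\<dots> = (a + 2 * k) * (u \<bullet> u)"
      by (simp add: matrix_vector_mult_add_rdistrib scaleR_matrix_vector_assoc[symmetric] inner_add_right distrib_right)
    also have "\<dots> \<le> M * (u \<bullet> u)" using k by (intro mult_right_mono) (auto simp: M_def)
    finally show ?thesis .
  qed
  have HF: "nonneg_sym (H x1)" "c \<le> monge_ampere (H x1)" using WF[OF x1\<Omega>(2)] by auto
  \<comment> \<open>The translation that keeps \<open>x - y\<close> fixed at its value at the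
    maximum.\<close>
  define h where "h = x1 - y1"
  define \<phi> where "\<phi> y = W (y + h) + (- k * ((y - (xh - h)) \<bullet> (y - (xh - h))) + - k * ((y - yh) \<bullet> (y - yh)))" for y
  have C\<phi>: "C2_data \<Omega> \<phi> (\<lambda>y. G (y + h) + ((2 * - k) *\<^sub>R (y - (xh - h)) + (2 * - k) *\<^sub>R (y - yh)))
      (\<lambda>y. H (y + h) + ((2 * - k) *\<^sub>R mat 1 + (2 * - k) *\<^sub>R mat 1))"
    unfolding \<phi>_def[abs_def] by (intro C2_data_add C2_data_scaled_sqdist C2_data_translate[OF C])
  have yh1: "y1 + h = x1" by (simp add: h_def)
  have hess: "H (y1 + h) + ((2 * - k) *\<^sub>R mat 1 + (2 * - k) *\<^sub>R mat 1) = H x1 + (- (4 * k)) *\<^sub>R mat 1"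
    unfolding yh1 scaleR_add_left[symmetric] by simp
  have shift: "nonneg_sym (H x1 + (- (4 * k)) *\<^sub>R mat 1)"
      "(1 - 4 * k / \<mu>) * c \<le> monge_ampere (H x1 + (- (4 * k)) *\<^sub>R mat 1)"
    using monge_ampere_shift_down[OF HF(1) Hx c HF(2) \<mu>_def \<mu> _ k(3)] k(1) by auto
  have my: "local_min_at (\<lambda>y. v y - \<phi> y) y1"
    unfolding local_min_at_def eventually_nhds
  proof (intro exI[of _ "ball yh s \<inter> (\<lambda>y. y + h) -` ball xh s"] conjI ballI)
    show "open (ball yh s \<inter> (\<lambda>y. y + h) -` ball xh s)"
      by (intro open_Int open_ball open_vimage continuous_intros)
    show "y1 \<in> ball yh s \<inter> (\<lambda>y. y + h) -` ball xh s"
      using x1s y1s by (simp add: yh1 dist_norm norm_minus_commute)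
    fix y assume y: "y \<in> ball yh s \<inter> (\<lambda>y. y + h) -` ball xh s"
    then have "\<Psi> (y + h) y \<le> \<Psi> x1 y1" by (intro max1) auto
    moreover have "y + h - y = x1 - y1" "y + h - xh = y - (xh - h)" "x1 - xh = y1 - (xh - h)"
      by (simp_all add: h_def)
    ultimately show "v y1 - \<phi> y1 \<le> v y - \<phi> y"
      unfolding \<Psi>_def \<phi>_def yh1 by simp
  qed
  from viscosity_supersolutionD[OF v(2) \<Omega>(1) y1\<Omega> C\<phi> my] shift(1)
  have sup: "monge_ampere (H x1 + (- (4 * k)) *\<^sub>R mat 1)
      \<le> f y1 + b * norm (G (y1 + h) + ((2 * - k) *\<^sub>R (y1 - (xh - h)) + (2 * - k) *\<^sub>R (y1 - yh))) powr p"
    unfolding hess by blast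
  have grad: "norm (G (y1 + h) + ((2 * - k) *\<^sub>R (y1 - (xh - h)) + (2 * - k) *\<^sub>R (y1 - yh)) - q) \<le> s0"
  proof -
    have "y1 - (xh - h) = x1 - xh" by (simp add: h_def)
    then have "G (y1 + h) + ((2 * - k) *\<^sub>R (y1 - (xh - h)) + (2 * - k) *\<^sub>R (y1 - yh)) - q
        = a *\<^sub>R (x1 - xh) - (a + 2 * k) *\<^sub>R (y1 - yh)"
      unfolding yh1 Gx q_def by (simp add: algebra_simps)
    also have "norm \<dots> \<le> norm (a *\<^sub>R (x1 - xh)) + norm ((a + 2 * k) *\<^sub>R (y1 - yh))" by (rule norm_triangle_ineq4)
    also have "\<dots> \<le> a * s + (a + 2) * s"
      using x1s y1s a k by (auto intro!: add_mono mult_mono)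
    also have "\<dots> = (2 * a + 2) * s" by (simp add: algebra_simps)
    finally show ?thesis using s(4) by linarith
  qed
  have "\<bar>f y1 - f yh\<bar> \<le> \<delta> / 8" using y1s s(3) by (intro s2(3)) (auto simp: dist_norm norm_minus_commute)
  with sup s0(2)[OF grad] shift(2) k(4) fxy show False
    unfolding c_def abs_le_iff abs_less_iff by linarith
qed

text \<open>Multiplication by \<open>t > 1\<close> multiplies the operator by \<open>t\<close> but
  the gradient term only by \<open>t^p \<le> t\<close>, so \<open>t * u\<close> gains at least
  \<open>(t - 1) * m\<close>, and zero boundary values are unaffected. Finally \<open>t\<close>
  tends to one.\<close>

lemma solution_le:
  fixes \<Omega> :: "(real^'n) set"
  assumes p: "0 < p" "p < 1" and b: "0 < b" and \<Omega>: "open \<Omega>" "bounded \<Omega>"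
    and f: "continuous_on \<Omega> f" and m: "m > 0" "\<And>x. x \<in> \<Omega> \<Longrightarrow> m \<le> f x"
    and u: "dirichlet_solution p b f \<Omega> u" and v: "dirichlet_solution p b f \<Omega> v" and x0: "x0 \<in> \<Omega>"
  shows "u x0 \<le> v x0"
proof -
  have us: "viscosity_subsolution p b f \<Omega> u" "continuous_on (closure \<Omega>) u" "\<And>x. x \<in> frontier \<Omega> \<Longrightarrow> u x = 0"
    and vs: "viscosity_supersolution p b f \<Omega> v" "continuous_on (closure \<Omega>) v" "\<And>x. x \<in> frontier \<Omega> \<Longrightarrow> v x = 0"
    using u v by (auto simp: dirichlet_solution_def)
  have cu: "convex_on \<Omega> u" using us(1) by (simp add: viscosity_subsolution_def)
  have fpos: "f x > 0" if "x \<in> \<Omega>" for x using m that by force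
  have scaled: "t * u x0 \<le> v x0" if t: "t > 1" for t
  proof (rule strict_comparison[OF \<Omega> f fpos p(1) b, where \<delta>="(t - 1) * m"])
    show "(t - 1) * m > 0" using t m by simp
    show "continuous_on (closure \<Omega>) (\<lambda>x. t * u x)" by (intro continuous_intros us)
    show "convex_on \<Omega> (\<lambda>x. t * u x)" using t cu by (intro convex_on_cmul) auto
    fix x \<psi> G H assume x: "x \<in> \<Omega>" and C: "C2_data \<Omega> \<psi> G H" and max: "local_max_at (\<lambda>y. t * u y - \<psi> y) x"
    have C': "C2_data \<Omega> (\<lambda>y. 1 / t * \<psi> y) (\<lambda>y. (1 / t) *\<^sub>R G y) (\<lambda>y. (1 / t) *\<^sub>R H y)" by (rule C2_data_scale[OF C])
    have max': "local_max_at (\<lambda>y. u y - 1 / t * \<psi> y) x"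
      using max unfolding local_max_at_def
    proof eventually_elim
      case (elim y)
      have "u z - 1 / t * \<psi> z = (t * u z - \<psi> z) / t" for z using t by (simp add: field_simps)
      then show ?case using elim t by (simp add: divide_right_mono)
    qed
    have "convex_on \<Omega> (\<lambda>x. t * u x)" using t cu by (intro convex_on_cmul) auto
    then have nn: "nonneg_sym (H x)" by (rule convex_touched_above_nonneg_sym[OF _ C \<Omega>(1) x max])
    have "f x + b * norm ((1 / t) *\<^sub>R G x) powr p \<le> monge_ampere ((1 / t) *\<^sub>R H x)"
      by (rule viscosity_subsolutionD[OF us(1) \<Omega>(1) x C' max'])
    also have "\<dots> = 1 / t * monge_ampere (H x)" using t by (intro monge_ampere_scale nn) simp
    finally have "t * (f x + b * norm ((1 / t) *\<^sub>R G x) powr p) \<le> t * (1 / t * monge_ampere (H x))"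
      using t by (intro mult_left_mono) auto
    then have le: "t * f x + b * (t * norm ((1 / t) *\<^sub>R G x) powr p) \<le> monge_ampere (H x)"
      using t by (simp add: distrib_left mult_ac)
    have "norm (G x) powr p \<le> t * norm ((1 / t) *\<^sub>R G x) powr p"
    proof -
      have "norm (G x) powr p = t powr p * norm ((1 / t) *\<^sub>R G x) powr p"
        using t by (simp flip: powr_mult)
      also have "\<dots> \<le> t powr 1 * norm ((1 / t) *\<^sub>R G x) powr p"
        using t p by (intro mult_right_mono powr_mono) auto
      finally show ?thesis using t by simp
    qed
    then have "b * norm (G x) powr p \<le> b * (t * norm ((1 / t) *\<^sub>R G x) powr p)" using b by (intro mult_left_mono) auto
    moreover have "(t - 1) * m \<le> (t - 1) * f x" using t m x by (intro mult_left_mono) auto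
    ultimately show "f x + b * norm (G x) powr p + (t - 1) * m \<le> monge_ampere (H x)"
      using le by (simp add: left_diff_distrib)
  qed (use us vs x0 in auto)
  have "((\<lambda>t. t * u x0) \<longlongrightarrow> 1 * u x0) (at_right 1)" by (intro tendsto_intros)
  then have "1 * u x0 \<le> v x0"
    by (rule tendsto_upperbound) (auto simp: eventually_at_right_field scaled intro!: exI[of _ 2])
  then show ?thesis by simp
qed

text \<open>For continuous \<open>f\<close> the set where \<open>|f|\<close> exceeds the essential
  bound is open and null, hence empty.\<close>

lemma essentially_bounded_continuous:
  fixes \<Omega> :: "(real^'n) set"
  assumes \<Omega>: "open \<Omega>" and f: "continuous_on \<Omega> f" and e: "essentially_bounded_on \<Omega> f"
  obtains C where "\<And>x. x \<in> \<Omega> \<Longrightarrow> \<bar>f x\<bar> \<le> C"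
proof -
  obtain C where C: "AE x in lebesgue_on \<Omega>. \<bar>f x\<bar> \<le> C"
    using e unfolding essentially_bounded_on_def by blast
  have ms: "\<Omega> \<in> sets lebesgue" using \<Omega> by auto
  have "AE x in lebesgue. x \<in> \<Omega> \<longrightarrow> \<bar>f x\<bar> \<le> C"
    using C ms by (simp add: AE_restrict_space_iff)
  then obtain N where N: "{x. \<not> (x \<in> \<Omega> \<longrightarrow> \<bar>f x\<bar> \<le> C)} \<subseteq> N" "negligible N"
    unfolding eventually_ae_filter by (auto simp: negligible_iff_null_sets)
  have "\<bar>f x\<bar> \<le> C" if x: "x \<in> \<Omega>" for x
  proof (rule ccontr)
    assume "\<not> \<bar>f x\<bar> \<le> C"
    define S where "S = \<Omega> \<inter> (\<lambda>x. \<bar>f x\<bar>) -` {C<..}"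
    have "open S" unfolding S_def
      using \<Omega> f by (intro continuous_open_preimage continuous_intros) auto
    moreover have "S \<noteq> {}" using x \<open>\<not> \<bar>f x\<bar> \<le> C\<close> by (auto simp: S_def)
    moreover have "negligible S" using N by (rule_tac negligible_subset[of N]) (auto simp: S_def)
    ultimately show False using open_not_negligible by blast
  qed
  then show ?thesis by (rule that)
qed

theorem theorem9:
  fixes p b :: real
    and \<Omega> :: "(real ^ 'n) set"
    and f :: "real ^ 'n \<Rightarrow> real"
  assumes "0 < p" and "p < 1" and "0 < b"
    and "open \<Omega>" and "connected \<Omega>" and "\<Omega> \<noteq> {}" and "bounded \<Omega>"
    and "uniformly_convex_set \<Omega>"
    and "continuous_on \<Omega> f" and "essentially_bounded_on \<Omega> f"
    and "(INF x\<in>\<Omega>. f x) > 0"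
  shows "\<exists>u. dirichlet_solution p b f \<Omega> u \<and>
           (\<forall>v. dirichlet_solution p b f \<Omega> v \<longrightarrow> (\<forall>x\<in>closure \<Omega>. v x = u x))"
proof -
  obtain C where C: "\<And>x. x \<in> \<Omega> \<Longrightarrow> \<bar>f x\<bar> \<le> C"
    using essentially_bounded_continuous[OF assms(4,9,10)] by blast
  \<comment> \<open>An infimum of reals is informative only for a set bounded below;
    \<open>- C\<close> supplies the bound.\<close>
  have low: "(INF x\<in>\<Omega>. f x) \<le> f x" if "x \<in> \<Omega>" for x
  proof (rule cINF_lower[OF bdd_belowI2[of _ "- C"] that])
    show "- C \<le> f y" if "y \<in> \<Omega>" for y using C[OF that] by linarith
  qed
  have fpos: "f x > 0" if "x \<in> \<Omega>" for x using low[OF that] assms(11) by linarith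
  have fC: "f x \<le> C" if "x \<in> \<Omega>" for x using C[OF that] by linarith
  obtain u where u: "dirichlet_solution p b f \<Omega> u"
    using dirichlet_solution_exists[OF assms(1-4,7,6,8,9) fpos fC] by blast
  have "v x = u x" if v: "dirichlet_solution p b f \<Omega> v" and x: "x \<in> closure \<Omega>" for v x
  proof (cases "x \<in> \<Omega>")
    case True
    have "u1 x \<le> u2 x" if "dirichlet_solution p b f \<Omega> u1" "dirichlet_solution p b f \<Omega> u2" for u1 u2
      by (rule solution_le[OF assms(1-4,7,9,11)]) (use low that True in auto)
    then show ?thesis using u v by (blast intro: antisym)
  next
    case False
    then have "x \<in> frontier \<Omega>" using x assms(4) by (simp add: frontier_def interior_open)
    then show ?thesis using u v by (simp add: dirichlet_solution_def)
  qed
  with u show ?thesis by blast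
qed

end
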